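(* Let $X\subset\mathcal{A}^{\mathbb{Z}^2}$ be a strongly irreducible two-dimensional subshift of finite type defined by a collection $\mathcal{L}\subset\mathcal{A}^{\Lambda_{\rm cross}}$ of allowed patches, and let $\Phi$ be a one-letter interaction given by a function $\Phi_{\rm o}:\mathcal{A}\to\mathbb{R}$ such that $\Phi_{\rm o}(\mathcal{A})\subset\epsilon_0 S$ for some $\epsilon_0>0$ and some finite set $S\subset\{0,1,2,\dots\}$. For each integer $N\geq 1$ let $X_N$ be the associated split subshift, let $\pi_c:X_N\to X$ be the color projection, and let $\beta_N=\log(N)/\epsilon_0$. Then the transformation $\mu\mapsto\pi_c^*(\mu):=\mu\circ\pi_c^{-1}$ is a homeomorphism between $\mathrm{Max}(X_N)$ and $\mathcal{E}_{\beta_N}(\Phi)$ with respect to the respective weak topologies, and it satisfies $$\pi_c^*(\lambda\mu+(1-\lambda)\nu)=\lambda\,\pi_c^*\mu+(1-\lambda)\,\pi_c^*\nu$$ for all $\mu,\nu\in\mathrm{Max}(X_N)$ and every $\lambda\in[0,1]$.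
   Context: $\mathcal{A}$ is a finite alphabet and $\Lambda_{\rm cross}=\{(0,0),(\pm1,0),(0,\pm1)\}\subset\mathbb{Z}^2$. The shifts are $(\sigma_z x)_s=x_{z+s}$ and $\sigma=\{\sigma_z:z\in\mathbb{Z}^2\}$. The subshift defined by $\mathcal{L}\subset\mathcal{A}^{\Lambda_{\rm cross}}$ is $X=\{x\in\mathcal{A}^{\mathbb{Z}^2}:(\sigma_zx)_{\Lambda_{\rm cross}}\in\mathcal{L}\text{ for all }z\in\mathbb{Z}^2\}$. For $\Lambda\subset\mathbb{Z}^2$ and $a\in\mathcal{A}^\Lambda$, $[a]=\{x\in X:x_\Lambda=a\}$; the patch $a$ is admissible if $[a]\neq\emptyset$. For disjoint $\Lambda,\Lambda'$ and $a\in\mathcal{A}^\Lambda$, $b\in\mathcal{A}^{\Lambda'}$, $a\oplus b\in\mathcal{A}^{\Lambda\cup\Lambda'}$ denotes the patch restricting to $a$ on $\Lambda$ and to $b$ on $\Lambda'$. $X$ is strongly irreducible if there is $\ell>0$ such that for all disjoint finite $\Lambda,\Lambda'\subset\mathbb{Z}^2$ with $\mathrm{dist}(\Lambda,\Lambda')\ge\ell$ and all admissible $a\in\mathcal{A}^\Lambda$, $b\in\mathcal{A}^{\Lambda'}$, one has $[a\oplus b]\ne\emptyset$. $\mathcal{M}^1_\sigma(X)$ is the set of $\sigma$-invariant Borel probability measures on $X$, with the weak topology. With $\Lambda_n=[-n,n]^2\cap\mathbb{Z}^2$, the entropy of $\mu\in\mathcal{M}^1_\sigma(X)$ is $h_\sigma(\mu)=-\lim_n|\Lambda_n|^{-1}\sum_{a\in\mathcal{A}^{\Lambda_n}}\mu[a]\log\mu[a]$,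 the topological entropy $h_{\rm top}(X)$ is $\lim_n|\Lambda_n|^{-1}\log|\{a\in\mathcal{A}^{\Lambda_n}:[a]\neq\emptyset\}|$, and $\mathrm{Max}(X)=\{\mu\in\mathcal{M}^1_\sigma(X):h_\sigma(\mu)=h_{\rm top}(X)\}$. The same definitions apply to $X_N$. Equilibrium states: for finite $\Lambda\subset\mathbb{Z}^2$ the energy is $H_\Lambda(y)=\sum_{z\in\Lambda}\Phi_{\rm o}(y_z)$, and $\partial^r\Lambda=\{z\in\mathbb{Z}^2\setminus\Lambda:\mathrm{dist}(z,\Lambda)\le r\}$, with $\mathrm{dist}$ the $\ell^1$ distance and $r=2$. $\mathcal{E}_\beta(\Phi)$ is the set of $\mu\in\mathcal{M}^1_\sigma(X)$ such that for all finite $\Lambda$, all finite $\Lambda'\supset\Lambda\cup\partial^r\Lambda$, and every admissible $a\in\mathcal{A}^{\Lambda'}$ with $\mu([a_{\Lambda'\setminus\Lambda}])>0$, $$\frac{\mu([a])}{\mu([a_{\Lambda'\setminus\Lambda}])}=\frac{e^{-\beta H_\Lambda(a)}}{\sum_{b\in\mathcal{A}^\Lambda:\,[b\oplus a_{\partial^r\Lambda}]\neq\emptyset}e^{-\beta H_\Lambda(b\oplus a_{\partial^r\Lambda})}}.$$ The split subshift: for $s\in S$ let $\mathcal{A}_s=\{a\in\mathcal{A}:\Phi_{\rm o}(a)=\epsilon_0 s\}$ and $N_s=N^{\max S-s}$. Let $\mathcal{A}_N=\bigcup_{s\in S}(\mathcal{A}_s\times\{0,1,\dots,N_s-1\})$,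 and let $\pi_c$ be the projection on the first coordinate, extended coordinatewise to patches and configurations. $X_N\subset\mathcal{A}_N^{\mathbb{Z}^2}$ is the subshift of finite type defined by the allowed patches $\mathcal{L}_N=\{\mathbf{a}\in\mathcal{A}_N^{\Lambda_{\rm cross}}:\pi_c(\mathbf{a})\in\mathcal{L}\}$. *)

theory Defs
  imports "HOL-Probability.Probability"
begin

text \<open>
  Configurations are functions on all of \<open>int \<times> int\<close>. A patch on \<open>\<Lambda>\<close> is an element of
  \<open>\<Lambda> \<rightarrow>\<^sub>E A\<close>, so that it carries no information outside \<open>\<Lambda>\<close>; the patch \<open>x\<^sub>\<Lambda>\<close> is
  \<open>restrict x \<Lambda>\<close>, and \<open>a \<oplus> b\<close> is \<open>merge \<Lambda> \<Lambda>' (a, b)\<close>.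
  The alphabet is an explicit finite set \<open>A\<close>, because the split alphabet depends on \<open>N\<close>.
\<close>

type_synonym site = "int \<times> int"
type_synonym 'a config = "site \<Rightarrow> 'a"

definition l1_dist :: "site \<Rightarrow> site \<Rightarrow> nat" where
  "l1_dist z w = nat (\<bar>fst z - fst w\<bar> + \<bar>snd z - snd w\<bar>)"

text \<open>Valued in \<^typ>\<open>enat\<close> so that the distance to the empty set is infinite.\<close>

definition l1_setdist :: "site set \<Rightarrow> site set \<Rightarrow> enat" where
  "l1_setdist \<Lambda> \<Lambda>' = (INF z\<in>\<Lambda>. INF w\<in>\<Lambda>'. enat (l1_dist z w))"

definition outer_boundary :: "nat \<Rightarrow> site set \<Rightarrow> site set" where
  "outer_boundary r \<Lambda> = {z. z \<notin> \<Lambda> \<and> l1_setdist {z} \<Lambda> \<le> enat r}"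

definition cross :: "site set" where
  "cross = {(0, 0), (1, 0), (-1, 0), (0, 1), (0, -1)}"

definition box :: "nat \<Rightarrow> site set" where
  "box n = {- int n..int n} \<times> {- int n..int n}"

definition shift :: "site \<Rightarrow> 'a config \<Rightarrow> 'a config" where
  "shift z x = (\<lambda>s. x (z + s))"

definition subshift :: "'a set \<Rightarrow> 'a config set \<Rightarrow> 'a config set" where
  "subshift A L = {x \<in> UNIV \<rightarrow>\<^sub>E A. \<forall>z. restrict (shift z x) cross \<in> L}"

definition cylinder :: "'a config set \<Rightarrow> site set \<Rightarrow> 'a config \<Rightarrow> 'a config set" where
  "cylinder X \<Lambda> a = {x \<in> X. restrict x \<Lambda> = a}"

definition admissible :: "'a config set \<Rightarrow> site set \<Rightarrow> 'a config \<Rightarrow> bool" where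
  "admissible X \<Lambda> a \<longleftrightarrow> cylinder X \<Lambda> a \<noteq> {}"

definition strongly_irreducible :: "'a set \<Rightarrow> 'a config set \<Rightarrow> bool" where
  "strongly_irreducible A X \<longleftrightarrow>
    (\<exists>l::nat. l > 0 \<and>
      (\<forall>\<Lambda> \<Lambda>'. finite \<Lambda> \<longrightarrow> finite \<Lambda>' \<longrightarrow> \<Lambda> \<inter> \<Lambda>' = {} \<longrightarrow> enat l \<le> l1_setdist \<Lambda> \<Lambda>' \<longrightarrow>
        (\<forall>a \<in> \<Lambda> \<rightarrow>\<^sub>E A. \<forall>b \<in> \<Lambda>' \<rightarrow>\<^sub>E A. admissible X \<Lambda> a \<longrightarrow> admissible X \<Lambda>' b \<longrightarrow>
          cylinder X (\<Lambda> \<union> \<Lambda>') (merge \<Lambda> \<Lambda>' (a, b)) \<noteq> {})))"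

definition config_topology :: "'a set \<Rightarrow> 'a config set \<Rightarrow> 'a config topology" where
  "config_topology A X = subtopology (product_topology (\<lambda>_. discrete_topology A) UNIV) X"

definition config_borel :: "'a set \<Rightarrow> 'a config set \<Rightarrow> 'a config measure" where
  "config_borel A X =
    sigma (topspace (config_topology A X)) {U. openin (config_topology A X) U}"

definition invariant_measures :: "'a set \<Rightarrow> 'a config set \<Rightarrow> 'a config measure set" where
  "invariant_measures A X =
    {\<mu>. prob_space \<mu> \<and> space \<mu> = space (config_borel A X) \<and> sets \<mu> = sets (config_borel A X) \<and>
      (\<forall>z. distr \<mu> (config_borel A X) (shift z) = \<mu>)}"

text \<open>The coarsest topology making \<open>\<mu> \<mapsto> \<integral>f d\<mu>\<close> continuous for every continuous real \<open>f\<close>;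
  boundedness of \<open>f\<close> is automatic on a compact subshift.\<close>

definition weak_topology :: "'a set \<Rightarrow> 'a config set \<Rightarrow> 'a config measure topology" where
  "weak_topology A X = topology_generated_by
    {{\<mu> \<in> invariant_measures A X. integral\<^sup>L \<mu> f \<in> U} | f U.
      continuous_map (config_topology A X) euclideanreal f \<and> open U}"

text \<open>Since \<^term>\<open>ln (0::real) = 0\<close>, the convention \<open>0 log 0 = 0\<close> is respected.\<close>

definition measure_entropy :: "'a set \<Rightarrow> 'a config set \<Rightarrow> 'a config measure \<Rightarrow> real" where
  "measure_entropy A X \<mu> =
    - lim (\<lambda>n. (\<Sum>a \<in> box n \<rightarrow>\<^sub>E A.
        measure \<mu> (cylinder X (box n) a) * ln (measure \<mu> (cylinder X (box n) a)))
      / real (card (box n)))"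

definition top_entropy :: "'a set \<Rightarrow> 'a config set \<Rightarrow> real" where
  "top_entropy A X =
    lim (\<lambda>n. ln (real (card {a \<in> box n \<rightarrow>\<^sub>E A. cylinder X (box n) a \<noteq> {}}))
      / real (card (box n)))"

definition max_entropy_measures :: "'a set \<Rightarrow> 'a config set \<Rightarrow> 'a config measure set" where
  "max_entropy_measures A X =
    {\<mu> \<in> invariant_measures A X. measure_entropy A X \<mu> = top_entropy A X}"

text \<open>\<open>t \<mu> + (1 - t) \<nu>\<close>, for measures on the same measurable space.\<close>

definition convex_comb :: "real \<Rightarrow> 'b measure \<Rightarrow> 'b measure \<Rightarrow> 'b measure" where
  "convex_comb t \<mu> \<nu> = measure_of (space \<mu>) (sets \<mu>)
    (\<lambda>B. ennreal t * emeasure \<mu> B + ennreal (1 - t) * emeasure \<nu> B)"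

definition energy :: "('a \<Rightarrow> real) \<Rightarrow> site set \<Rightarrow> 'a config \<Rightarrow> real" where
  "energy \<Phi> \<Lambda> y = (\<Sum>z\<in>\<Lambda>. \<Phi> (y z))"

definition equilibrium_states ::
    "'a set \<Rightarrow> 'a config set \<Rightarrow> ('a \<Rightarrow> real) \<Rightarrow> real \<Rightarrow> 'a config measure set" where
  "equilibrium_states A X \<Phi> \<beta> =
    {\<mu> \<in> invariant_measures A X.
      \<forall>\<Lambda> \<Lambda>'. finite \<Lambda> \<longrightarrow> finite \<Lambda>' \<longrightarrow> \<Lambda> \<union> outer_boundary 2 \<Lambda> \<subseteq> \<Lambda>' \<longrightarrow>
        (\<forall>a \<in> \<Lambda>' \<rightarrow>\<^sub>E A. admissible X \<Lambda>' a \<longrightarrow>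
          measure \<mu> (cylinder X (\<Lambda>' - \<Lambda>) (restrict a (\<Lambda>' - \<Lambda>))) > 0 \<longrightarrow>
          (let D = outer_boundary 2 \<Lambda>;
               glue = (\<lambda>b. merge \<Lambda> D (b, restrict a D))
           in measure \<mu> (cylinder X \<Lambda>' a)
                / measure \<mu> (cylinder X (\<Lambda>' - \<Lambda>) (restrict a (\<Lambda>' - \<Lambda>)))
              = exp (- \<beta> * energy \<Phi> \<Lambda> a)
                / (\<Sum>b \<in> {b \<in> \<Lambda> \<rightarrow>\<^sub>E A. cylinder X (\<Lambda> \<union> D) (glue b) \<noteq> {}}.
                     exp (- \<beta> * energy \<Phi> \<Lambda> (glue b)))))}"

definition level_set :: "'a set \<Rightarrow> ('a \<Rightarrow> real) \<Rightarrow> real \<Rightarrow> nat \<Rightarrow> 'a set" where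
  "level_set A \<Phi> \<epsilon> s = {a \<in> A. \<Phi> a = \<epsilon> * real s}"

definition split_alphabet ::
    "'a set \<Rightarrow> ('a \<Rightarrow> real) \<Rightarrow> real \<Rightarrow> nat set \<Rightarrow> nat \<Rightarrow> ('a \<times> nat) set" where
  "split_alphabet A \<Phi> \<epsilon> S N = (\<Union>s\<in>S. level_set A \<Phi> \<epsilon> s \<times> {..<N ^ (Max S - s)})"

definition color_proj :: "('a \<times> nat) config \<Rightarrow> 'a config" where
  "color_proj x = (\<lambda>z. fst (x z))"

definition split_patches ::
    "'a set \<Rightarrow> 'a config set \<Rightarrow> ('a \<Rightarrow> real) \<Rightarrow> real \<Rightarrow> nat set \<Rightarrow> nat \<Rightarrow> ('a \<times> nat) config set" where
  "split_patches A L \<Phi> \<epsilon> S N =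
    {a \<in> cross \<rightarrow>\<^sub>E split_alphabet A \<Phi> \<epsilon> S N. restrict (color_proj a) cross \<in> L}"

definition split_subshift ::
    "'a set \<Rightarrow> 'a config set \<Rightarrow> ('a \<Rightarrow> real) \<Rightarrow> real \<Rightarrow> nat set \<Rightarrow> nat \<Rightarrow> ('a \<times> nat) config set" where
  "split_subshift A L \<Phi> \<epsilon> S N =
    subshift (split_alphabet A \<Phi> \<epsilon> S N) (split_patches A L \<Phi> \<epsilon> S N)"

definition color_pushforward ::
    "'a set \<Rightarrow> 'a config set \<Rightarrow> ('a \<times> nat) config measure \<Rightarrow> 'a config measure" where
  "color_pushforward A X \<mu> = distr \<mu> (config_borel A X) color_proj"

end

theory Submission
  imports Defs
begin

text \<open>
  Both sets of measures are described by conditional distributions in finite windows, and the color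
  projection translates one description into the other.

  On a strongly irreducible subshift of finite type the measures of maximal entropy are exactly the
  invariant measures for which, given the configuration around a finite window, all admissible fillings of
  the window are equally likely (\<open>max_entropy_iff_gibbs\<close>). If the conditional distribution in some window
  is not uniform, its relative entropy with respect to the uniform one has a positive mean, the same for all
  translates of the window. In a large box one can place disjoint translates in number proportional to the
  area, and the Gibbs inequality shows that each of them lowers the block entropy by this amount below the
  logarithm of the number of patches (\<open>block_entropy_le_deficit\<close>); so the entropy is not maximal. Conversely,
  strong irreducibility leaves, for every boundary condition of \<open>box (n + l)\<close>, at least as many fillings as
  there are patches on \<open>box n\<close>. If fillings are equally likely, every patch on \<open>box (n + l)\<close> is correspondingly
  unlikely, and the entropy is as large as it can be (\<open>gibbs_imp_max_entropy\<close>).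

  The letter \<open>a\<close> with \<open>\<Phi> a = \<epsilon> s\<close> is split into \<open>\<kappa> a = N ^ (Max S - s)\<close> copies, and \<open>\<beta>\<close> is chosen such that
  \<open>\<kappa> a\<close> is a constant multiple of \<open>exp (- \<beta> * \<Phi> a)\<close>. As the split subshift constrains only the
  colors, the number of fillings upstairs is the partition sum of the fillings downstairs
  (\<open>card_fillings_split\<close>). A uniform Gibbs measure upstairs cannot tell apart patches with the same colors, so
  it spreads the mass of each color cylinder evenly over the cylinders above it (\<open>gibbs_uniform_lift\<close>);
  for such a measure the uniform Gibbs property upstairs and the Gibbs property for the weights \<open>\<kappa>\<close>
  downstairs are the same equations (\<open>uniform_lift_gibbs_iff\<close>). This makes the projection injective. It is
  onto because every measure downstairs has such an even lift: decorate the configuration with independent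
  labels, uniform on a common multiple of all \<open>\<kappa> a\<close>, and reduce each label modulo the multiplicity of its
  letter (\<open>lift_measure_uniform_lift\<close>). Finally, pushing forward and lifting are dual to operators on
  continuous functions, composition with the projection and averaging over the labels, and this gives
  continuity in both directions.
\<close>

section \<open>Relative entropy of finite distributions\<close>
text \<open>
  Relative entropy is nonnegative and vanishes only for equal distributions. The comparison is made term by
  term: \<open>p ln (q / p) \<le> q - p\<close> because \<open>ln x \<le> x - 1\<close>, where equality forces \<open>x = 1\<close>. Terms with
  \<open>p = 0\<close> contribute the gap \<open>q\<close>. Allowing \<open>q\<close> to have smaller mass than \<open>p\<close> spares the
  normalization of the comparison distributions below.
\<close>
lemma
  fixes p q :: "'i \<Rightarrow> real"
  assumes fin: "finite I"
    and p0: "\<And>i. i \<in> I \<Longrightarrow> 0 \<le> p i" and q0: "\<And>i. i \<in> I \<Longrightarrow> 0 \<le> q i"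
    and ac: "\<And>i. i \<in> I \<Longrightarrow> 0 < p i \<Longrightarrow> 0 < q i"
    and sums: "(\<Sum>i\<in>I. q i) \<le> (\<Sum>i\<in>I. p i)"
  shows gibbs_inequality: "(\<Sum>i\<in>I. p i * ln (q i)) \<le> (\<Sum>i\<in>I. p i * ln (p i))"
    and gibbs_equality: "(\<Sum>i\<in>I. p i * ln (p i)) \<le> (\<Sum>i\<in>I. p i * ln (q i)) \<Longrightarrow> i \<in> I \<Longrightarrow> p i = q i"
proof -
  let ?gap = "\<lambda>i. (q i - p i) - (p i * ln (q i) - p i * ln (p i))"
  have gap_pos: "?gap i = p i * ((q i / p i - 1) - ln (q i / p i))" if "i \<in> I" "0 < p i" for i
    using that ac[OF that] by (simp add: ln_div algebra_simps)
  have gap: "0 \<le> ?gap i" if "i \<in> I" for i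
  proof (cases "p i = 0")
    case False
    then have "0 < p i" using p0[OF that] by simp
    moreover have "ln (q i / p i) \<le> q i / p i - 1"
      using calculation ac that by (intro ln_le_minus_one) simp
    ultimately show ?thesis using gap_pos[OF that] by simp
  qed (use q0[OF that] in simp)
  have total: "(\<Sum>i\<in>I. ?gap i)
      = ((\<Sum>i\<in>I. q i) - (\<Sum>i\<in>I. p i)) - ((\<Sum>i\<in>I. p i * ln (q i)) - (\<Sum>i\<in>I. p i * ln (p i)))"
    by (simp add: sum_subtractf)
  have "0 \<le> (\<Sum>i\<in>I. ?gap i)" by (rule sum_nonneg) (rule gap)
  then show "(\<Sum>i\<in>I. p i * ln (q i)) \<le> (\<Sum>i\<in>I. p i * ln (p i))"
    using total sums by linarith
  show "p i = q i" if le: "(\<Sum>i\<in>I. p i * ln (p i)) \<le> (\<Sum>i\<in>I. p i * ln (q i))" and i: "i \<in> I" for i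
  proof -
    have "(\<Sum>i\<in>I. ?gap i) \<le> 0" using total sums le by linarith
    then have "(\<Sum>i\<in>I. ?gap i) = 0" using \<open>0 \<le> (\<Sum>i\<in>I. ?gap i)\<close> by linarith
    then have zero: "?gap i = 0"
      using i gap fin by (subst (asm) sum_nonneg_eq_0_iff) auto
    show ?thesis
    proof (cases "p i = 0")
      case True then show ?thesis using zero by simp
    next
      case False
      then have pos: "0 < p i" using p0[OF i] by simp
      then have "ln (q i / p i) = q i / p i - 1" using zero gap_pos[OF i] by simp
      then have "q i / p i = 1" using pos ac[OF i] by (intro ln_eq_minus_one) auto
      then show ?thesis using pos by simp
    qed
  qed
qed

section \<open>Packings of boxes and densities of subadditive functions\<close>
lemma card_box: "card (box n) = (2 * n + 1)\<^sup>2"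
proof -
  have "card {- int n..int n} = 2 * n + 1" by simp
  then show ?thesis by (simp only: box_def card_cartesian_product power2_eq_square)
qed

lemma finite_box [simp]: "finite (box n)"
  by (simp add: box_def)

lemma box_nonempty [simp]: "box n \<noteq> {}"
  by (simp add: box_def)

lemma box_mono: "m \<le> n \<Longrightarrow> box m \<subseteq> box n"
  by (auto simp: box_def)

lemma finite_subset_box:
  assumes "finite \<Lambda>"
  obtains n where "\<Lambda> \<subseteq> box n"
proof -
  have "\<exists>n. \<Lambda> \<subseteq> box n" using assms
  proof induction
    case (insert z \<Lambda>)
    then obtain n where n: "\<Lambda> \<subseteq> box n" by blast
    define k where "k = max n (nat (max \<bar>fst z\<bar> \<bar>snd z\<bar>))"
    have "z \<in> box k" by (cases z) (auto simp: k_def box_def)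
    moreover have "\<Lambda> \<subseteq> box k" using n box_mono[of n k] by (auto simp: k_def)
    ultimately show ?case by (intro exI[of _ k]) simp
  qed simp
  then show thesis using that by blast
qed

text \<open>
  Along each axis the copies of the smaller box sit at spacing \<open>2 m + 1\<close>, its side length, beginning in a
  corner of the larger box.
\<close>
lemma box_packing:
  obtains T where "finite T" "card T = ((2 * n + 1) div (2 * m + 1))\<^sup>2"
    "\<And>t. t \<in> T \<Longrightarrow> (+) t ` box m \<subseteq> box n"
    "\<And>s t. s \<in> T \<Longrightarrow> t \<in> T \<Longrightarrow> s \<noteq> t \<Longrightarrow> (+) s ` box m \<inter> (+) t ` box m = {}"
proof -
  define w where "w = 2 * int m + 1"
  define q where "q = (2 * n + 1) div (2 * m + 1)"
  define c where "c = (\<lambda>i::nat. int m - int n + w * int i)"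
  define T where "T = (\<lambda>(i, j). (c i, c j)) ` ({..<q} \<times> {..<q})"
  have w: "w > 0" by (simp add: w_def)
  have qw: "w * int q \<le> 2 * int n + 1"
  proof -
    have "(2 * m + 1) * q \<le> 2 * n + 1" unfolding q_def by (rule times_div_less_eq_dividend)
    then have "int ((2 * m + 1) * q) \<le> int (2 * n + 1)" by (simp only: of_nat_le_iff)
    then show ?thesis by (simp add: w_def algebra_simps)
  qed
  have inj: "i = j" if "\<bar>c i - c j\<bar> < w" for i j
  proof -
    have "\<bar>c i - c j\<bar> = w * \<bar>int i - int j\<bar>"
      using w by (simp add: c_def abs_mult right_diff_distrib[symmetric])
    then have "\<bar>int i - int j\<bar> < 1" using that w by (simp add: mult_less_cancel_left2)
    then show ?thesis by simp
  qed
  have "inj c" by (rule injI) (use inj w in simp)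
  then have "inj_on (\<lambda>(i, j). (c i, c j)) ({..<q} \<times> {..<q})"
    by (auto simp: inj_on_def)
  then have card: "card T = q\<^sup>2"
    by (simp add: T_def card_image power2_eq_square)
  have rng: "- int n + int m \<le> c i" "c i \<le> int n - int m" if "i < q" for i
  proof -
    have "int i + 1 \<le> int q" using that by simp
    then have "w * (int i + 1) \<le> w * int q" using w by (intro mult_left_mono) auto
    then have "w * int i + w \<le> 2 * int n + 1" using qw by (simp add: distrib_left)
    then show "c i \<le> int n - int m" by (simp add: c_def w_def)
    show "- int n + int m \<le> c i" using w by (simp add: c_def)
  qed
  have sub: "(+) t ` box m \<subseteq> box n" if "t \<in> T" for t
    using that rng by (fastforce simp: T_def box_def)
  have disj: "(+) s ` box m \<inter> (+) t ` box m = {}" if st: "s \<in> T" "t \<in> T" "s \<noteq> t" for s t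
  proof (rule ccontr)
    assume "(+) s ` box m \<inter> (+) t ` box m \<noteq> {}"
    then obtain u v where uv: "u \<in> box m" "v \<in> box m" "s + u = t + v" by blast
    obtain i j i' j' where ij: "s = (c i, c j)" "t = (c i', c j')" using st by (auto simp: T_def)
    have "\<bar>c i - c i'\<bar> < w" "\<bar>c j - c j'\<bar> < w"
      using uv by (auto simp: ij box_def w_def)
    then show False using inj st ij by blast
  qed
  show thesis using that[of T] card sub disj by (simp add: T_def q_def)
qed

text \<open>
  Along each axis the packing leaves less than one period \<open>2 m + 1\<close> of the side \<open>2 n + 1\<close> uncovered.
\<close>
lemma packing_density:
  "(\<lambda>n. real (((2 * n + 1) div (2 * m + 1))\<^sup>2 * (2 * m + 1)\<^sup>2) / real (card (box n))) \<longlonglongrightarrow> 1"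
proof -
  let ?q = "\<lambda>n. real ((2 * n + 1) div (2 * m + 1)) * real (2 * m + 1) / real (2 * n + 1)"
  have "?q \<longlonglongrightarrow> 1"
  proof (rule tendsto_sandwich)
    show "\<forall>\<^sub>F n in sequentially. 1 - real (2 * m + 1) / real (2 * n + 1) \<le> ?q n"
    proof (rule always_eventually, rule allI)
      fix n
      have "(2 * n + 1) div (2 * m + 1) * (2 * m + 1) + (2 * n + 1) mod (2 * m + 1) = 2 * n + 1"
        by (rule div_mult_mod_eq)
      moreover have "(2 * n + 1) mod (2 * m + 1) < 2 * m + 1" by (rule mod_less_divisor) simp
      ultimately have "2 * n + 1 \<le> (2 * n + 1) div (2 * m + 1) * (2 * m + 1) + (2 * m + 1)"
        by linarith
      then have "real (2 * n + 1) \<le> real ((2 * n + 1) div (2 * m + 1) * (2 * m + 1) + (2 * m + 1))"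
        by (simp only: of_nat_le_iff)
      then have "(real (2 * n + 1) - real (2 * m + 1)) / real (2 * n + 1)
          \<le> real ((2 * n + 1) div (2 * m + 1) * (2 * m + 1)) / real (2 * n + 1)"
        by (intro divide_right_mono) simp_all
      moreover have "(real (2 * n + 1) - real (2 * m + 1)) / real (2 * n + 1)
          = 1 - real (2 * m + 1) / real (2 * n + 1)"
        by (subst diff_divide_distrib) simp
      ultimately show "1 - real (2 * m + 1) / real (2 * n + 1) \<le> ?q n"
        by (simp only: of_nat_mult)
    qed
    show "\<forall>\<^sub>F n in sequentially. ?q n \<le> 1"
    proof (rule always_eventually, rule allI)
      fix n
      have "(2 * n + 1) div (2 * m + 1) * (2 * m + 1) \<le> 2 * n + 1" by (rule div_times_less_eq_dividend)
      then have "real ((2 * n + 1) div (2 * m + 1) * (2 * m + 1)) \<le> real (2 * n + 1)"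
        by (simp only: of_nat_le_iff)
      then show "?q n \<le> 1" by (simp add: divide_le_eq algebra_simps)
    qed
    have "filterlim (\<lambda>n::nat. real (2 * n + 1)) at_top sequentially" 
      by (rule filterlim_at_top_mono[OF filterlim_real_sequentially]) simp
    then have "(\<lambda>n. real (2 * m + 1) / real (2 * n + 1)) \<longlonglongrightarrow> 0"
      by (rule real_tendsto_divide_at_top[OF tendsto_const])
    from tendsto_diff[OF tendsto_const this, of 1]
    show "(\<lambda>n. 1 - real (2 * m + 1) / real (2 * n + 1)) \<longlonglongrightarrow> 1" by simp
  qed simp
  from tendsto_power[OF this, of 2] show ?thesis
    by (simp only: card_box power_divide power_mult_distrib of_nat_mult of_nat_power power_one)
qed

text \<open>
  Fekete's argument. Pack \<open>box n\<close> with copies of \<open>box m\<close> and pay \<open>F {0}\<close> for every uncovered site: the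
  density on \<open>box n\<close> exceeds the density on \<open>box m\<close> by at most an error that vanishes as \<open>n\<close> grows,
  so the densities tend to their infimum.
\<close>
lemma box_density_convergent:
  fixes F :: "site set \<Rightarrow> real"
  assumes nonneg: "\<And>\<Lambda>. finite \<Lambda> \<Longrightarrow> 0 \<le> F \<Lambda>"
    and empty: "F {} \<le> 0"
    and subadd: "\<And>\<Lambda> \<Delta>. finite \<Lambda> \<Longrightarrow> finite \<Delta> \<Longrightarrow> F (\<Lambda> \<union> \<Delta>) \<le> F \<Lambda> + F \<Delta>"
    and trans: "\<And>t \<Lambda>. finite \<Lambda> \<Longrightarrow> F ((+) t ` \<Lambda>) = F \<Lambda>"
  shows "convergent (\<lambda>n. F (box n) / real (card (box n)))"
proof -
  define g where "g = (\<lambda>n. F (box n) / real (card (box n)))"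
  define C where "C = F {0}"
  have Union: "F (\<Union>i\<in>I. U i) \<le> (\<Sum>i\<in>I. F (U i))"
    if "finite I" "\<And>i. i \<in> I \<Longrightarrow> finite (U i)" for I :: "site set" and U
    using that
  proof induction
    case (insert i I)
    have "F (U i \<union> (\<Union>i\<in>I. U i)) \<le> F (U i) + F (\<Union>i\<in>I. U i)"
      using insert by (intro subadd) auto
    then show ?case using insert by simp
  qed (use empty in simp)
  have upper: "F R \<le> real (card R) * C" if "finite R" for R
  proof -
    have "F (\<Union>z\<in>R. (+) z ` {0}) \<le> (\<Sum>z\<in>R. F ((+) z ` {0}))"
      using that by (intro Union) auto
    also have "\<dots> = (\<Sum>z\<in>R. C)" by (rule sum.cong) (use trans[of "{0}"] in \<open>simp_all add: C_def\<close>)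
    finally show ?thesis by simp
  qed
  \<comment> \<open>The fraction of \<open>box n\<close> covered by the packing with copies of \<open>box m\<close>.\<close>
  let ?\<rho> = "\<lambda>m n. real (((2 * n + 1) div (2 * m + 1))\<^sup>2 * (2 * m + 1)\<^sup>2) / real (card (box n))"
  have step: "g n \<le> ?\<rho> m n * g m + (1 - ?\<rho> m n) * C" for m n
  proof -
    obtain T where T: "finite T" "card T = ((2 * n + 1) div (2 * m + 1))\<^sup>2"
      "\<And>t. t \<in> T \<Longrightarrow> (+) t ` box m \<subseteq> box n"
      "\<And>s t. s \<in> T \<Longrightarrow> t \<in> T \<Longrightarrow> s \<noteq> t \<Longrightarrow> (+) s ` box m \<inter> (+) t ` box m = {}"
      using box_packing[of n m] by metis
    define P where "P = (\<Union>t\<in>T. (+) t ` box m)"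
    have cardP: "card P = card T * card (box m)"
    proof -
      have "card P = (\<Sum>t\<in>T. card ((+) t ` box m))" unfolding P_def
        using T by (intro card_UN_disjoint) auto
      also have "\<dots> = (\<Sum>t\<in>T. card (box m))" by (intro sum.cong refl card_image) auto
      finally show ?thesis by simp
    qed
    have Psub: "P \<subseteq> box n" using T(3) by (auto simp: P_def)
    have finP: "finite P" using Psub finite_box finite_subset by blast
    have "F (box n) = F (P \<union> (box n - P))" using Psub by (simp add: Un_absorb1)
    also have "\<dots> \<le> F P + F (box n - P)" using finP by (intro subadd) auto
    also have "F P \<le> (\<Sum>t\<in>T. F ((+) t ` box m))" unfolding P_def using T(1) by (intro Union) auto
    also have "\<dots> = real (card T) * F (box m)" by (simp add: trans)
    also have "F (box n - P) \<le> real (card (box n - P)) * C" by (rule upper) simp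
    also have "real (card (box n - P)) = real (card (box n)) - real (card P)"
      using card_mono[OF finite_box Psub] by (simp add: card_Diff_subset[OF finP Psub] of_nat_diff)
    finally have "F (box n) \<le> real (card T) * F (box m) + (real (card (box n)) - real (card P)) * C"
      by simp
    then have "g n \<le> (real (card T) * F (box m) + (real (card (box n)) - real (card P)) * C) / real (card (box n))"
      by (simp add: g_def divide_right_mono)
    also have "\<dots> = real (card P) / real (card (box n)) * g m + (1 - real (card P) / real (card (box n))) * C"
      by (simp add: g_def cardP card_box field_simps)
    finally show ?thesis by (simp add: cardP T(2) card_box)
  qed
  have g0: "0 \<le> g n" for n using nonneg[of "box n"] by (simp add: g_def)
  have bdd: "bdd_below (range g)" using g0 by (intro bdd_belowI[of _ 0]) auto
  have "g \<longlonglongrightarrow> Inf (range g)"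
  proof (rule LIMSEQ_I)
    fix r :: real assume r: "0 < r"
    obtain m where m: "g m < Inf (range g) + r / 2"
      using r cInf_lessD[of "range g" "Inf (range g) + r / 2"] by auto
    have "(\<lambda>n. ?\<rho> m n * g m + (1 - ?\<rho> m n) * C) \<longlonglongrightarrow> 1 * g m + (1 - 1) * C"
      by (intro tendsto_intros packing_density)
    then have "\<forall>\<^sub>F n in sequentially. ?\<rho> m n * g m + (1 - ?\<rho> m n) * C < Inf (range g) + r"
      using m r by (intro order_tendstoD(2)) auto
    then obtain n0 where n0: "\<And>n. n \<ge> n0 \<Longrightarrow> ?\<rho> m n * g m + (1 - ?\<rho> m n) * C < Inf (range g) + r"
      by (auto simp: eventually_sequentially)
    have "norm (g n - Inf (range g)) < r" if "n \<ge> n0" for n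
      using n0[OF that] step[of n m] cInf_lower[OF _ bdd, of "g n"] r by (auto simp: abs_less_iff)
    then show "\<exists>n0. \<forall>n\<ge>n0. norm (g n - Inf (range g)) < r" by blast
  qed
  then show ?thesis unfolding g_def convergent_def by blast
qed

section \<open>Patches, fillings and block distributions\<close>
text \<open>
  Sites are pairs of integers that are treated as points: quantifiers over sites are kept in one piece.
\<close>
declare split_paired_All [simp del] split_paired_Ex [simp del]

definition patches :: "'a config set \<Rightarrow> site set \<Rightarrow> 'a config set" where
  "patches X \<Lambda> = (\<lambda>x. restrict x \<Lambda>) ` X"

text \<open>
  A filling of the window \<open>\<Lambda>\<close> carries its boundary condition on \<open>\<Lambda>' - \<Lambda>\<close> along. Thus fillings for
  different \<open>\<Lambda>'\<close> are compared by restriction, and the patches on \<open>\<Lambda>'\<close> are partitioned into fillings.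
\<close>
definition fillings :: "'a config set \<Rightarrow> site set \<Rightarrow> site set \<Rightarrow> 'a config \<Rightarrow> 'a config set" where
  "fillings X \<Lambda> \<Lambda>' a = {b \<in> patches X \<Lambda>'. restrict b (\<Lambda>' - \<Lambda>) = restrict a (\<Lambda>' - \<Lambda>)}"

lemma restrict_eq_iff: "restrict x \<Lambda> = restrict y \<Lambda> \<longleftrightarrow> (\<forall>z\<in>\<Lambda>. x z = y z)"
  by (auto simp: restrict_def fun_eq_iff)

lemma restrict_eq_subset: "restrict x \<Lambda>' = restrict y \<Lambda>' \<Longrightarrow> \<Lambda> \<subseteq> \<Lambda>' \<Longrightarrow> restrict x \<Lambda> = restrict y \<Lambda>"
  by (auto simp: restrict_eq_iff)

lemma restrict_to_empty [simp]: "restrict x {} = (\<lambda>_. undefined)"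
  by (simp add: restrict_def)

lemma restrict_patch: "a \<in> patches X \<Lambda> \<Longrightarrow> restrict a \<Lambda> = a"
  by (auto simp: patches_def)

lemma inj_on_restrict_pair: "inj_on (\<lambda>a. (restrict a \<Lambda>, restrict a \<Delta>)) (patches X (\<Lambda> \<union> \<Delta>))"
proof (rule inj_onI)
  fix a b assume ab: "a \<in> patches X (\<Lambda> \<union> \<Delta>)" "b \<in> patches X (\<Lambda> \<union> \<Delta>)"
    and "(restrict a \<Lambda>, restrict a \<Delta>) = (restrict b \<Lambda>, restrict b \<Delta>)"
  then have "restrict a (\<Lambda> \<union> \<Delta>) = restrict b (\<Lambda> \<union> \<Delta>)" by (auto simp: restrict_eq_iff)
  then show "a = b" using ab by (simp add: restrict_patch)
qed

lemma cylinder_nonempty_iff: "cylinder X \<Lambda> a \<noteq> {} \<longleftrightarrow> a \<in> patches X \<Lambda>"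
  by (auto simp: cylinder_def patches_def)

lemma restrict_patches: "a \<in> patches X \<Lambda>' \<Longrightarrow> \<Lambda> \<subseteq> \<Lambda>' \<Longrightarrow> restrict a \<Lambda> \<in> patches X \<Lambda>"
  by (auto simp: patches_def Int_absorb1)

lemma patches_empty_iff [simp]: "patches X \<Lambda> = {} \<longleftrightarrow> X = {}"
  by (simp add: patches_def)

lemma l1_setdist_ge_iff: "enat l \<le> l1_setdist \<Lambda> \<Lambda>' \<longleftrightarrow> (\<forall>z\<in>\<Lambda>. \<forall>w\<in>\<Lambda>'. l \<le> l1_dist z w)"
  by (simp add: l1_setdist_def le_INF_iff)

lemma outer_boundary_iff: "z \<in> outer_boundary r \<Lambda> \<longleftrightarrow> z \<notin> \<Lambda> \<and> (\<exists>w\<in>\<Lambda>. l1_dist z w \<le> r)"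
proof -
  have "l1_setdist {z} \<Lambda> \<le> enat r \<longleftrightarrow> \<not> enat (Suc r) \<le> l1_setdist {z} \<Lambda>"
    by (metis Suc_ile_eq not_le)
  then show ?thesis by (auto simp: outer_boundary_def l1_setdist_ge_iff not_less_eq_eq)
qed

lemma finite_outer_boundary:
  assumes "finite \<Lambda>"
  shows "finite (outer_boundary r \<Lambda>)"
proof (rule finite_subset)
  show "outer_boundary r \<Lambda> \<subseteq> (\<Union>w\<in>\<Lambda>. (+) w ` box r)"
  proof
    fix z assume "z \<in> outer_boundary r \<Lambda>"
    then obtain w where w: "w \<in> \<Lambda>" "l1_dist z w \<le> r" by (auto simp: outer_boundary_iff)
    have "z - w \<in> box r" using w(2) by (cases z, cases w) (auto simp: box_def l1_dist_def)
    then have "z \<in> (+) w ` box r" by (intro image_eqI[of _ _ "z - w"]) auto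
    then show "z \<in> (\<Union>w\<in>\<Lambda>. (+) w ` box r)" using w(1) by blast
  qed
qed (use assms in auto)

lemma l1_dist_cross:
  assumes "u \<in> cross" "u' \<in> cross"
  shows "l1_dist (v + u) (v + u') \<le> 2"
  using assms by (cases v) (auto simp: cross_def l1_dist_def)

lemma shift_shift: "shift s (shift t x) = shift (t + s) x"
  by (simp add: shift_def add.assoc)

lemma shift_0 [simp]: "shift 0 x = x"
  by (simp add: shift_def)

lemma shift_restrict: "shift t (restrict x ((+) t ` \<Lambda>)) = restrict (shift t x) \<Lambda>"
  by (auto simp: shift_def restrict_def fun_eq_iff)

text \<open>
  The inner restriction makes every configuration a legal argument, so that one patch serves for all windows
  inside its own.
\<close>
definition block_prob :: "'a config set \<Rightarrow> 'a config measure \<Rightarrow> site set \<Rightarrow> 'a config \<Rightarrow> real" where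
  "block_prob X \<mu> \<Lambda> a = measure \<mu> (cylinder X \<Lambda> (restrict a \<Lambda>))"

definition block_entropy :: "'a config set \<Rightarrow> 'a config measure \<Rightarrow> site set \<Rightarrow> real" where
  "block_entropy X \<mu> \<Lambda> = - (\<Sum>a\<in>patches X \<Lambda>. block_prob X \<mu> \<Lambda> a * ln (block_prob X \<mu> \<Lambda> a))"

lemma block_prob_restrict: "\<Lambda> \<subseteq> \<Lambda>' \<Longrightarrow> block_prob X \<mu> \<Lambda> (restrict a \<Lambda>') = block_prob X \<mu> \<Lambda> a"
  by (simp add: block_prob_def Int_absorb1)

lemma block_prob_cong: "(\<And>z. z \<in> \<Lambda> \<Longrightarrow> a z = b z) \<Longrightarrow> block_prob X \<mu> \<Lambda> a = block_prob X \<mu> \<Lambda> b"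
  unfolding block_prob_def by (metis restrict_eq_iff)

lemma block_prob_nonneg: "0 \<le> block_prob X \<mu> \<Lambda> a"
  by (simp add: block_prob_def)

section \<open>Gluing in subshifts of finite type\<close>
locale sft =
  fixes A :: "'a set" and L :: "'a config set"
  assumes finite_A: "finite A"
begin

abbreviation X :: "'a config set" where "X \<equiv> subshift A L"

abbreviation pr :: "'a config measure \<Rightarrow> site set \<Rightarrow> 'a config \<Rightarrow> real" where
  "pr \<equiv> block_prob X"

lemma X_iff: "x \<in> X \<longleftrightarrow> (\<forall>z. x z \<in> A) \<and> (\<forall>z. restrict (shift z x) cross \<in> L)"
  by (auto simp: subshift_def)

lemma X_letter: "x \<in> X \<Longrightarrow> x z \<in> A"
  by (simp add: X_iff)

lemma shift_X: "x \<in> X \<Longrightarrow> shift t x \<in> X"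
  by (simp add: X_iff shift_shift) (simp add: shift_def)

text \<open>
  Two sites of a cross are at distance at most 2. A translate of the cross that meets \<open>\<Lambda>\<close> therefore stays in
  \<open>\<Lambda>\<close> and its boundary of radius 2, where the glued configuration is \<open>y\<close>; any other translate sees only \<open>x\<close>.
\<close>
lemma glue_X:
  assumes x: "x \<in> X" and y: "y \<in> X" and eq: "\<And>s. s \<in> outer_boundary 2 \<Lambda> \<Longrightarrow> x s = y s"
  shows "(\<lambda>s. if s \<in> \<Lambda> then y s else x s) \<in> X" (is "?w \<in> X")
proof -
  have "restrict (shift v ?w) cross \<in> L" for v
  proof (cases "\<exists>u\<in>cross. v + u \<in> \<Lambda>")
    case True
    then obtain u where u: "u \<in> cross" "v + u \<in> \<Lambda>" by blast
    have "?w (v + u') = y (v + u')" if "u' \<in> cross" for u'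
    proof (cases "v + u' \<in> \<Lambda>")
      case False
      then have "v + u' \<in> outer_boundary 2 \<Lambda>"
        unfolding outer_boundary_iff using u l1_dist_cross[OF that u(1)] by blast
      then show ?thesis using eq by simp
    qed simp
    then have "restrict (shift v ?w) cross = restrict (shift v y) cross"
      by (simp add: restrict_eq_iff shift_def)
    then show ?thesis using y by (simp add: X_iff)
  next
    case False
    then have "restrict (shift v ?w) cross = restrict (shift v x) cross"
      by (simp add: restrict_eq_iff shift_def)
    then show ?thesis using x by (simp add: X_iff)
  qed
  then show ?thesis using x y by (auto simp: X_iff)
qed

lemma patches_subset: "patches X \<Lambda> \<subseteq> \<Lambda> \<rightarrow>\<^sub>E A"
  using X_letter by (fastforce simp: patches_def)

lemma finite_patches [simp]: "finite \<Lambda> \<Longrightarrow> finite (patches X \<Lambda>)"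
  using finite_subset[OF patches_subset] finite_PiE finite_A by metis

lemma finite_fillings [simp]: "finite \<Lambda>' \<Longrightarrow> finite (fillings X \<Lambda> \<Lambda>' a)"
  by (simp add: fillings_def)

text \<open>
  How \<open>\<Lambda>\<close> can be filled depends on the boundary condition only near \<open>\<Lambda>\<close>: by \<open>glue_X\<close>, a filling in
  the smaller window \<open>\<Lambda>'\<close> is compatible with all of the patch \<open>a\<close> on \<open>B\<close>.
\<close>
lemma bij_betw_fillings:
  assumes sub: "\<Lambda> \<union> outer_boundary 2 \<Lambda> \<subseteq> \<Lambda>'" "\<Lambda>' \<subseteq> B" and a: "a \<in> patches X B"
  shows "bij_betw (\<lambda>b. restrict b \<Lambda>') (fillings X \<Lambda> B a) (fillings X \<Lambda> \<Lambda>' a)"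
proof (rule bij_betw_imageI)
  show "inj_on (\<lambda>b. restrict b \<Lambda>') (fillings X \<Lambda> B a)"
  proof (rule inj_onI)
    fix b c assume b: "b \<in> fillings X \<Lambda> B a" and c: "c \<in> fillings X \<Lambda> B a"
      and eq: "restrict b \<Lambda>' = restrict c \<Lambda>'"
    have "restrict b (B - \<Lambda>) = restrict c (B - \<Lambda>)" using b c by (simp add: fillings_def)
    then have "\<forall>z\<in>B. b z = c z" using eq sub by (auto simp: restrict_eq_iff)
    then have "restrict b B = restrict c B" by (simp add: restrict_eq_iff)
    then show "b = c" using b c by (metis (no_types, lifting) fillings_def mem_Collect_eq restrict_patch)
  qed
  show "(\<lambda>b. restrict b \<Lambda>') ` fillings X \<Lambda> B a = fillings X \<Lambda> \<Lambda>' a"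
  proof (intro equalityI subsetI)
    fix c assume "c \<in> (\<lambda>b. restrict b \<Lambda>') ` fillings X \<Lambda> B a"
    then obtain b where b: "b \<in> patches X B" "restrict b (B - \<Lambda>) = restrict a (B - \<Lambda>)"
      and c: "c = restrict b \<Lambda>'" by (auto simp: fillings_def)
    have "c \<in> patches X \<Lambda>'" using restrict_patches[OF b(1) sub(2)] c by simp
    moreover have "restrict c (\<Lambda>' - \<Lambda>) = restrict a (\<Lambda>' - \<Lambda>)"
      using b(2) sub(2) c by (auto simp: restrict_eq_iff simp del: restrict_restrict)
    ultimately show "c \<in> fillings X \<Lambda> \<Lambda>' a" by (simp add: fillings_def)
  next
    fix c assume c: "c \<in> fillings X \<Lambda> \<Lambda>' a"
    then obtain y where y: "y \<in> X" "c = restrict y \<Lambda>'" by (auto simp: fillings_def patches_def)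
    obtain x where x: "x \<in> X" "a = restrict x B" using a by (auto simp: patches_def)
    have yx: "y s = x s" if "s \<in> \<Lambda>' - \<Lambda>" for s
      using c that sub by (auto simp: fillings_def restrict_eq_iff y x simp del: restrict_restrict)
    \<comment> \<open>The filling is completed to a configuration by \<open>x\<close>, which realizes \<open>a\<close>.\<close>
    let ?w = "\<lambda>s. if s \<in> \<Lambda> then y s else x s"
    have "?w \<in> X"
    proof (rule glue_X[OF x(1) y(1)])
      fix s assume s: "s \<in> outer_boundary 2 \<Lambda>"
      then have "s \<notin> \<Lambda>" by (simp add: outer_boundary_def)
      then show "x s = y s" using yx[of s] s sub(1) by auto
    qed
    moreover have "restrict (restrict ?w B) (B - \<Lambda>) = restrict a (B - \<Lambda>)" by (simp add: restrict_eq_iff x)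
    ultimately have "restrict ?w B \<in> fillings X \<Lambda> B a" by (auto simp: fillings_def patches_def)
    moreover have "restrict (restrict ?w B) \<Lambda>' = c"
      using yx sub by (auto simp: y restrict_def fun_eq_iff)
    ultimately show "c \<in> (\<lambda>b. restrict b \<Lambda>') ` fillings X \<Lambda> B a" by blast
  qed
qed

lemma shift_bij_patches: "bij_betw (shift t) (patches X ((+) t ` \<Lambda>)) (patches X \<Lambda>)"
proof (rule bij_betw_imageI)
  have "shift (- t) (shift t x) = x" for x :: "'a config" by (simp add: shift_shift)
  then show "inj_on (shift t) (patches X ((+) t ` \<Lambda>))" by (metis inj_on_inverseI)
  have "shift t ` patches X ((+) t ` \<Lambda>) = (\<lambda>x. restrict x \<Lambda>) ` shift t ` X"
    by (simp add: patches_def image_image shift_restrict)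
  also have "shift t ` X = X"
  proof
    show "X \<subseteq> shift t ` X"
    proof
      fix x assume "x \<in> X"
      then have "x = shift t (shift (- t) x)" "shift (- t) x \<in> X" by (simp_all add: shift_shift shift_X)
      then show "x \<in> shift t ` X" by blast
    qed
  qed (use shift_X in blast)
  finally show "shift t ` patches X ((+) t ` \<Lambda>) = patches X \<Lambda>" unfolding patches_def .
qed

section \<open>Topology and Borel structure of a subshift\<close>
lemma topspace_config [simp]: "topspace (config_topology A X) = X"
  by (auto simp: config_topology_def subshift_def)

lemma openin_cylinder:
  assumes "finite \<Lambda>"
  shows "openin (config_topology A X) (cylinder X \<Lambda> (restrict a \<Lambda>))"
proof -
  have "openin (product_topology (\<lambda>_. discrete_topology A) UNIV)
      (\<Pi>\<^sub>E z\<in>UNIV. if z \<in> \<Lambda> then {a z} \<inter> A else A)"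
    using assms by (auto simp: openin_PiE_gen elim!: finite_subset[rotated])
  moreover have "cylinder X \<Lambda> (restrict a \<Lambda>) = (\<Pi>\<^sub>E z\<in>UNIV. if z \<in> \<Lambda> then {a z} \<inter> A else A) \<inter> X"
    by (auto simp: cylinder_def restrict_eq_iff PiE_def Pi_def X_letter split: if_splits)
  ultimately show ?thesis unfolding config_topology_def openin_subtopology by blast
qed

lemma open_contains_cylinder:
  assumes "openin (config_topology A X) U" "x \<in> U"
  obtains n where "cylinder X (box n) (restrict x (box n)) \<subseteq> U"
proof -
  obtain V where V: "openin (product_topology (\<lambda>_. discrete_topology A) UNIV) V" "U = V \<inter> X"
    using assms(1) by (auto simp: config_topology_def openin_subtopology)
  then obtain W where W: "finite {i. W i \<noteq> A}" "x \<in> Pi\<^sub>E UNIV W" "Pi\<^sub>E UNIV W \<subseteq> V"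
    using assms(2) by (auto simp: openin_product_topology_alt)
  obtain n where n: "{i. W i \<noteq> A} \<subseteq> box n" using finite_subset_box[OF W(1)] .
  have "y \<in> Pi\<^sub>E UNIV W" if "y \<in> X" "restrict y (box n) = restrict x (box n)" for y
  proof -
    have "y i \<in> W i" for i
    proof (cases "W i = A")
      case False
      then have "y i = x i" using that(2) n by (auto simp: restrict_eq_iff)
      then show ?thesis using W(2) by auto
    qed (use that X_letter in simp)
    then show ?thesis by auto
  qed
  then have "cylinder X (box n) (restrict x (box n)) \<subseteq> U"
    using W(3) unfolding V(2) cylinder_def by blast
  then show thesis using that by blast
qed

text \<open>
  The full shift is compact by Tychonoff's theorem, and the subshift is closed in it: a forbidden cross is
  forbidden in all configurations that agree on its five sites.
\<close>
lemma compact_config: "compact_space (config_topology A X)"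
proof -
  let ?P = "product_topology (\<lambda>_::site. discrete_topology A) UNIV"
  have "compact_space ?P"
    using finite_A by (simp add: compact_space_product_topology compact_space_discrete_topology)
  moreover have "closedin ?P X"
    unfolding closedin_def
  proof
    show "X \<subseteq> topspace ?P" by (auto simp: subshift_def)
    show "openin ?P (topspace ?P - X)"
    proof (subst openin_subopen, intro ballI)
      fix x assume x: "x \<in> topspace ?P - X"
      then obtain z where z: "restrict (shift z x) cross \<notin> L" by (auto simp: X_iff)
      let ?V = "\<Pi>\<^sub>E s\<in>UNIV. if s \<in> (+) z ` cross then {x s} else A"
      have "{s. (if s \<in> (+) z ` cross then {x s} else A) \<noteq> A} \<subseteq> (+) z ` cross" by auto
      then have "finite {s. (if s \<in> (+) z ` cross then {x s} else A) \<noteq> A}"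
        by (rule finite_subset) (simp add: cross_def)
      then have "openin ?P ?V" using x by (auto simp: openin_PiE_gen)
      moreover have "x \<in> ?V" using x by auto
      moreover have "?V \<subseteq> topspace ?P - X"
      proof
        fix y assume y: "y \<in> ?V"
        have "y (z + s) = x (z + s)" if "s \<in> cross" for s
        proof -
          have "y (z + s) \<in> (if z + s \<in> (+) z ` cross then {x (z + s)} else A)"
            using y by (rule PiE_mem) simp
          then show ?thesis using that by simp
        qed
        then have "restrict (shift z y) cross = restrict (shift z x) cross"
          by (simp add: restrict_eq_iff shift_def)
        then have "y \<notin> X" using z unfolding X_iff by metis
        moreover have "y s \<in> A" for s
          using PiE_mem[OF y, of s] x by (auto split: if_splits)
        ultimately show "y \<in> topspace ?P - X" by auto
      qed
      ultimately show "\<exists>V. openin ?P V \<and> x \<in> V \<and> V \<subseteq> topspace ?P - X" by blast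
    qed
  qed
  ultimately show ?thesis
    unfolding config_topology_def by (intro compact_space_subtopology closedin_compact_space)
qed

definition box_cylinders :: "'a config set set" where
  "box_cylinders = insert {} {cylinder X (box n) a | n a. a \<in> patches X (box n)}"

text \<open>
  An open set is the union of the box cylinders inside it, and there are only countably many box cylinders.
\<close>
lemma sets_config_borel: "sets (config_borel A X) = sigma_sets X box_cylinders"
  and space_config_borel [simp]: "space (config_borel A X) = X"
proof -
  let ?O = "{U. openin (config_topology A X) U}"
  have sub: "?O \<subseteq> Pow X" using openin_subset by fastforce
  show "space (config_borel A X) = X" using sub by (simp add: config_borel_def)
  have "sets (config_borel A X) = sigma_sets X ?O" using sub by (simp add: config_borel_def)
  also have "\<dots> = sigma_sets X box_cylinders"
  proof (intro sigma_sets_eqI)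
    fix U assume "U \<in> ?O"
    then have U: "openin (config_topology A X) U" by simp
    define I where "I = {(n, a). a \<in> patches X (box n) \<and> cylinder X (box n) a \<subseteq> U}"
    have "U = (\<Union>(n, a)\<in>I. cylinder X (box n) a)"
    proof (intro equalityI subsetI)
      fix x assume x: "x \<in> U"
      then have "x \<in> X" using U openin_subset by fastforce
      moreover obtain n where "cylinder X (box n) (restrict x (box n)) \<subseteq> U"
        using open_contains_cylinder[OF U x] .
      ultimately have "(n, restrict x (box n)) \<in> I" "x \<in> cylinder X (box n) (restrict x (box n))"
        by (auto simp: I_def patches_def cylinder_def)
      then show "x \<in> (\<Union>(n, a)\<in>I. cylinder X (box n) a)" by blast
    qed (auto simp: I_def)
    moreover have "countable I"
    proof (rule countable_subset)
      show "I \<subseteq> (SIGMA n:UNIV. patches X (box n))" by (auto simp: I_def)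
      show "countable (SIGMA n:UNIV. patches X (box n))"
        by (rule countable_SIGMA) (simp_all add: countable_finite)
    qed
    moreover have "cylinder X (box n) a \<in> sigma_sets X box_cylinders" if "(n, a) \<in> I" for n a
      using that by (intro sigma_sets.Basic) (auto simp: I_def box_cylinders_def)
    ultimately show "U \<in> sigma_sets X box_cylinders"
      by (auto intro!: sigma_sets_UNION)
  next
    fix C assume "C \<in> box_cylinders"
    then have "openin (config_topology A X) C"
      using openin_cylinder[OF finite_box] restrict_patch unfolding box_cylinders_def
      by (smt (verit) insert_iff mem_Collect_eq openin_empty)
    then show "C \<in> sigma_sets X ?O" by (intro sigma_sets.Basic) simp
  qed
  finally show "sets (config_borel A X) = sigma_sets X box_cylinders" .
qed

lemma sets_openin: "openin (config_topology A X) U \<Longrightarrow> U \<in> sets (config_borel A X)"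
proof -
  have "{U. openin (config_topology A X) U} \<subseteq> Pow X" using openin_subset by fastforce
  then show "openin (config_topology A X) U \<Longrightarrow> U \<in> sets (config_borel A X)"
    by (simp add: config_borel_def sigma_sets.Basic)
qed

lemma sets_cylinder:
  assumes "finite \<Lambda>"
  shows "cylinder X \<Lambda> a \<in> sets (config_borel A X)"
proof (cases "a \<in> patches X \<Lambda>")
  case True
  then show ?thesis using openin_cylinder[OF assms, of a] by (intro sets_openin) (simp add: restrict_patch)
next
  case False
  then have "cylinder X \<Lambda> a = {}" using cylinder_nonempty_iff by blast
  then show ?thesis by simp
qed

text \<open>
  Boxes are nested, so of two box cylinders that meet one contains the other.
\<close>
lemma Int_stable_box_cylinders: "Int_stable box_cylinders"
proof (rule Int_stableI)
  have *: "cylinder X (box m) a \<inter> cylinder X (box n) b \<in> box_cylinders"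
    if "m \<le> n" "b \<in> patches X (box n)" for m n a b
  proof (cases "restrict b (box m) = a")
    case True
    then have "cylinder X (box n) b \<subseteq> cylinder X (box m) a"
      using box_mono[OF that(1)] by (auto simp: cylinder_def Int_absorb1)
    then show ?thesis using that by (auto simp: box_cylinders_def Int_absorb1)
  next
    case False
    then have "cylinder X (box m) a \<inter> cylinder X (box n) b = {}"
      using box_mono[OF that(1)] by (auto simp: cylinder_def Int_absorb1)
    then show ?thesis by (simp add: box_cylinders_def)
  qed
  fix C D assume C: "C \<in> box_cylinders" and D: "D \<in> box_cylinders"
  show "C \<inter> D \<in> box_cylinders"
  proof (cases "C = {} \<or> D = {}")
    case True
    then show ?thesis by (auto simp: box_cylinders_def)
  next
    case False
    then obtain m a n b where CD: "C = cylinder X (box m) a" "a \<in> patches X (box m)"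
      "D = cylinder X (box n) b" "b \<in> patches X (box n)"
      using C D by (auto simp: box_cylinders_def)
    show ?thesis
      using *[of m n b a] *[of n m a b] CD by (cases "m \<le> n") (auto simp: Int_commute)
  qed
qed

lemma measurable_config_borel:
  assumes "f \<in> space M \<rightarrow> X"
    and "\<And>n a. a \<in> patches X (box n) \<Longrightarrow> f -` cylinder X (box n) a \<inter> space M \<in> sets M"
  shows "f \<in> measurable M (config_borel A X)"
proof (rule measurable_sigma_sets[OF sets_config_borel])
  show "box_cylinders \<subseteq> Pow X" by (auto simp: box_cylinders_def cylinder_def)
qed (use assms in \<open>auto simp: box_cylinders_def\<close>)

section \<open>Block distributions of probability measures\<close>
text \<open>
  Invariance is left out because lifted measures are identified by their block distributions before they are
  known to be invariant.
\<close>
definition config_prob :: "'a config measure \<Rightarrow> bool" where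
  "config_prob \<mu> \<longleftrightarrow> prob_space \<mu> \<and> sets \<mu> = sets (config_borel A X)"

lemma config_prob_space: "config_prob \<mu> \<Longrightarrow> space \<mu> = X"
  unfolding config_prob_def using sets_eq_imp_space_eq space_config_borel by metis

lemma measurable_config_prob: "config_prob \<mu> \<Longrightarrow> measurable \<mu> N = measurable (config_borel A X) N"
  by (rule measurable_cong_sets) (simp_all add: config_prob_def)

lemma invariant_config_prob: "\<mu> \<in> invariant_measures A X \<Longrightarrow> config_prob \<mu>"
  by (simp add: invariant_measures_def config_prob_def)

lemma config_prob_eqI:
  assumes \<mu>: "config_prob \<mu>" and \<nu>: "config_prob \<nu>"
    and eq: "\<And>n a. a \<in> patches X (box n) \<Longrightarrow> pr \<mu> (box n) a = pr \<nu> (box n) a"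
  shows "\<mu> = \<nu>"
proof -
  interpret \<mu>: prob_space \<mu> using \<mu> by (simp add: config_prob_def)
  interpret \<nu>: prob_space \<nu> using \<nu> by (simp add: config_prob_def)
  show ?thesis
  proof (rule measure_eqI_generator_eq_countable[OF Int_stable_box_cylinders])
    show "box_cylinders \<subseteq> Pow X" by (auto simp: box_cylinders_def cylinder_def)
    show "emeasure \<mu> C = emeasure \<nu> C" if "C \<in> box_cylinders" for C
      using that eq by (auto simp: box_cylinders_def block_prob_def restrict_patch
          \<mu>.emeasure_eq_measure \<nu>.emeasure_eq_measure)
    show "sets \<mu> = sigma_sets X box_cylinders" "sets \<nu> = sigma_sets X box_cylinders"
      using \<mu> \<nu> by (simp_all add: config_prob_def sets_config_borel)
    let ?E = "cylinder X (box 0) ` patches X (box 0)"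
    show "?E \<subseteq> box_cylinders" by (auto simp: box_cylinders_def)
    show "\<Union> ?E = X" by (auto simp: cylinder_def patches_def)
    show "countable ?E" by (intro countable_image countable_finite) simp
  qed simp
qed

lemma block_prob_le_1: "config_prob \<mu> \<Longrightarrow> pr \<mu> \<Lambda> a \<le> 1"
  by (simp add: block_prob_def config_prob_def prob_space.prob_le_1)

lemma block_prob_split:
  assumes \<mu>: "config_prob \<mu>" and fin: "finite \<Lambda>'" and sub: "\<Lambda> \<subseteq> \<Lambda>'"
  shows "pr \<mu> \<Lambda> a
    = (\<Sum>b\<in>{b \<in> patches X \<Lambda>'. restrict b \<Lambda> = restrict a \<Lambda>}. pr \<mu> \<Lambda>' b)"
proof -
  interpret prob_space \<mu> using \<mu> by (simp add: config_prob_def)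
  let ?I = "{b \<in> patches X \<Lambda>'. restrict b \<Lambda> = restrict a \<Lambda>}"
  have "cylinder X \<Lambda> (restrict a \<Lambda>) = {x \<in> X. restrict x \<Lambda>' \<in> ?I}"
    unfolding cylinder_def
  proof (rule Collect_cong, rule conj_cong[OF refl])
    fix x assume "x \<in> X"
    then have "restrict x \<Lambda>' \<in> patches X \<Lambda>'" by (simp add: patches_def)
    moreover have "restrict (restrict x \<Lambda>') \<Lambda> = restrict x \<Lambda>" using sub by (simp add: Int_absorb1)
    ultimately show "(restrict x \<Lambda> = restrict a \<Lambda>) = (restrict x \<Lambda>' \<in> ?I)" by simp
  qed
  also have "\<dots> = (\<Union>b\<in>?I. cylinder X \<Lambda>' b)"
    unfolding cylinder_def UN_iff set_eq_iff by simp
  also have "measure \<mu> \<dots> = (\<Sum>b\<in>?I. measure \<mu> (cylinder X \<Lambda>' b))"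
  proof (rule finite_measure_finite_Union)
    show "cylinder X \<Lambda>' ` ?I \<subseteq> sets \<mu>"
      using \<mu> sets_cylinder[OF fin] by (simp add: config_prob_def image_subset_iff)
    show "disjoint_family_on (cylinder X \<Lambda>') ?I" by (auto simp: disjoint_family_on_def cylinder_def)
    show "finite ?I" using fin by simp
  qed
  also have "\<dots> = (\<Sum>b\<in>?I. pr \<mu> \<Lambda>' b)"
    by (intro sum.cong) (auto simp: block_prob_def restrict_patch)
  finally show ?thesis by (simp only: block_prob_def[of _ _ \<Lambda> a])
qed

lemma block_prob_mono:
  assumes \<mu>: "config_prob \<mu>" and fin: "finite \<Lambda>'" and sub: "\<Lambda> \<subseteq> \<Lambda>'"
  shows "pr \<mu> \<Lambda>' a \<le> pr \<mu> \<Lambda> a"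
proof -
  interpret prob_space \<mu> using \<mu> by (simp add: config_prob_def)
  have "cylinder X \<Lambda> (restrict a \<Lambda>) \<in> sets \<mu>"
    using \<mu> finite_subset[OF sub fin] by (simp add: config_prob_def sets_cylinder)
  then show ?thesis unfolding block_prob_def
    using sub by (intro finite_measure_mono) (auto simp: cylinder_def restrict_eq_iff)
qed

lemma sum_block_prob_marginal:
  assumes \<mu>: "config_prob \<mu>" and fin: "finite \<Lambda>'" and sub: "\<Lambda> \<subseteq> \<Lambda>'"
  shows "(\<Sum>b\<in>patches X \<Lambda>'. pr \<mu> \<Lambda>' b * g (restrict b \<Lambda>))
    = (\<Sum>a\<in>patches X \<Lambda>. pr \<mu> \<Lambda> a * g a)"
proof -
  have "(\<Sum>a\<in>patches X \<Lambda>. pr \<mu> \<Lambda> a * g a)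
    = (\<Sum>a\<in>patches X \<Lambda>. \<Sum>b\<in>{b \<in> patches X \<Lambda>'. restrict b \<Lambda> = a}. pr \<mu> \<Lambda>' b * g (restrict b \<Lambda>))"
  proof (rule sum.cong[OF refl])
    fix a assume "a \<in> patches X \<Lambda>"
    then have "pr \<mu> \<Lambda> a = (\<Sum>b\<in>{b \<in> patches X \<Lambda>'. restrict b \<Lambda> = a}. pr \<mu> \<Lambda>' b)"
      using block_prob_split[OF \<mu> fin sub, of a] by (simp add: restrict_patch)
    then show "pr \<mu> \<Lambda> a * g a
        = (\<Sum>b\<in>{b \<in> patches X \<Lambda>'. restrict b \<Lambda> = a}. pr \<mu> \<Lambda>' b * g (restrict b \<Lambda>))"
      by (simp add: sum_distrib_right)
  qed
  also have "\<dots> = (\<Sum>b\<in>patches X \<Lambda>'. pr \<mu> \<Lambda>' b * g (restrict b \<Lambda>))"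
    using fin sub finite_subset[OF sub fin] by (intro sum.group) (auto intro: restrict_patches)
  finally show ?thesis by simp
qed

lemma sum_block_prob:
  assumes "config_prob \<mu>" "finite \<Lambda>"
  shows "(\<Sum>a\<in>patches X \<Lambda>. pr \<mu> \<Lambda> a) = 1"
proof -
  have "pr \<mu> {} undefined = measure \<mu> X"
    by (simp add: block_prob_def cylinder_def)
  also have "\<dots> = 1"
    using assms config_prob_space by (metis config_prob_def prob_space.prob_space)
  finally show ?thesis using block_prob_split[OF assms, of "{}" undefined] by simp
qed

lemma measurable_shift: "shift t \<in> measurable (config_borel A X) (config_borel A X)"
  and shift_vimage_cylinder:
    "shift t -` cylinder X \<Lambda> (restrict (shift t a) \<Lambda>) \<inter> X = cylinder X ((+) t ` \<Lambda>) (restrict a ((+) t ` \<Lambda>))"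
proof -
  show *: "shift t -` cylinder X \<Lambda> (restrict (shift t a) \<Lambda>) \<inter> X
      = cylinder X ((+) t ` \<Lambda>) (restrict a ((+) t ` \<Lambda>))" for \<Lambda> a
    by (auto simp: cylinder_def restrict_eq_iff shift_X) (auto simp: shift_def)
  show "shift t \<in> measurable (config_borel A X) (config_borel A X)"
  proof (rule measurable_config_borel)
    fix n a assume a: "a \<in> patches X (box n)"
    have "a = restrict (shift t (shift (- t) a)) (box n)" using a by (simp add: shift_shift restrict_patch)
    then have "shift t -` cylinder X (box n) a \<inter> X
        = cylinder X ((+) t ` box n) (restrict (shift (- t) a) ((+) t ` box n))"
      using * by metis
    then show "shift t -` cylinder X (box n) a \<inter> space (config_borel A X) \<in> sets (config_borel A X)"
      by (simp add: sets_cylinder)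
  qed (simp add: shift_X)
qed

lemma block_prob_distr_shift:
  assumes "config_prob \<mu>" "finite \<Lambda>"
  shows "pr (distr \<mu> (config_borel A X) (shift t)) \<Lambda> (shift t a) = pr \<mu> ((+) t ` \<Lambda>) a"
proof -
  have "shift t \<in> measurable \<mu> (config_borel A X)"
    using measurable_shift by (simp add: measurable_config_prob[OF assms(1)])
  then show ?thesis
    using assms by (simp add: block_prob_def measure_distr sets_cylinder config_prob_space shift_vimage_cylinder)
qed

lemma block_prob_shift:
  assumes "\<mu> \<in> invariant_measures A X" "finite \<Lambda>"
  shows "pr \<mu> ((+) t ` \<Lambda>) a = pr \<mu> \<Lambda> (shift t a)"
  using block_prob_distr_shift[OF invariant_config_prob[OF assms(1)] assms(2), of t a] assms(1)
  by (simp add: invariant_measures_def)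

lemma invariant_measuresI:
  assumes \<mu>: "config_prob \<mu>"
    and inv: "\<And>t n a. a \<in> X \<Longrightarrow> pr \<mu> ((+) t ` box n) a = pr \<mu> (box n) (shift t a)"
  shows "\<mu> \<in> invariant_measures A X"
proof -
  have "distr \<mu> (config_borel A X) (shift t) = \<mu>" for t
  proof (rule config_prob_eqI[OF _ \<mu>])
    have "shift t \<in> measurable \<mu> (config_borel A X)"
      using measurable_shift by (simp add: measurable_config_prob[OF \<mu>])
    then show "config_prob (distr \<mu> (config_borel A X) (shift t))"
      using \<mu> by (simp add: config_prob_def prob_space.prob_space_distr)
    fix n a assume "a \<in> patches X (box n)"
    then obtain x where x: "x \<in> X" "a = restrict x (box n)" by (auto simp: patches_def)
    define y where "y = shift (- t) x"
    have y: "y \<in> X" "x = shift t y" using x by (simp_all add: y_def shift_X shift_shift)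
    show "pr (distr \<mu> (config_borel A X) (shift t)) (box n) a = pr \<mu> (box n) a"
      using block_prob_distr_shift[OF \<mu> finite_box, of t n y] inv[OF y(1)]
      by (simp add: x block_prob_restrict y(2))
  qed
  then show ?thesis using \<mu> config_prob_space[OF \<mu>]
    by (simp add: invariant_measures_def config_prob_def)
qed

section \<open>Block entropies and their densities\<close>
text \<open>
  The difference of the two sides is the relative entropy of the joint distribution with respect to the
  product of its marginals. On the patches of the union the product may have mass less than 1, since
  not every pair of patches fits together.
\<close>
lemma block_entropy_subadditive:
  assumes \<mu>: "config_prob \<mu>" and fin: "finite \<Lambda>" "finite \<Delta>"
  shows "block_entropy X \<mu> (\<Lambda> \<union> \<Delta>) \<le> block_entropy X \<mu> \<Lambda> + block_entropy X \<mu> \<Delta>"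
proof -
  let ?p = "pr \<mu>" and ?I = "patches X (\<Lambda> \<union> \<Delta>)"
  have finI: "finite ?I" using fin by simp
  have mono: "?p (\<Lambda> \<union> \<Delta>) a \<le> ?p \<Lambda> a" "?p (\<Lambda> \<union> \<Delta>) a \<le> ?p \<Delta> a" for a
    using fin by (intro block_prob_mono[OF \<mu>]; simp)+
  have "(\<Sum>a\<in>?I. ?p \<Lambda> a * ?p \<Delta> a)
      = (\<Sum>a\<in>?I. ?p \<Lambda> (restrict a \<Lambda>) * ?p \<Delta> (restrict a \<Delta>))" by (simp add: block_prob_restrict)
  also have "\<dots> = (\<Sum>(b, c)\<in>(\<lambda>a. (restrict a \<Lambda>, restrict a \<Delta>)) ` ?I. ?p \<Lambda> b * ?p \<Delta> c)"
  proof (subst sum.reindex)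
    show "inj_on (\<lambda>a. (restrict a \<Lambda>, restrict a \<Delta>)) ?I" by (rule inj_on_restrict_pair)
  qed simp
  also have "\<dots> \<le> (\<Sum>(b, c)\<in>patches X \<Lambda> \<times> patches X \<Delta>. ?p \<Lambda> b * ?p \<Delta> c)"
    using fin by (intro sum_mono2) (auto intro!: restrict_patches mult_nonneg_nonneg block_prob_nonneg)
  also have "\<dots> = (\<Sum>b\<in>patches X \<Lambda>. ?p \<Lambda> b) * (\<Sum>c\<in>patches X \<Delta>. ?p \<Delta> c)"
    by (simp add: sum_product sum.cartesian_product)
  also have "\<dots> = (\<Sum>a\<in>?I. ?p (\<Lambda> \<union> \<Delta>) a)" using fin by (simp add: sum_block_prob[OF \<mu>])
  finally have sums: "(\<Sum>a\<in>?I. ?p \<Lambda> a * ?p \<Delta> a) \<le> (\<Sum>a\<in>?I. ?p (\<Lambda> \<union> \<Delta>) a)" .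
  have "(\<Sum>a\<in>?I. ?p (\<Lambda> \<union> \<Delta>) a * ln (?p \<Lambda> a * ?p \<Delta> a)) \<le> (\<Sum>a\<in>?I. ?p (\<Lambda> \<union> \<Delta>) a * ln (?p (\<Lambda> \<union> \<Delta>) a))"
  proof (rule gibbs_inequality[OF finI _ _ _ sums])
    fix a assume "0 < ?p (\<Lambda> \<union> \<Delta>) a"
    then have "0 < ?p \<Lambda> a" "0 < ?p \<Delta> a" using mono[of a] by linarith+
    then show "0 < ?p \<Lambda> a * ?p \<Delta> a" by simp
  qed (simp_all add: block_prob_nonneg)
  moreover have "(\<Sum>a\<in>?I. ?p (\<Lambda> \<union> \<Delta>) a * ln (?p \<Lambda> a * ?p \<Delta> a))
      = (\<Sum>a\<in>?I. ?p (\<Lambda> \<union> \<Delta>) a * ln (?p \<Lambda> (restrict a \<Lambda>))) + (\<Sum>a\<in>?I. ?p (\<Lambda> \<union> \<Delta>) a * ln (?p \<Delta> (restrict a \<Delta>)))"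
  proof (subst sum.distrib[symmetric], rule sum.cong[OF refl])
    fix a assume "a \<in> ?I"
    show "?p (\<Lambda> \<union> \<Delta>) a * ln (?p \<Lambda> a * ?p \<Delta> a)
        = ?p (\<Lambda> \<union> \<Delta>) a * ln (?p \<Lambda> (restrict a \<Lambda>)) + ?p (\<Lambda> \<union> \<Delta>) a * ln (?p \<Delta> (restrict a \<Delta>))"
    proof (cases "?p (\<Lambda> \<union> \<Delta>) a = 0")
      case False
      then have "0 < ?p (\<Lambda> \<union> \<Delta>) a" using block_prob_nonneg[of X \<mu> "\<Lambda> \<union> \<Delta>" a] by linarith
      then have "0 < ?p \<Lambda> a" "0 < ?p \<Delta> a" using mono[of a] by linarith+
      then show ?thesis by (simp add: block_prob_restrict ln_mult distrib_left)
    qed simp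
  qed
  moreover have "(\<Sum>a\<in>?I. ?p (\<Lambda> \<union> \<Delta>) a * ln (?p \<Lambda> (restrict a \<Lambda>))) = - block_entropy X \<mu> \<Lambda>"
    unfolding block_entropy_def minus_minus
    by (rule sum_block_prob_marginal[OF \<mu>, of "\<Lambda> \<union> \<Delta>" \<Lambda> "\<lambda>a. ln (?p \<Lambda> a)"]) (use fin in auto)
  moreover have "(\<Sum>a\<in>?I. ?p (\<Lambda> \<union> \<Delta>) a * ln (?p \<Delta> (restrict a \<Delta>))) = - block_entropy X \<mu> \<Delta>"
    unfolding block_entropy_def minus_minus
    by (rule sum_block_prob_marginal[OF \<mu>, of "\<Lambda> \<union> \<Delta>" \<Delta> "\<lambda>a. ln (?p \<Delta> a)"]) (use fin in auto)
  ultimately show ?thesis by (simp add: block_entropy_def)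
qed

lemma block_entropy_nonneg: "config_prob \<mu> \<Longrightarrow> 0 \<le> block_entropy X \<mu> \<Lambda>"
  unfolding block_entropy_def neg_0_le_iff_le
  by (intro sum_nonpos mult_nonneg_nonpos block_prob_nonneg)
    (metis block_prob_le_1 block_prob_nonneg ln_le_zero_iff ln_0 less_eq_real_def order_refl)

lemma block_entropy_shift:
  assumes "\<mu> \<in> invariant_measures A X" "finite \<Lambda>"
  shows "block_entropy X \<mu> ((+) t ` \<Lambda>) = block_entropy X \<mu> \<Lambda>"
  unfolding block_entropy_def
  by (subst sum.reindex_bij_betw[OF shift_bij_patches[of t], symmetric]) (simp add: block_prob_shift[OF assms])

text \<open>
  The entropy is defined by \<open>lim\<close>, which says nothing about divergent sequences: convergence has to be
  known before the definition can be used.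
\<close>
lemma block_entropy_tendsto:
  assumes "\<mu> \<in> invariant_measures A X"
  shows "(\<lambda>n. block_entropy X \<mu> (box n) / real (card (box n))) \<longlonglongrightarrow> measure_entropy A X \<mu>"
proof -
  have \<mu>: "config_prob \<mu>" using assms by (rule invariant_config_prob)
  have conv: "convergent (\<lambda>n. block_entropy X \<mu> (box n) / real (card (box n)))"
  proof (rule box_density_convergent)
    show "block_entropy X \<mu> {} \<le> 0"
    proof -
      have "pr \<mu> {} a = 1" if "a \<in> patches X {}" for a
      proof -
        have "pr \<mu> {} a = measure \<mu> X" by (simp add: block_prob_def cylinder_def)
        then show ?thesis using \<mu> config_prob_space by (metis config_prob_def prob_space.prob_space)
      qed
      then show ?thesis by (simp add: block_entropy_def)
    qed
  qed (use block_entropy_nonneg[OF \<mu>] block_entropy_subadditive[OF \<mu>] block_entropy_shift[OF assms] in auto)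
  have "(\<Sum>a \<in> box n \<rightarrow>\<^sub>E A. measure \<mu> (cylinder X (box n) a) * ln (measure \<mu> (cylinder X (box n) a)))
      = - block_entropy X \<mu> (box n)" for n
  proof -
    have "(\<Sum>a \<in> box n \<rightarrow>\<^sub>E A. measure \<mu> (cylinder X (box n) a) * ln (measure \<mu> (cylinder X (box n) a)))
      = (\<Sum>a \<in> patches X (box n). measure \<mu> (cylinder X (box n) a) * ln (measure \<mu> (cylinder X (box n) a)))"
    proof (rule sum.mono_neutral_right)
      show "\<forall>a\<in>(box n \<rightarrow>\<^sub>E A) - patches X (box n).
          measure \<mu> (cylinder X (box n) a) * ln (measure \<mu> (cylinder X (box n) a)) = 0"
        using cylinder_nonempty_iff[of X "box n"] by (metis DiffD2 measure_empty mult_zero_left)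
    qed (use finite_A patches_subset in \<open>auto intro: finite_PiE\<close>)
    then show ?thesis by (simp add: block_entropy_def block_prob_def restrict_patch)
  qed
  then have "measure_entropy A X \<mu> = - lim (\<lambda>n. - (block_entropy X \<mu> (box n) / real (card (box n))))"
    by (simp add: measure_entropy_def)
  also have "\<dots> = lim (\<lambda>n. block_entropy X \<mu> (box n) / real (card (box n)))"
    using tendsto_minus[OF conv[unfolded convergent_LIMSEQ_iff]] by (simp add: limI)
  finally show ?thesis using conv by (simp add: convergent_LIMSEQ_iff)
qed

lemma card_patches_tendsto:
  assumes "X \<noteq> {}"
  shows "(\<lambda>n. ln (real (card (patches X (box n)))) / real (card (box n))) \<longlonglongrightarrow> top_entropy A X"
proof -
  have pos: "1 \<le> card (patches X \<Lambda>)" if "finite \<Lambda>" for \<Lambda>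
    using that assms by (simp add: Suc_le_eq card_gt_0_iff)
  have conv: "convergent (\<lambda>n. ln (real (card (patches X (box n)))) / real (card (box n)))"
  proof (rule box_density_convergent[of "\<lambda>\<Lambda>. ln (real (card (patches X \<Lambda>)))"])
    show "0 \<le> ln (real (card (patches X \<Lambda>)))" if "finite \<Lambda>" for \<Lambda> using pos[OF that] by simp
    have "patches X {} = {\<lambda>_. undefined}" using assms by (auto simp: patches_def)
    then show "ln (real (card (patches X {}))) \<le> 0" by simp
    show "ln (real (card (patches X ((+) t ` \<Lambda>)))) = ln (real (card (patches X \<Lambda>)))" for t \<Lambda>
      using bij_betw_same_card[OF shift_bij_patches[of t \<Lambda>]] by simp
    show "ln (real (card (patches X (\<Lambda> \<union> \<Delta>)))) \<le> ln (real (card (patches X \<Lambda>))) + ln (real (card (patches X \<Delta>)))"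
      if fin: "finite \<Lambda>" "finite \<Delta>" for \<Lambda> \<Delta>
    proof -
      have "card (patches X (\<Lambda> \<union> \<Delta>)) \<le> card (patches X \<Lambda> \<times> patches X \<Delta>)"
      proof (rule card_inj_on_le[of "\<lambda>a. (restrict a \<Lambda>, restrict a \<Delta>)"])
        show "inj_on (\<lambda>a. (restrict a \<Lambda>, restrict a \<Delta>)) (patches X (\<Lambda> \<union> \<Delta>))"
          by (rule inj_on_restrict_pair)
      qed (use fin in \<open>auto intro: restrict_patches\<close>)
      then have "real (card (patches X (\<Lambda> \<union> \<Delta>))) \<le> real (card (patches X \<Lambda>)) * real (card (patches X \<Delta>))"
        by (simp add: card_cartesian_product flip: of_nat_mult)
      moreover have "0 < real (card (patches X (\<Lambda> \<union> \<Delta>)))" using pos[of "\<Lambda> \<union> \<Delta>"] fin by simp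
      ultimately have "ln (real (card (patches X (\<Lambda> \<union> \<Delta>)))) \<le> ln (real (card (patches X \<Lambda>)) * real (card (patches X \<Delta>)))"
        by simp
      then show ?thesis using pos[OF fin(1)] pos[OF fin(2)] by (simp add: ln_mult)
    qed
  qed
  have "{a \<in> box n \<rightarrow>\<^sub>E A. cylinder X (box n) a \<noteq> {}} = patches X (box n)" for n
    using patches_subset by (auto simp: cylinder_nonempty_iff)
  then show ?thesis using conv by (simp add: top_entropy_def convergent_LIMSEQ_iff)
qed

section \<open>Gibbs measures for one-letter weights\<close>
text \<open>
  The conditional distribution in \<open>\<Lambda>\<close> given the rest of \<open>\<Lambda>'\<close> is proportional to the product of the letter
  weights. The denominators are cleared, so for boundary conditions of probability zero the equation reads
  \<open>0 = 0\<close>.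
\<close>
definition gibbs :: "('a \<Rightarrow> real) \<Rightarrow> 'a config measure \<Rightarrow> bool" where
  "gibbs w \<mu> \<longleftrightarrow> (\<forall>\<Lambda> \<Lambda>'. finite \<Lambda>' \<longrightarrow> \<Lambda> \<union> outer_boundary 2 \<Lambda> \<subseteq> \<Lambda>' \<longrightarrow>
     (\<forall>a\<in>patches X \<Lambda>'.
        pr \<mu> \<Lambda>' a * (\<Sum>b\<in>fillings X \<Lambda> \<Lambda>' a. \<Prod>z\<in>\<Lambda>. w (b z))
        = pr \<mu> (\<Lambda>' - \<Lambda>) a * (\<Prod>z\<in>\<Lambda>. w (a z))))"

lemma gibbs_uniform_iff:
  "gibbs (\<lambda>_. 1) \<mu> \<longleftrightarrow> (\<forall>\<Lambda> \<Lambda>'. finite \<Lambda>' \<longrightarrow> \<Lambda> \<union> outer_boundary 2 \<Lambda> \<subseteq> \<Lambda>' \<longrightarrow>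
     (\<forall>a\<in>patches X \<Lambda>'. pr \<mu> \<Lambda>' a * real (card (fillings X \<Lambda> \<Lambda>' a)) = pr \<mu> (\<Lambda>' - \<Lambda>) a))"
  by (simp add: gibbs_def)

text \<open>
  The density of the conditional distribution in \<open>\<Lambda>\<close>, given the rest of \<open>\<Lambda>'\<close>, relative to the uniform
  distribution on the fillings. It is 0 where the boundary condition has probability 0.
\<close>
definition resampling_ratio :: "'a config measure \<Rightarrow> site set \<Rightarrow> site set \<Rightarrow> 'a config \<Rightarrow> real" where
  "resampling_ratio \<mu> \<Lambda> \<Lambda>' a =
     pr \<mu> \<Lambda>' a * real (card (fillings X \<Lambda> \<Lambda>' a)) / pr \<mu> (\<Lambda>' - \<Lambda>) a"

text \<open>
  The mean relative entropy of that conditional distribution with respect to the uniform one: the entropy that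
  resampling \<open>\<Lambda>\<close> uniformly would gain.
\<close>
definition conditional_deficit :: "'a config measure \<Rightarrow> site set \<Rightarrow> site set \<Rightarrow> real" where
  "conditional_deficit \<mu> \<Lambda> \<Lambda>' =
     (\<Sum>a\<in>patches X \<Lambda>'. pr \<mu> \<Lambda>' a * ln (resampling_ratio \<mu> \<Lambda> \<Lambda>' a))"

lemma fillings_cong: "restrict a (\<Lambda>' - \<Lambda>) = restrict b (\<Lambda>' - \<Lambda>) \<Longrightarrow> fillings X \<Lambda> \<Lambda>' a = fillings X \<Lambda> \<Lambda>' b"
  by (simp add: fillings_def)

lemma patch_in_fillings: "a \<in> patches X \<Lambda>' \<Longrightarrow> a \<in> fillings X \<Lambda> \<Lambda>' a"
  by (simp add: fillings_def)

lemma card_fillings_pos: "finite \<Lambda>' \<Longrightarrow> a \<in> patches X \<Lambda>' \<Longrightarrow> 0 < card (fillings X \<Lambda> \<Lambda>' a)"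
  by (metis card_gt_0_iff empty_iff finite_fillings patch_in_fillings)

lemma sum_fillings_block_prob:
  assumes "config_prob \<mu>" "finite \<Lambda>'"
  shows "(\<Sum>b\<in>fillings X \<Lambda> \<Lambda>' a. pr \<mu> \<Lambda>' b) = pr \<mu> (\<Lambda>' - \<Lambda>) a"
  using block_prob_split[OF assms, of "\<Lambda>' - \<Lambda>" a] by (simp add: fillings_def)

lemma sum_patches_by_fillings:
  assumes "finite \<Lambda>'"
  shows "(\<Sum>a\<in>patches X \<Lambda>'. f a) = (\<Sum>v\<in>patches X (\<Lambda>' - \<Lambda>). \<Sum>a\<in>fillings X \<Lambda> \<Lambda>' v. f a)"
proof -
  have "(\<Sum>a\<in>patches X \<Lambda>'. f a)
      = (\<Sum>v\<in>patches X (\<Lambda>' - \<Lambda>). \<Sum>a\<in>{a \<in> patches X \<Lambda>'. restrict a (\<Lambda>' - \<Lambda>) = v}. f a)"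
    using assms by (intro sum.group[symmetric]) (auto intro: restrict_patches)
  also have "\<dots> = (\<Sum>v\<in>patches X (\<Lambda>' - \<Lambda>). \<Sum>a\<in>fillings X \<Lambda> \<Lambda>' v. f a)"
    by (intro sum.cong refl) (simp_all add: fillings_def restrict_patch)
  finally show ?thesis .
qed

section \<open>Measures of maximal entropy are uniform Gibbs measures\<close>
lemma resampling_ratio_nonneg: "0 \<le> resampling_ratio \<mu> \<Lambda> \<Lambda>' a"
  by (simp add: resampling_ratio_def block_prob_nonneg)

lemma resampling_ratio_restrict:
  assumes "\<Lambda>' \<subseteq> B"
  shows "resampling_ratio \<mu> \<Lambda> \<Lambda>' (restrict a B) = resampling_ratio \<mu> \<Lambda> \<Lambda>' a"
proof -
  have "fillings X \<Lambda> \<Lambda>' (restrict a B) = fillings X \<Lambda> \<Lambda>' a"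
    using assms by (intro fillings_cong) (auto simp: restrict_eq_iff simp del: restrict_restrict)
  then show ?thesis
    using assms by (simp add: resampling_ratio_def block_prob_restrict Diff_subset[THEN order_trans])
qed

text \<open>
  For a fixed boundary condition the ratio is a density, so its average over the fillings is 1 (or 0 for boundary
  conditions of probability 0), and \<open>g\<close> is constant on these fillings.
\<close>
lemma sum_resampling_ratio_le:
  assumes \<mu>: "config_prob \<mu>" and sub: "\<Lambda> \<union> outer_boundary 2 \<Lambda> \<subseteq> \<Lambda>'" "\<Lambda>' \<subseteq> B" and fin: "finite B"
    and g0: "\<And>a. 0 \<le> g a" and g: "\<And>a b. restrict a (B - \<Lambda>) = restrict b (B - \<Lambda>) \<Longrightarrow> g a = g b"
  shows "(\<Sum>a\<in>patches X B. resampling_ratio \<mu> \<Lambda> \<Lambda>' a * g a) \<le> (\<Sum>a\<in>patches X B. g a)"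
  unfolding sum_patches_by_fillings[OF fin, of _ \<Lambda>]
proof (rule sum_mono)
  fix v assume "v \<in> patches X (B - \<Lambda>)"
  then obtain x where x: "x \<in> X" "v = restrict x (B - \<Lambda>)" by (auto simp: patches_def)
  define a where "a = restrict x B"
  have a: "a \<in> patches X B" using x by (simp add: a_def patches_def)
  have va: "fillings X \<Lambda> B v = fillings X \<Lambda> B a"
    by (rule fillings_cong) (auto simp: x a_def restrict_eq_iff)
  have finL: "finite \<Lambda>'" using fin sub finite_subset by blast
  have bij: "bij_betw (\<lambda>b. restrict b \<Lambda>') (fillings X \<Lambda> B a) (fillings X \<Lambda> \<Lambda>' a)"
    by (rule bij_betw_fillings[OF sub a])
  \<comment> \<open>The part of the ratio that is determined by the boundary condition.\<close>
  let ?r = "real (card (fillings X \<Lambda> \<Lambda>' a)) / pr \<mu> (\<Lambda>' - \<Lambda>) a"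
  have term_eq: "resampling_ratio \<mu> \<Lambda> \<Lambda>' b * g b = ?r * g a * pr \<mu> \<Lambda>' (restrict b \<Lambda>')"
    if "b \<in> fillings X \<Lambda> B a" for b
  proof -
    have eq: "restrict b (B - \<Lambda>) = restrict a (B - \<Lambda>)" using that by (simp add: fillings_def)
    then have eq': "restrict b (\<Lambda>' - \<Lambda>) = restrict a (\<Lambda>' - \<Lambda>)"
      by (rule restrict_eq_subset) (use sub in auto)
    then have "pr \<mu> (\<Lambda>' - \<Lambda>) b = pr \<mu> (\<Lambda>' - \<Lambda>) a" by (simp add: block_prob_def)
    then show ?thesis
      using g[OF eq] fillings_cong[OF eq'] by (simp add: resampling_ratio_def block_prob_restrict)
  qed
  have "(\<Sum>b\<in>fillings X \<Lambda> B v. resampling_ratio \<mu> \<Lambda> \<Lambda>' b * g b)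
      = ?r * g a * (\<Sum>b\<in>fillings X \<Lambda> B a. pr \<mu> \<Lambda>' (restrict b \<Lambda>'))"
    using term_eq by (simp add: va sum_distrib_left)
  also have "(\<Sum>b\<in>fillings X \<Lambda> B a. pr \<mu> \<Lambda>' (restrict b \<Lambda>')) = pr \<mu> (\<Lambda>' - \<Lambda>) a"
    using sum.reindex_bij_betw[OF bij, of "pr \<mu> \<Lambda>'"] sum_fillings_block_prob[OF \<mu> finL, of \<Lambda> a]
    by simp
  also have "?r * g a * pr \<mu> (\<Lambda>' - \<Lambda>) a \<le> real (card (fillings X \<Lambda> \<Lambda>' a)) * g a"
    using g0[of a] by (cases "pr \<mu> (\<Lambda>' - \<Lambda>) a = 0") auto
  also have "\<dots> = (\<Sum>b\<in>fillings X \<Lambda> B v. g b)"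
  proof -
    have "(\<Sum>b\<in>fillings X \<Lambda> B v. g b) = (\<Sum>b\<in>fillings X \<Lambda> B a. g a)"
      unfolding va by (rule sum.cong[OF refl], rule g) (simp add: fillings_def)
    then show ?thesis using bij_betw_same_card[OF bij] by simp
  qed
  finally show "(\<Sum>b\<in>fillings X \<Lambda> B v. resampling_ratio \<mu> \<Lambda> \<Lambda>' b * g b) \<le> (\<Sum>b\<in>fillings X \<Lambda> B v. g b)" .
qed

text \<open>
  Each ratio looks only at its own window, so the factors can be averaged out one at a time.
\<close>
lemma sum_prod_resampling_ratio_le:
  assumes \<mu>: "config_prob \<mu>" and fin: "finite B" and "finite T"
    and "\<And>t. t \<in> T \<Longrightarrow> \<Lambda> t \<union> outer_boundary 2 (\<Lambda> t) \<subseteq> \<Lambda>' t"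
    and "\<And>t. t \<in> T \<Longrightarrow> \<Lambda>' t \<subseteq> B"
    and "\<And>s t. s \<in> T \<Longrightarrow> t \<in> T \<Longrightarrow> s \<noteq> t \<Longrightarrow> \<Lambda>' s \<inter> \<Lambda>' t = {}"
  shows "(\<Sum>a\<in>patches X B. \<Prod>t\<in>T. resampling_ratio \<mu> (\<Lambda> t) (\<Lambda>' t) a) \<le> real (card (patches X B))"
  using assms(3-)
proof (induction T)
  case (insert t T)
  let ?g = "\<lambda>a. \<Prod>s\<in>T. resampling_ratio \<mu> (\<Lambda> s) (\<Lambda>' s) a"
  have "(\<Sum>a\<in>patches X B. \<Prod>t\<in>insert t T. resampling_ratio \<mu> (\<Lambda> t) (\<Lambda>' t) a)
      = (\<Sum>a\<in>patches X B. resampling_ratio \<mu> (\<Lambda> t) (\<Lambda>' t) a * ?g a)"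
    using insert.hyps by simp
  also have "\<dots> \<le> (\<Sum>a\<in>patches X B. ?g a)"
  proof (rule sum_resampling_ratio_le[OF \<mu> _ _ fin])
    show "\<Lambda> t \<union> outer_boundary 2 (\<Lambda> t) \<subseteq> \<Lambda>' t" "\<Lambda>' t \<subseteq> B" using insert.prems by auto
    show "0 \<le> ?g a" for a by (intro prod_nonneg ballI resampling_ratio_nonneg)
    fix a b :: "'a config" assume eq: "restrict a (B - \<Lambda> t) = restrict b (B - \<Lambda> t)"
    have "resampling_ratio \<mu> (\<Lambda> s) (\<Lambda>' s) a = resampling_ratio \<mu> (\<Lambda> s) (\<Lambda>' s) b" if "s \<in> T" for s
    proof -
      have "\<Lambda>' s \<inter> \<Lambda>' t = {}" using that insert.hyps insert.prems(3)[of s t] by auto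
      moreover have "\<Lambda> t \<subseteq> \<Lambda>' t" "\<Lambda>' s \<subseteq> B" using insert.prems(1)[of t] insert.prems(2)[of s] that by auto
      ultimately have "\<Lambda>' s \<subseteq> B - \<Lambda> t" by blast
      then show ?thesis using eq resampling_ratio_restrict[of "\<Lambda>' s" "B - \<Lambda> t"] by metis
    qed
    then show "?g a = ?g b" by simp
  qed
  also have "\<dots> \<le> real (card (patches X B))" using insert.prems by (intro insert.IH) auto
  finally show ?case .
qed simp

lemma resampling_ratio_pos:
  assumes \<mu>: "config_prob \<mu>" and fin: "finite \<Lambda>'" and a: "a \<in> patches X \<Lambda>'" and pos: "0 < pr \<mu> \<Lambda>' a"
  shows "0 < resampling_ratio \<mu> \<Lambda> \<Lambda>' a"
proof -
  have "pr \<mu> \<Lambda>' a \<le> pr \<mu> (\<Lambda>' - \<Lambda>) a" using fin by (intro block_prob_mono[OF \<mu>]) auto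
  then show ?thesis using pos card_fillings_pos[OF fin a, of \<Lambda>] by (simp add: resampling_ratio_def)
qed

text \<open>
  This is the Gibbs inequality for the block distribution and the comparison distribution that gives each patch
  on \<open>B\<close> the product of its resampling ratios divided by the number of patches. Its mass is at
  most 1 by \<open>sum_prod_resampling_ratio_le\<close>, and the mean logarithm of each ratio is a deficit.
\<close>
lemma block_entropy_le_deficit:
  assumes \<mu>: "config_prob \<mu>" and fin: "finite B" and T: "finite T"
    and sub: "\<And>t. t \<in> T \<Longrightarrow> \<Lambda> t \<union> outer_boundary 2 (\<Lambda> t) \<subseteq> \<Lambda>' t"
    and subB: "\<And>t. t \<in> T \<Longrightarrow> \<Lambda>' t \<subseteq> B"
    and disj: "\<And>s t. s \<in> T \<Longrightarrow> t \<in> T \<Longrightarrow> s \<noteq> t \<Longrightarrow> \<Lambda>' s \<inter> \<Lambda>' t = {}"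
  shows "block_entropy X \<mu> B
    \<le> ln (real (card (patches X B))) - (\<Sum>t\<in>T. conditional_deficit \<mu> (\<Lambda> t) (\<Lambda>' t))"
proof -
  let ?p = "pr \<mu> B" and ?r = "\<lambda>t. resampling_ratio \<mu> (\<Lambda> t) (\<Lambda>' t)"
  let ?Z = "real (card (patches X B))"
  have "patches X B \<noteq> {}" using sum_block_prob[OF \<mu> fin] by (auto simp del: patches_empty_iff)
  then have Z: "0 < ?Z" using fin by (simp add: card_gt_0_iff)
  have pos: "0 < ?r t a" if "a \<in> patches X B" "0 < ?p a" "t \<in> T" for t a
  proof -
    have "?p a \<le> pr \<mu> (\<Lambda>' t) a" by (rule block_prob_mono[OF \<mu> fin subB[OF that(3)]])
    then have "0 < pr \<mu> (\<Lambda>' t) (restrict a (\<Lambda>' t))" using that by (simp add: block_prob_restrict)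
    then have "0 < ?r t (restrict a (\<Lambda>' t))"
      using finite_subset[OF subB fin] restrict_patches[OF that(1)] subB that
      by (intro resampling_ratio_pos[OF \<mu>]) auto
    then show ?thesis by (simp add: resampling_ratio_restrict)
  qed
  have "(\<Sum>a\<in>patches X B. ?p a * ln ((\<Prod>t\<in>T. ?r t a) / ?Z)) \<le> (\<Sum>a\<in>patches X B. ?p a * ln (?p a))"
  proof (rule gibbs_inequality)
    show "(\<Sum>a\<in>patches X B. (\<Prod>t\<in>T. ?r t a) / ?Z) \<le> (\<Sum>a\<in>patches X B. ?p a)"
      using sum_prod_resampling_ratio_le[OF \<mu> fin T sub subB disj] Z
      by (simp add: sum_block_prob[OF \<mu> fin] flip: sum_divide_distrib)
    show "0 \<le> (\<Prod>t\<in>T. ?r t a) / ?Z" for a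
      using Z by (intro divide_nonneg_pos prod_nonneg ballI resampling_ratio_nonneg)
    show "0 < (\<Prod>t\<in>T. ?r t a) / ?Z" if "a \<in> patches X B" "0 < ?p a" for a
      using Z pos[OF that] by (intro divide_pos_pos prod_pos) auto
  qed (use fin in \<open>auto simp: block_prob_nonneg\<close>)
  moreover have "(\<Sum>a\<in>patches X B. ?p a * ln ((\<Prod>t\<in>T. ?r t a) / ?Z))
      = (\<Sum>a\<in>patches X B. (\<Sum>t\<in>T. ?p a * ln (?r t (restrict a (\<Lambda>' t)))) - ?p a * ln ?Z)"
  proof (rule sum.cong[OF refl])
    fix a assume a: "a \<in> patches X B"
    show "?p a * ln ((\<Prod>t\<in>T. ?r t a) / ?Z)
        = (\<Sum>t\<in>T. ?p a * ln (?r t (restrict a (\<Lambda>' t)))) - ?p a * ln ?Z"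
    proof (cases "?p a = 0")
      case False
      then have p: "0 < ?p a" using block_prob_nonneg[of X \<mu> B a] by linarith
      have "ln (\<Prod>t\<in>T. ?r t a) = (\<Sum>t\<in>T. ln (?r t a))"
        using pos[OF a p] by (intro ln_prod T) force
      moreover have "0 < (\<Prod>t\<in>T. ?r t a)" using pos[OF a p] by (intro prod_pos) auto
      ultimately show ?thesis
        using Z by (simp add: ln_div resampling_ratio_restrict right_diff_distrib sum_distrib_left)
    qed simp
  qed
  moreover have "\<dots> = (\<Sum>t\<in>T. conditional_deficit \<mu> (\<Lambda> t) (\<Lambda>' t)) - ln ?Z"
  proof -
    have "(\<Sum>a\<in>patches X B. \<Sum>t\<in>T. ?p a * ln (?r t (restrict a (\<Lambda>' t))))
        = (\<Sum>t\<in>T. \<Sum>a\<in>patches X B. ?p a * ln (?r t (restrict a (\<Lambda>' t))))" by (rule sum.swap)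
    also have "\<dots> = (\<Sum>t\<in>T. conditional_deficit \<mu> (\<Lambda> t) (\<Lambda>' t))"
      unfolding conditional_deficit_def
      by (intro sum.cong refl sum_block_prob_marginal[OF \<mu> fin subB, where g = "\<lambda>a. ln (?r _ a)"])
    finally show ?thesis
      by (simp add: sum_subtractf sum_block_prob[OF \<mu> fin] flip: sum_distrib_right)
  qed
  ultimately show ?thesis by (simp add: block_entropy_def)
qed

lemma image_plus_diff: "(+) t ` \<Lambda>' - (+) t ` \<Lambda> = (+) t ` (\<Lambda>' - \<Lambda>)" for t :: site
  by (simp add: image_set_diff)

lemma card_fillings_shift:
  "card (fillings X ((+) t ` \<Lambda>) ((+) t ` \<Lambda>') a) = card (fillings X \<Lambda> \<Lambda>' (shift t a))"
proof -
  have bij: "bij_betw (shift t) (patches X ((+) t ` \<Lambda>')) (patches X \<Lambda>')" by (rule shift_bij_patches)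
  have "(restrict b ((+) t ` (\<Lambda>' - \<Lambda>)) = restrict a ((+) t ` (\<Lambda>' - \<Lambda>)))
      \<longleftrightarrow> (restrict (shift t b) (\<Lambda>' - \<Lambda>) = restrict (shift t a) (\<Lambda>' - \<Lambda>))" for b
    by (simp add: restrict_eq_iff shift_def)
  then have "shift t ` fillings X ((+) t ` \<Lambda>) ((+) t ` \<Lambda>') a = fillings X \<Lambda> \<Lambda>' (shift t a)"
    unfolding fillings_def image_plus_diff bij_betw_imp_surj_on[OF bij, symmetric] by auto
  moreover have "inj_on (shift t) (fillings X ((+) t ` \<Lambda>) ((+) t ` \<Lambda>') a)"
    using bij_betw_imp_inj_on[OF bij] by (rule inj_on_subset) (auto simp: fillings_def)
  ultimately show ?thesis by (metis card_image)
qed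

lemma conditional_deficit_shift:
  assumes "\<mu> \<in> invariant_measures A X" "finite \<Lambda>'"
  shows "conditional_deficit \<mu> ((+) t ` \<Lambda>) ((+) t ` \<Lambda>') = conditional_deficit \<mu> \<Lambda> \<Lambda>'"
  unfolding conditional_deficit_def resampling_ratio_def image_plus_diff card_fillings_shift
  by (subst sum.reindex_bij_betw[OF shift_bij_patches[of t], symmetric])
    (simp add: block_prob_shift[OF assms(1)] assms(2))

lemma outer_boundary_translate: "outer_boundary r ((+) t ` \<Lambda>) = (+) t ` outer_boundary r \<Lambda>"
proof (intro equalityI subsetI)
  fix z assume z: "z \<in> outer_boundary r ((+) t ` \<Lambda>)"
  have "z - t \<in> outer_boundary r \<Lambda>" using z
    by (force simp: outer_boundary_iff l1_dist_def image_iff algebra_simps)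
  then show "z \<in> (+) t ` outer_boundary r \<Lambda>" by (intro image_eqI[of _ _ "z - t"]) auto
qed (auto simp: outer_boundary_iff l1_dist_def)

text \<open>
  A large box contains disjoint translates of \<open>\<Lambda>'\<close> in number proportional to its area, and each of them
  costs the same deficit. A positive deficit would push the entropy per site strictly below the topological
  entropy.
\<close>
lemma conditional_deficit_nonpos:
  assumes max: "\<mu> \<in> max_entropy_measures A X"
    and fin: "finite \<Lambda>'" and sub: "\<Lambda> \<union> outer_boundary 2 \<Lambda> \<subseteq> \<Lambda>'"
  shows "conditional_deficit \<mu> \<Lambda> \<Lambda>' \<le> 0"
proof -
  have inv: "\<mu> \<in> invariant_measures A X" and h: "measure_entropy A X \<mu> = top_entropy A X"
    using max by (auto simp: max_entropy_measures_def)
  have \<mu>: "config_prob \<mu>" by (rule invariant_config_prob[OF inv])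
  have "X \<noteq> {}" using sum_block_prob[OF \<mu> finite_box[of 0]] by (auto simp: patches_def)
  let ?c = "conditional_deficit \<mu> \<Lambda> \<Lambda>'"
  obtain m where m: "\<Lambda>' \<subseteq> box m" using finite_subset_box[OF fin] .
  let ?q = "\<lambda>n. real (((2 * n + 1) div (2 * m + 1))\<^sup>2)"
  have bound: "block_entropy X \<mu> (box n) / real (card (box n))
      \<le> ln (real (card (patches X (box n)))) / real (card (box n)) - ?q n / real (card (box n)) * ?c" for n
  proof -
    obtain T where T: "finite T" "card T = ((2 * n + 1) div (2 * m + 1))\<^sup>2"
      "\<And>t. t \<in> T \<Longrightarrow> (+) t ` box m \<subseteq> box n"
      "\<And>s t. s \<in> T \<Longrightarrow> t \<in> T \<Longrightarrow> s \<noteq> t \<Longrightarrow> (+) s ` box m \<inter> (+) t ` box m = {}"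
      using box_packing[of n m] by metis
    have "block_entropy X \<mu> (box n) \<le> ln (real (card (patches X (box n))))
        - (\<Sum>t\<in>T. conditional_deficit \<mu> ((+) t ` \<Lambda>) ((+) t ` \<Lambda>'))"
    proof (rule block_entropy_le_deficit[OF \<mu> finite_box T(1)])
      show "(+) t ` \<Lambda> \<union> outer_boundary 2 ((+) t ` \<Lambda>) \<subseteq> (+) t ` \<Lambda>'" for t
        using sub unfolding outer_boundary_translate by blast
      show "(+) t ` \<Lambda>' \<subseteq> box n" if "t \<in> T" for t using T(3)[OF that] m by blast
      show "(+) s ` \<Lambda>' \<inter> (+) t ` \<Lambda>' = {}" if "s \<in> T" "t \<in> T" "s \<noteq> t" for s t
        using T(4)[OF that] m by blast
    qed
    also have "(\<Sum>t\<in>T. conditional_deficit \<mu> ((+) t ` \<Lambda>) ((+) t ` \<Lambda>')) = ?q n * ?c"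
      by (simp add: conditional_deficit_shift[OF inv fin] T(2))
    finally have "block_entropy X \<mu> (box n) / real (card (box n))
        \<le> (ln (real (card (patches X (box n)))) - ?q n * ?c) / real (card (box n))"
      by (intro divide_right_mono) auto
    then show ?thesis by (simp add: diff_divide_distrib)
  qed
  have "(\<lambda>n. ?q n / real (card (box n))) \<longlonglongrightarrow> 1 / (2 * real m + 1)\<^sup>2"
  proof -
    have "(\<lambda>n. real (((2 * n + 1) div (2 * m + 1))\<^sup>2 * (2 * m + 1)\<^sup>2) / real (card (box n)) / (2 * real m + 1)\<^sup>2)
        \<longlonglongrightarrow> 1 / (2 * real m + 1)\<^sup>2"
      by (intro tendsto_divide packing_density tendsto_const) (simp add: add_nonneg_eq_0_iff)
    moreover have "real (((2 * n + 1) div (2 * m + 1))\<^sup>2 * (2 * m + 1)\<^sup>2) / real (card (box n)) / (2 * real m + 1)\<^sup>2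
        = ?q n / real (card (box n))" for n
    proof -
      have cancel: "x * c / d / c = x / d" if "c \<noteq> 0" for x c d :: real using that by simp
      have pos: "(2 * real m + 1)\<^sup>2 \<noteq> 0" by (simp add: add_nonneg_eq_0_iff)
      have "real (((2 * n + 1) div (2 * m + 1))\<^sup>2 * (2 * m + 1)\<^sup>2) = ?q n * (2 * real m + 1)\<^sup>2"
        by simp
      then show ?thesis by (simp only: cancel[OF pos])
    qed
    ultimately show ?thesis by simp
  qed
  then have "(\<lambda>n. ln (real (card (patches X (box n)))) / real (card (box n)) - ?q n / real (card (box n)) * ?c)
      \<longlonglongrightarrow> top_entropy A X - 1 / (2 * real m + 1)\<^sup>2 * ?c"
    by (intro tendsto_diff tendsto_mult tendsto_const card_patches_tendsto[OF \<open>X \<noteq> {}\<close>])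
  from LIMSEQ_le[OF block_entropy_tendsto[OF inv] this]
  have "measure_entropy A X \<mu> \<le> top_entropy A X - 1 / (2 * real m + 1)\<^sup>2 * ?c" using bound by blast
  then have "1 / (2 * real m + 1)\<^sup>2 * ?c \<le> 0" using h by simp
  moreover have "0 < 1 / (2 * real m + 1)\<^sup>2" by (simp add: add_nonneg_pos)
  ultimately show ?thesis by (simp only: mult_le_0_iff) linarith
qed

text \<open>
  The deficit is also the relative entropy of the block distribution on \<open>\<Lambda>'\<close> with respect to the distribution
  obtained from it by resampling \<open>\<Lambda>\<close> uniformly. Since the deficit is not positive, the two
  distributions coincide.
\<close>
lemma max_entropy_imp_gibbs:
  assumes max: "\<mu> \<in> max_entropy_measures A X"
  shows "gibbs (\<lambda>_. 1) \<mu>"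
  unfolding gibbs_uniform_iff
proof (intro allI impI ballI)
  fix \<Lambda> \<Lambda>' a
  assume fin: "finite \<Lambda>'" and sub: "\<Lambda> \<union> outer_boundary 2 \<Lambda> \<subseteq> \<Lambda>'" and a: "a \<in> patches X \<Lambda>'"
  have "\<mu> \<in> invariant_measures A X" using max by (simp add: max_entropy_measures_def)
  then have \<mu>: "config_prob \<mu>" by (rule invariant_config_prob)
  let ?p = "pr \<mu> \<Lambda>'" and ?q = "\<lambda>a. pr \<mu> (\<Lambda>' - \<Lambda>) a / real (card (fillings X \<Lambda> \<Lambda>' a))"
  have mono: "?p a \<le> pr \<mu> (\<Lambda>' - \<Lambda>) a" for a using fin by (intro block_prob_mono[OF \<mu>]) auto
  have "?p a = ?q a"
  proof (rule gibbs_equality[of "patches X \<Lambda>'" ?p ?q])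
    show "finite (patches X \<Lambda>')" using fin by simp
    show "0 \<le> ?p a" "0 \<le> ?q a" for a by (simp_all add: block_prob_nonneg)
    show "0 < ?q a" if "a \<in> patches X \<Lambda>'" "0 < ?p a" for a
      using that card_fillings_pos[OF fin that(1), of \<Lambda>] mono[of a] by simp
    have "(\<Sum>a\<in>patches X \<Lambda>'. ?q a) = (\<Sum>v\<in>patches X (\<Lambda>' - \<Lambda>). \<Sum>a\<in>fillings X \<Lambda> \<Lambda>' v. ?q a)"
      by (rule sum_patches_by_fillings[OF fin])
    also have "\<dots> = (\<Sum>v\<in>patches X (\<Lambda>' - \<Lambda>). pr \<mu> (\<Lambda>' - \<Lambda>) v)"
    proof (rule sum.cong[OF refl])
      fix v assume v: "v \<in> patches X (\<Lambda>' - \<Lambda>)"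
      then obtain x where x: "x \<in> X" "v = restrict x (\<Lambda>' - \<Lambda>)" by (auto simp: patches_def)
      then have "fillings X \<Lambda> \<Lambda>' v = fillings X \<Lambda> \<Lambda>' (restrict x \<Lambda>')"
        by (intro fillings_cong) (auto simp: restrict_eq_iff)
      then have pos: "0 < card (fillings X \<Lambda> \<Lambda>' v)"
        using card_fillings_pos[OF fin, of "restrict x \<Lambda>'"] x by (simp add: patches_def)
      have "?q b = ?q v" if "b \<in> fillings X \<Lambda> \<Lambda>' v" for b
      proof -
        have eq: "restrict b (\<Lambda>' - \<Lambda>) = restrict v (\<Lambda>' - \<Lambda>)" using that by (simp add: fillings_def)
        then show ?thesis using fillings_cong[OF eq] by (simp add: block_prob_def)
      qed
      then have "(\<Sum>b\<in>fillings X \<Lambda> \<Lambda>' v. ?q b) = (\<Sum>b\<in>fillings X \<Lambda> \<Lambda>' v. ?q v)"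
        by (intro sum.cong) auto
      then show "(\<Sum>b\<in>fillings X \<Lambda> \<Lambda>' v. ?q b) = pr \<mu> (\<Lambda>' - \<Lambda>) v" using pos by simp
    qed
    finally show "(\<Sum>a\<in>patches X \<Lambda>'. ?q a) \<le> (\<Sum>a\<in>patches X \<Lambda>'. ?p a)"
      using fin by (simp add: sum_block_prob[OF \<mu>])
    have "?p a * ln (resampling_ratio \<mu> \<Lambda> \<Lambda>' a) = ?p a * ln (?p a) - ?p a * ln (?q a)"
      if "a \<in> patches X \<Lambda>'" for a
    proof (cases "?p a = 0")
      case False
      then have p: "0 < ?p a" using block_prob_nonneg[of X \<mu> \<Lambda>' a] by linarith
      then have "0 < ?q a" using that card_fillings_pos[OF fin that(1), of \<Lambda>] mono[of a] by simp
      moreover have "resampling_ratio \<mu> \<Lambda> \<Lambda>' a = ?p a / ?q a" by (simp add: resampling_ratio_def)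
      ultimately show ?thesis using p by (simp only: ln_divide_pos right_diff_distrib)
    qed simp
    then have "conditional_deficit \<mu> \<Lambda> \<Lambda>' = (\<Sum>a\<in>patches X \<Lambda>'. ?p a * ln (?p a)) - (\<Sum>a\<in>patches X \<Lambda>'. ?p a * ln (?q a))"
      by (simp add: conditional_deficit_def sum_subtractf)
    then show "(\<Sum>a\<in>patches X \<Lambda>'. ?p a * ln (?p a)) \<le> (\<Sum>a\<in>patches X \<Lambda>'. ?p a * ln (?q a))"
      using conditional_deficit_nonpos[OF max fin sub] by linarith
  qed (rule a)
  then show "?p a * real (card (fillings X \<Lambda> \<Lambda>' a)) = pr \<mu> (\<Lambda>' - \<Lambda>) a"
    using card_fillings_pos[OF fin a, of \<Lambda>] by simp
qed

section \<open>Uniform Gibbs measures have maximal entropy\<close>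
definition combines_at_distance :: "nat \<Rightarrow> bool" where
  "combines_at_distance l \<longleftrightarrow> (\<forall>\<Lambda> \<Lambda>' a b. finite \<Lambda> \<longrightarrow> finite \<Lambda>' \<longrightarrow> \<Lambda> \<inter> \<Lambda>' = {} \<longrightarrow>
     enat l \<le> l1_setdist \<Lambda> \<Lambda>' \<longrightarrow> a \<in> patches X \<Lambda> \<longrightarrow> b \<in> patches X \<Lambda>' \<longrightarrow>
     (\<exists>x\<in>X. restrict x \<Lambda> = a \<and> restrict x \<Lambda>' = b))"

text \<open>
  A layer of width \<open>l\<close> separates \<open>box n\<close> from the boundary condition, so each patch on \<open>box n\<close> occurs in
  a filling of \<open>box (n + l)\<close>.
\<close>
lemma card_fillings_ge:
  assumes sep: "combines_at_distance l"
    and fin: "finite \<Lambda>'" and box: "box (n + l) \<subseteq> \<Lambda>'" and a: "a \<in> patches X \<Lambda>'"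
  shows "card (patches X (box n)) \<le> card (fillings X (box (n + l)) \<Lambda>' a)"
proof -
  let ?D = "\<Lambda>' - box (n + l)"
  have "\<exists>b\<in>fillings X (box (n + l)) \<Lambda>' a. restrict b (box n) = d" if d: "d \<in> patches X (box n)" for d
  proof -
    have "l \<le> l1_dist z w" if "z \<in> box n" "w \<in> ?D" for z w
      using that by (cases z, cases w) (auto simp: box_def l1_dist_def)
    then have "enat l \<le> l1_setdist (box n) ?D" by (auto simp: l1_setdist_ge_iff)
    moreover have "box n \<inter> ?D = {}" using box_mono[of n "n + l"] by auto
    moreover have "restrict a ?D \<in> patches X ?D" using a by (rule restrict_patches) auto
    ultimately obtain x where x: "x \<in> X" "restrict x (box n) = d" "restrict x ?D = restrict a ?D"
      using sep[unfolded combines_at_distance_def, rule_format, of "box n" ?D d "restrict a ?D"] fin d by auto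
    have "restrict (restrict x \<Lambda>') ?D = restrict a ?D"
      using x(3) by (simp add: restrict_eq_iff del: restrict_restrict)
    then have "restrict x \<Lambda>' \<in> fillings X (box (n + l)) \<Lambda>' a"
      using x(1) by (simp add: fillings_def patches_def)
    moreover have "restrict (restrict x \<Lambda>') (box n) = d"
      using x(2) box box_mono[of n "n + l"] by (simp add: Int_absorb1 subset_trans)
    ultimately show ?thesis by blast
  qed
  then have "patches X (box n) \<subseteq> (\<lambda>b. restrict b (box n)) ` fillings X (box (n + l)) \<Lambda>' a" by blast
  then show ?thesis using fin by (intro surj_card_le) auto
qed

lemma strongly_irreducible_patches:
  assumes "strongly_irreducible A X"
  obtains l where "combines_at_distance l"
proof -
  obtain l where l: "\<And>\<Lambda> \<Lambda>' a b. finite \<Lambda> \<Longrightarrow> finite \<Lambda>' \<Longrightarrow> \<Lambda> \<inter> \<Lambda>' = {} \<Longrightarrow> enat l \<le> l1_setdist \<Lambda> \<Lambda>' \<Longrightarrow>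
      a \<in> \<Lambda> \<rightarrow>\<^sub>E A \<Longrightarrow> b \<in> \<Lambda>' \<rightarrow>\<^sub>E A \<Longrightarrow> a \<in> patches X \<Lambda> \<Longrightarrow> b \<in> patches X \<Lambda>' \<Longrightarrow>
      cylinder X (\<Lambda> \<union> \<Lambda>') (merge \<Lambda> \<Lambda>' (a, b)) \<noteq> {}"
    using assms unfolding strongly_irreducible_def admissible_def cylinder_nonempty_iff by metis
  show thesis
  proof (rule that[of l], unfold combines_at_distance_def, intro allI impI)
    fix \<Lambda> \<Lambda>' a b
    assume *: "finite \<Lambda>" "finite \<Lambda>'" "\<Lambda> \<inter> \<Lambda>' = {}" "enat l \<le> l1_setdist \<Lambda> \<Lambda>'" "a \<in> patches X \<Lambda>" "b \<in> patches X \<Lambda>'"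
    then obtain x where x: "x \<in> X" "restrict x (\<Lambda> \<union> \<Lambda>') = merge \<Lambda> \<Lambda>' (a, b)"
      using l[OF *(1-4) subsetD[OF patches_subset *(5)] subsetD[OF patches_subset *(6)] *(5,6)]
      by (auto simp: cylinder_def)
    have "x z = merge \<Lambda> \<Lambda>' (a, b) z" if "z \<in> \<Lambda> \<union> \<Lambda>'" for z
      using fun_cong[OF x(2), of z] that by (simp add: restrict_def)
    then have "restrict x \<Lambda> = restrict a \<Lambda>" "restrict x \<Lambda>' = restrict b \<Lambda>'"
      using *(3) by (auto simp: restrict_eq_iff merge_def)
    then show "\<exists>x\<in>X. restrict x \<Lambda> = a \<and> restrict x \<Lambda>' = b" using x(1) *(5,6) restrict_patch by metis
  qed
qed

text \<open>
  Given the boundary condition of \<open>box (n + l)\<close>, all fillings are equally likely, and there are at least as many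
  as patches on \<open>box n\<close>. Hence no patch on \<open>box (n + l)\<close> is more likely than the reciprocal of that number,
  which bounds the block entropy from below by its logarithm. The layer of width \<open>l\<close> does not affect the
  entropy per site.
\<close>
lemma gibbs_imp_max_entropy:
  assumes si: "strongly_irreducible A X"
    and inv: "\<mu> \<in> invariant_measures A X" and gibbs: "gibbs (\<lambda>_. 1) \<mu>"
  shows "\<mu> \<in> max_entropy_measures A X"
proof -
  have \<mu>: "config_prob \<mu>" by (rule invariant_config_prob[OF inv])
  have ne: "X \<noteq> {}" using sum_block_prob[OF \<mu> finite_box[of 0]] by (auto simp: patches_def)
  obtain l where sep: "combines_at_distance l" using strongly_irreducible_patches[OF si] .
  have lower: "ln (real (card (patches X (box n)))) \<le> block_entropy X \<mu> (box (n + l))" for n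
  proof -
    let ?B = "box (n + l)" and ?M = "real (card (patches X (box n)))"
    let ?B' = "?B \<union> outer_boundary 2 ?B"
    have finB: "finite ?B'" by (simp add: finite_outer_boundary)
    have M: "0 < ?M" using ne by (simp add: card_gt_0_iff)
    \<comment> \<open>Sum over the boundary conditions that \<open>b\<close> may have; \<open>b\<close> and the boundary condition determine
       the patch on \<open>?B'\<close>.\<close>
    have small: "pr \<mu> ?B b \<le> 1 / ?M" if b: "b \<in> patches X ?B" for b
    proof -
      let ?I = "{a \<in> patches X ?B'. restrict a ?B = restrict b ?B}"
      have "pr \<mu> ?B b = (\<Sum>a\<in>?I. pr \<mu> ?B' a)"
        by (rule block_prob_split[OF \<mu> finB]) simp
      also have "\<dots> \<le> (\<Sum>a\<in>?I. pr \<mu> (?B' - ?B) (restrict a (?B' - ?B)) / ?M)"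
      proof (rule sum_mono)
        fix a assume "a \<in> ?I"
        then have a: "a \<in> patches X ?B'" by simp
        have "card (patches X (box n)) \<le> card (fillings X ?B ?B' a)"
          by (rule card_fillings_ge[OF sep finB Un_upper1 a])
        then have "pr \<mu> ?B' a * ?M \<le> pr \<mu> ?B' a * real (card (fillings X ?B ?B' a))"
          by (intro mult_left_mono block_prob_nonneg) (simp only: of_nat_le_iff)
        also have "\<dots> = pr \<mu> (?B' - ?B) a"
          using gibbs finB a unfolding gibbs_uniform_iff by blast
        finally show "pr \<mu> ?B' a \<le> pr \<mu> (?B' - ?B) (restrict a (?B' - ?B)) / ?M"
          using M by (simp add: block_prob_restrict pos_le_divide_eq)
      qed
      also have "\<dots> = (\<Sum>v\<in>(\<lambda>a. restrict a (?B' - ?B)) ` ?I. pr \<mu> (?B' - ?B) v) / ?M"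
      proof -
        have "inj_on (\<lambda>a. restrict a (?B' - ?B)) ?I"
        proof (rule inj_onI)
          fix a c assume ac: "a \<in> ?I" "c \<in> ?I" "restrict a (?B' - ?B) = restrict c (?B' - ?B)"
          then have eq: "restrict a ?B = restrict c ?B" by simp
          have "a z = c z" if "z \<in> ?B'" for z
            using that eq ac(3) unfolding restrict_eq_iff by (cases "z \<in> ?B") auto
          then have "restrict a ?B' = restrict c ?B'" unfolding restrict_eq_iff by blast
          then show "a = c" using ac(1,2) restrict_patch by (metis (no_types, lifting) mem_Collect_eq)
        qed
        then show ?thesis by (simp only: sum.reindex sum_divide_distrib comp_def)
      qed
      also have "\<dots> \<le> (\<Sum>v\<in>patches X (?B' - ?B). pr \<mu> (?B' - ?B) v) / ?M"
      proof (intro divide_right_mono sum_mono2)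
        show "(\<lambda>a. restrict a (?B' - ?B)) ` ?I \<subseteq> patches X (?B' - ?B)"
          using restrict_patches[of _ X ?B' "?B' - ?B"] by blast
      qed (use finB M in \<open>auto simp: block_prob_nonneg\<close>)
      also have "\<dots> = 1 / ?M" using finB by (simp add: sum_block_prob[OF \<mu>])
      finally show ?thesis .
    qed
    have "(\<Sum>a\<in>patches X ?B. pr \<mu> ?B a * ln (pr \<mu> ?B a))
        \<le> (\<Sum>a\<in>patches X ?B. pr \<mu> ?B a * ln (1 / ?M))"
    proof (rule sum_mono)
      fix a assume a: "a \<in> patches X ?B"
      show "pr \<mu> ?B a * ln (pr \<mu> ?B a) \<le> pr \<mu> ?B a * ln (1 / ?M)"
      proof (cases "pr \<mu> ?B a = 0")
        case False
        then have "0 < pr \<mu> ?B a" using block_prob_nonneg[of X \<mu> ?B a] by linarith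
        moreover from this have "ln (pr \<mu> ?B a) \<le> ln (1 / ?M)"
          using small[OF a] M by (subst ln_le_cancel_iff) auto
        ultimately show ?thesis by simp
      qed simp
    qed
    also have "\<dots> = ln (1 / ?M)" by (simp add: sum_block_prob[OF \<mu>] flip: sum_distrib_right)
    finally show ?thesis using ne M by (simp add: block_entropy_def ln_div)
  qed
  have upper: "block_entropy X \<mu> (box n) \<le> ln (real (card (patches X (box n))))" for n
    using block_entropy_le_deficit[OF \<mu> finite_box, of "{}"] by simp
  have card_pos: "0 < real (card (box n))" for n by (simp add: card_box)
  have "measure_entropy A X \<mu> \<le> top_entropy A X"
    using upper card_pos
    by (intro LIMSEQ_le[OF block_entropy_tendsto[OF inv] card_patches_tendsto[OF ne]])
      (auto intro!: divide_right_mono)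
  moreover have "top_entropy A X \<le> measure_entropy A X \<mu>"
  proof (rule LIMSEQ_le)
    have "filterlim (\<lambda>n::nat. real (2 * n + 2 * l + 1)) at_top sequentially"
      by (rule filterlim_at_top_mono[OF filterlim_real_sequentially]) simp
    then have "(\<lambda>n. real (2 * l) / real (2 * n + 2 * l + 1)) \<longlonglongrightarrow> 0"
      by (rule real_tendsto_divide_at_top[OF tendsto_const])
    then have "(\<lambda>n. (1 - real (2 * l) / real (2 * n + 2 * l + 1))\<^sup>2) \<longlonglongrightarrow> (1 - 0)\<^sup>2"
      by (intro tendsto_intros)
    moreover have "(1 - real (2 * l) / real (2 * n + 2 * l + 1))\<^sup>2 = real (card (box n)) / real (card (box (n + l)))" for n
    proof -
      have "1 - real (2 * l) / real (2 * n + 2 * l + 1) = real (2 * n + 1) / real (2 * n + 2 * l + 1)"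
        by (simp add: field_simps)
      moreover have "card (box (n + l)) = (2 * n + 2 * l + 1)\<^sup>2"
        by (simp add: card_box distrib_left)
      ultimately show ?thesis by (simp only: card_box power_divide of_nat_power)
    qed
    ultimately have "(\<lambda>n. real (card (box n)) / real (card (box (n + l)))) \<longlonglongrightarrow> 1" by simp
    from tendsto_mult[OF card_patches_tendsto[OF ne] this]
    show "(\<lambda>n. ln (real (card (patches X (box n)))) / real (card (box (n + l)))) \<longlonglongrightarrow> top_entropy A X"
      by simp
    show "(\<lambda>n. block_entropy X \<mu> (box (n + l)) / real (card (box (n + l)))) \<longlonglongrightarrow> measure_entropy A X \<mu>"
      using LIMSEQ_ignore_initial_segment[OF block_entropy_tendsto[OF inv], of l] .
    show "\<exists>N. \<forall>n\<ge>N. ln (real (card (patches X (box n)))) / real (card (box (n + l)))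
        \<le> block_entropy X \<mu> (box (n + l)) / real (card (box (n + l)))"
      using lower card_pos by (auto intro!: divide_right_mono)
  qed
  ultimately show ?thesis using inv by (simp add: max_entropy_measures_def)
qed

theorem max_entropy_iff_gibbs:
  assumes "strongly_irreducible A X"
  shows "max_entropy_measures A X = {\<mu> \<in> invariant_measures A X. gibbs (\<lambda>_. 1) \<mu>}"
proof (intro equalityI subsetI)
  fix \<mu> assume "\<mu> \<in> max_entropy_measures A X"
  then show "\<mu> \<in> {\<mu> \<in> invariant_measures A X. gibbs (\<lambda>_. 1) \<mu>}"
    using max_entropy_imp_gibbs by (simp add: max_entropy_measures_def)
qed (use gibbs_imp_max_entropy[OF assms] in simp)

end

section \<open>The split subshift\<close>
lemma restrict_in_patches: "x \<in> X \<Longrightarrow> restrict x \<Lambda> \<in> patches X \<Lambda>"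
  by (simp add: patches_def)

text \<open>
  The letter \<open>a\<close> is split into \<open>\<kappa> a\<close> copies. The common multiple \<open>M\<close> of the multiplicities is the range of
  independent labels from which the copies will be chosen by taking residues.
\<close>
locale split_sft = sft A L for A :: "'a set" and L :: "'a config set" +
  fixes \<kappa> :: "'a \<Rightarrow> nat" and M :: nat
  assumes \<kappa>_pos: "a \<in> A \<Longrightarrow> 0 < \<kappa> a"
    and \<kappa>_dvd: "a \<in> A \<Longrightarrow> \<kappa> a dvd M"
    and M_pos: "0 < M"
begin

definition A' :: "('a \<times> nat) set" where
  "A' = (SIGMA a:A. {..<\<kappa> a})"

definition L' :: "('a \<times> nat) config set" where
  "L' = {a \<in> cross \<rightarrow>\<^sub>E A'. restrict (color_proj a) cross \<in> L}"

sublocale Y: sft A' L'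
  by standard (simp add: A'_def finite_A)

abbreviation Y :: "('a \<times> nat) config set" where "Y \<equiv> Y.X"

lemma A'_iff: "b \<in> A' \<longleftrightarrow> fst b \<in> A \<and> snd b < \<kappa> (fst b)"
  by (cases b) (simp add: A'_def)

lemma Y_iff: "y \<in> Y \<longleftrightarrow> color_proj y \<in> X \<and> (\<forall>z. snd (y z) < \<kappa> (fst (y z)))"
proof -
  have "restrict (color_proj (restrict (shift z y) cross)) cross = restrict (shift z (color_proj y)) cross" for z
    by (simp add: restrict_eq_iff) (simp add: color_proj_def shift_def)
  then have "restrict (shift z y) cross \<in> L'
      \<longleftrightarrow> (\<forall>s\<in>cross. y (z + s) \<in> A') \<and> restrict (shift z (color_proj y)) cross \<in> L" for z
    by (simp add: L'_def) (simp add: shift_def Pi_def Ball_def)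
  then show ?thesis
    unfolding Y.X_iff X_iff A'_iff color_proj_def by blast
qed

lemma Y_I: "x \<in> X \<Longrightarrow> (\<And>z. u z < \<kappa> (x z)) \<Longrightarrow> (\<lambda>z. (x z, u z)) \<in> Y"
  by (simp add: Y_iff color_proj_def)

lemma color_Y: "y \<in> Y \<Longrightarrow> color_proj y \<in> X"
  by (simp add: Y_iff)

lemma color_shift: "color_proj (shift t y) = shift t (color_proj y)"
  by (simp add: color_proj_def shift_def)

lemma color_restrict: "restrict (color_proj (restrict y \<Lambda>')) \<Lambda> = restrict (color_proj y) (\<Lambda> \<inter> \<Lambda>')"
  if "\<Lambda> \<subseteq> \<Lambda>'"
  using that by (auto simp: color_proj_def restrict_def fun_eq_iff)

lemma X_lift:
  assumes "x \<in> X"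
  obtains y where "y \<in> Y" "color_proj y = x"
proof (rule that)
  show "(\<lambda>z. (x z, 0)) \<in> Y" using assms X_letter \<kappa>_pos by (intro Y_I) auto
qed (simp add: color_proj_def)

lemma \<kappa>_prod_pos: "x \<in> X \<Longrightarrow> 0 < (\<Prod>z\<in>\<Lambda>. real (\<kappa> (x z)))"
  by (intro prod_pos ballI) (simp add: \<kappa>_pos X_letter)

text \<open>
  Only the colors are constrained: a configuration of \<open>X\<close> that combines the colors of the two patches can be
  given their labels.
\<close>
lemma strongly_irreducible_split:
  assumes "strongly_irreducible A X"
  shows "strongly_irreducible A' Y"
proof -
  from assms obtain l where l: "l > 0" "\<And>\<Lambda> \<Lambda>' a b. finite \<Lambda> \<Longrightarrow> finite \<Lambda>' \<Longrightarrow> \<Lambda> \<inter> \<Lambda>' = {} \<Longrightarrow>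
      enat l \<le> l1_setdist \<Lambda> \<Lambda>' \<Longrightarrow> a \<in> \<Lambda> \<rightarrow>\<^sub>E A \<Longrightarrow> b \<in> \<Lambda>' \<rightarrow>\<^sub>E A \<Longrightarrow> admissible X \<Lambda> a \<Longrightarrow> admissible X \<Lambda>' b \<Longrightarrow>
      cylinder X (\<Lambda> \<union> \<Lambda>') (merge \<Lambda> \<Lambda>' (a, b)) \<noteq> {}"
    unfolding strongly_irreducible_def by metis
  have "cylinder Y (\<Lambda> \<union> \<Lambda>') (merge \<Lambda> \<Lambda>' (a, b)) \<noteq> {}"
    if fin: "finite \<Lambda>" "finite \<Lambda>'" and disj: "\<Lambda> \<inter> \<Lambda>' = {}" and far: "enat l \<le> l1_setdist \<Lambda> \<Lambda>'"
      and ab: "admissible Y \<Lambda> a" "admissible Y \<Lambda>' b" for \<Lambda> \<Lambda>' a b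
  proof -
    obtain y y' where y: "y \<in> Y" "a = restrict y \<Lambda>" and y': "y' \<in> Y" "b = restrict y' \<Lambda>'"
      using ab by (auto simp: admissible_def cylinder_def)
    have p: "restrict x \<Lambda> \<in> \<Lambda> \<rightarrow>\<^sub>E A" "admissible X \<Lambda> (restrict x \<Lambda>)" if "x \<in> X" for x \<Lambda>
      using that X_letter by (auto simp: admissible_def cylinder_def)
    obtain x where x: "x \<in> X"
      "restrict x (\<Lambda> \<union> \<Lambda>') = merge \<Lambda> \<Lambda>' (restrict (color_proj y) \<Lambda>, restrict (color_proj y') \<Lambda>')"
      using l(2)[OF fin disj far p(1)[OF color_Y[OF y(1)]] p(1)[OF color_Y[OF y'(1)]]
          p(2)[OF color_Y[OF y(1)]] p(2)[OF color_Y[OF y'(1)]]]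
      unfolding cylinder_def by blast
    have xe: "x z = merge \<Lambda> \<Lambda>' (restrict (color_proj y) \<Lambda>, restrict (color_proj y') \<Lambda>') z"
      if "z \<in> \<Lambda> \<union> \<Lambda>'" for z
      using fun_cong[OF x(2), of z] that by (simp add: restrict_def)
    define u where "u = (\<lambda>z. if z \<in> \<Lambda> then snd (y z) else if z \<in> \<Lambda>' then snd (y' z) else 0)"
    have xy: "x z = fst (y z)" if "z \<in> \<Lambda>" for z
      using xe[of z] that by (simp add: merge_def color_proj_def)
    have xy': "x z = fst (y' z)" if "z \<in> \<Lambda>'" for z
      using xe[of z] that disj by (auto simp: merge_def color_proj_def)
    have "u z < \<kappa> (x z)" for z
      using xy[of z] xy'[of z] y(1) y'(1) \<kappa>_pos X_letter[OF x(1)] by (simp add: u_def Y_iff)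
    then have "(\<lambda>z. (x z, u z)) \<in> Y" by (rule Y_I[OF x(1)])
    moreover have "restrict (\<lambda>z. (x z, u z)) (\<Lambda> \<union> \<Lambda>') = merge \<Lambda> \<Lambda>' (a, b)"
      using xy xy' disj by (auto simp: fun_eq_iff restrict_def merge_def y(2) y'(2) u_def)
    ultimately show ?thesis by (auto simp: cylinder_def)
  qed
  note glue = this
  show ?thesis unfolding strongly_irreducible_def
    by (intro exI[of _ l] conjI l(1) allI impI ballI) (rule glue)
qed

lemma color_vimage_cylinder:
  "color_proj -` cylinder X \<Lambda> a \<inter> Y
    = (\<Union>b\<in>{b \<in> patches Y \<Lambda>. restrict (color_proj b) \<Lambda> = a}. cylinder Y \<Lambda> b)"
proof (rule set_eqI)
  fix y
  have "y \<in> (\<Union>b\<in>{b \<in> patches Y \<Lambda>. restrict (color_proj b) \<Lambda> = a}. cylinder Y \<Lambda> b)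
      \<longleftrightarrow> y \<in> Y \<and> restrict y \<Lambda> \<in> patches Y \<Lambda> \<and> restrict (color_proj (restrict y \<Lambda>)) \<Lambda> = a"
    unfolding cylinder_def UN_iff by simp
  also have "\<dots> \<longleftrightarrow> y \<in> Y \<and> restrict (color_proj y) \<Lambda> = a"
    using restrict_in_patches[of y Y \<Lambda>] by (auto simp: color_restrict)
  finally show "y \<in> color_proj -` cylinder X \<Lambda> a \<inter> Y
      \<longleftrightarrow> y \<in> (\<Union>b\<in>{b \<in> patches Y \<Lambda>. restrict (color_proj b) \<Lambda> = a}. cylinder Y \<Lambda> b)"
    by (auto simp: cylinder_def color_Y)
qed

lemma color_proj_measurable: "color_proj \<in> measurable (config_borel A' Y) (config_borel A X)"
proof (rule measurable_config_borel)
  fix n a assume "a \<in> patches X (box n)"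
  have "color_proj -` cylinder X (box n) a \<inter> Y
      = (\<Union>b\<in>{b \<in> patches Y (box n). restrict (color_proj b) (box n) = a}. cylinder Y (box n) b)"
    by (rule color_vimage_cylinder)
  also have "\<dots> \<in> sets (config_borel A' Y)"
    by (intro sets.finite_UN) (auto intro: Y.sets_cylinder)
  finally show "color_proj -` cylinder X (box n) a \<inter> space (config_borel A' Y) \<in> sets (config_borel A' Y)"
    by simp
qed (simp add: color_Y)

abbreviation push :: "('a \<times> nat) config measure \<Rightarrow> 'a config measure" where
  "push \<equiv> color_pushforward A X"

lemma color_pushforward_prob:
  assumes "Y.config_prob \<mu>"
  shows "config_prob (push \<mu>)"
  using assms color_proj_measurable
  by (simp add: config_prob_def color_pushforward_def prob_space.prob_space_distr Y.config_prob_def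
      Y.measurable_config_prob[OF assms])

lemma color_pushforward_block_prob:
  assumes \<mu>: "Y.config_prob \<mu>" and fin: "finite \<Lambda>"
  shows "pr (push \<mu>) \<Lambda> x
    = (\<Sum>b\<in>{b \<in> patches Y \<Lambda>. restrict (color_proj b) \<Lambda> = restrict x \<Lambda>}. Y.pr \<mu> \<Lambda> b)"
proof -
  interpret prob_space \<mu> using \<mu> by (simp add: Y.config_prob_def)
  let ?I = "{b \<in> patches Y \<Lambda>. restrict (color_proj b) \<Lambda> = restrict x \<Lambda>}"
  have "color_proj \<in> measurable \<mu> (config_borel A X)"
    using color_proj_measurable by (simp add: Y.measurable_config_prob[OF \<mu>])
  then have "pr (push \<mu>) \<Lambda> x
      = measure \<mu> (color_proj -` cylinder X \<Lambda> (restrict x \<Lambda>) \<inter> Y)"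
    by (simp add: block_prob_def color_pushforward_def measure_distr sets_cylinder[OF fin] Y.config_prob_space[OF \<mu>])
  also have "color_proj -` cylinder X \<Lambda> (restrict x \<Lambda>) \<inter> Y = (\<Union>b\<in>?I. cylinder Y \<Lambda> b)"
    by (rule color_vimage_cylinder)
  also have "measure \<mu> \<dots> = (\<Sum>b\<in>?I. measure \<mu> (cylinder Y \<Lambda> b))"
  proof (rule finite_measure_finite_Union)
    show "cylinder Y \<Lambda> ` ?I \<subseteq> sets \<mu>"
      using \<mu> Y.sets_cylinder[OF fin] by (simp add: Y.config_prob_def image_subset_iff)
    show "disjoint_family_on (cylinder Y \<Lambda>) ?I" by (auto simp: disjoint_family_on_def cylinder_def)
    show "finite ?I" using fin by simp
  qed
  also have "\<dots> = (\<Sum>b\<in>?I. Y.pr \<mu> \<Lambda> b)"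
    by (intro sum.cong) (auto simp: block_prob_def restrict_patch)
  finally show ?thesis .
qed

lemma color_pushforward_invariant:
  assumes "\<mu> \<in> invariant_measures A' Y"
  shows "push \<mu> \<in> invariant_measures A X"
proof -
  have \<mu>: "Y.config_prob \<mu>" by (rule Y.invariant_config_prob[OF assms])
  have \<pi>: "color_proj \<in> measurable \<mu> (config_borel A X)"
    using color_proj_measurable by (simp add: Y.measurable_config_prob[OF \<mu>])
  have "distr (push \<mu>) (config_borel A X) (shift t) = push \<mu>" for t
  proof -
    have sh: "shift t \<in> measurable \<mu> (config_borel A' Y)"
      using Y.measurable_shift by (simp add: Y.measurable_config_prob[OF \<mu>])
    have "distr (push \<mu>) (config_borel A X) (shift t)
        = distr \<mu> (config_borel A X) (shift t \<circ> color_proj)"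
      unfolding color_pushforward_def by (rule distr_distr[OF measurable_shift \<pi>])
    also have "\<dots> = distr \<mu> (config_borel A X) (color_proj \<circ> shift t)"
      by (simp add: comp_def color_shift)
    also have "\<dots> = distr (distr \<mu> (config_borel A' Y) (shift t)) (config_borel A X) color_proj"
      by (rule distr_distr[OF color_proj_measurable sh, symmetric])
    also have "\<dots> = push \<mu>"
      using assms by (simp add: invariant_measures_def color_pushforward_def)
    finally show ?thesis .
  qed
  then show ?thesis
    using color_pushforward_prob[OF \<mu>] config_prob_space[OF color_pushforward_prob[OF \<mu>]]
    by (simp add: invariant_measures_def config_prob_def)
qed

text \<open>
  The labels of a patch with given colors can be chosen freely, site by site.
\<close>
lemma card_color_class:
  assumes x: "x \<in> X" and fin: "finite \<Lambda>"
  shows "card {b \<in> patches Y \<Lambda>. restrict (color_proj b) \<Lambda> = restrict x \<Lambda>} = (\<Prod>z\<in>\<Lambda>. \<kappa> (x z))"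
proof -
  let ?F = "\<lambda>f. restrict (\<lambda>z. (x z, f z)) \<Lambda>" and ?G = "\<lambda>b. restrict (\<lambda>z. snd (b z)) \<Lambda>"
  have "bij_betw ?F (\<Pi>\<^sub>E z\<in>\<Lambda>. {..<\<kappa> (x z)}) {b \<in> patches Y \<Lambda>. restrict (color_proj b) \<Lambda> = restrict x \<Lambda>}"
  proof (rule bij_betw_byWitness[where f' = ?G])
    show "\<forall>f\<in>\<Pi>\<^sub>E z\<in>\<Lambda>. {..<\<kappa> (x z)}. ?G (?F f) = f"
      by (auto simp: fun_eq_iff restrict_def PiE_def extensional_def)
    show "\<forall>b\<in>{b \<in> patches Y \<Lambda>. restrict (color_proj b) \<Lambda> = restrict x \<Lambda>}. ?F (?G b) = b"
    proof
      fix b assume b: "b \<in> {b \<in> patches Y \<Lambda>. restrict (color_proj b) \<Lambda> = restrict x \<Lambda>}"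
      then have "fst (b z) = x z" if "z \<in> \<Lambda>" for z
        using that by (simp add: restrict_eq_iff color_proj_def)
      then have "?F (?G b) = restrict b \<Lambda>" by (auto simp: fun_eq_iff restrict_def prod_eq_iff)
      moreover have "b \<in> patches Y \<Lambda>" using b by simp
      ultimately show "?F (?G b) = b" by (simp only: restrict_patch)
    qed
    show "?F ` (\<Pi>\<^sub>E z\<in>\<Lambda>. {..<\<kappa> (x z)}) \<subseteq> {b \<in> patches Y \<Lambda>. restrict (color_proj b) \<Lambda> = restrict x \<Lambda>}"
    proof (intro image_subsetI CollectI conjI)
      fix f assume f: "f \<in> (\<Pi>\<^sub>E z\<in>\<Lambda>. {..<\<kappa> (x z)})"
      have "(\<lambda>z. (x z, if z \<in> \<Lambda> then f z else 0)) \<in> Y"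
        using f X_letter[OF x] \<kappa>_pos by (intro Y_I[OF x]) (auto simp: PiE_def Pi_def)
      moreover have "?F f = restrict (\<lambda>z. (x z, if z \<in> \<Lambda> then f z else 0)) \<Lambda>"
        by (simp add: restrict_eq_iff)
      ultimately show "?F f \<in> patches Y \<Lambda>" unfolding patches_def by blast
      show "restrict (color_proj (?F f)) \<Lambda> = restrict x \<Lambda>" by (simp add: restrict_eq_iff color_proj_def)
    qed
    show "?G ` {b \<in> patches Y \<Lambda>. restrict (color_proj b) \<Lambda> = restrict x \<Lambda>} \<subseteq> (\<Pi>\<^sub>E z\<in>\<Lambda>. {..<\<kappa> (x z)})"
    proof (intro image_subsetI)
      fix b assume b: "b \<in> {b \<in> patches Y \<Lambda>. restrict (color_proj b) \<Lambda> = restrict x \<Lambda>}"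
      then obtain y where y: "y \<in> Y" "b = restrict y \<Lambda>" by (auto simp: patches_def)
      have "snd (b z) < \<kappa> (x z)" if "z \<in> \<Lambda>" for z
      proof -
        have "fst (b z) = x z" using b that by (simp add: restrict_eq_iff color_proj_def)
        moreover have "snd (y z) < \<kappa> (fst (y z))" using y(1) by (simp add: Y_iff)
        ultimately show ?thesis using y(2) that by simp
      qed
      then show "?G b \<in> (\<Pi>\<^sub>E z\<in>\<Lambda>. {..<\<kappa> (x z)})" by auto
    qed
  qed
  then have "card {b \<in> patches Y \<Lambda>. restrict (color_proj b) \<Lambda> = restrict x \<Lambda>} = card (\<Pi>\<^sub>E z\<in>\<Lambda>. {..<\<kappa> (x z)})"
    by (rule bij_betw_same_card[symmetric])
  then show ?thesis using fin by (simp add: card_PiE)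
qed

text \<open>
  Inside \<open>\<Lambda>\<close> the labels are free. Hence counting fillings upstairs amounts to counting every filling of the
  colors with the product of its multiplicities, which is its Gibbs weight.
\<close>
lemma card_fillings_split:
  assumes y: "y \<in> Y" and fin: "finite \<Lambda>'" and sub: "\<Lambda> \<subseteq> \<Lambda>'"
  shows "real (card (fillings Y \<Lambda> \<Lambda>' y)) = (\<Sum>b\<in>fillings X \<Lambda> \<Lambda>' (color_proj y). \<Prod>z\<in>\<Lambda>. real (\<kappa> (b z)))"
proof -
  let ?P = "SIGMA b:fillings X \<Lambda> \<Lambda>' (color_proj y). (\<Pi>\<^sub>E z\<in>\<Lambda>. {..<\<kappa> (b z)})"
  let ?F = "\<lambda>(b, f). restrict (\<lambda>z. (b z, if z \<in> \<Lambda> then f z else snd (y z))) \<Lambda>'"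
  let ?G = "\<lambda>c. (restrict (color_proj c) \<Lambda>', restrict (\<lambda>z. snd (c z)) \<Lambda>)"
  have "bij_betw ?F ?P (fillings Y \<Lambda> \<Lambda>' y)"
  proof (rule bij_betw_byWitness[where f' = ?G])
    show "\<forall>p\<in>?P. ?G (?F p) = p"
    proof
      fix p assume "p \<in> ?P"
      then obtain b f where p: "p = (b, f)" "b \<in> patches X \<Lambda>'" "f \<in> (\<Pi>\<^sub>E z\<in>\<Lambda>. {..<\<kappa> (b z)})"
        by (auto simp: fillings_def)
      have "restrict (color_proj (?F (b, f))) \<Lambda>' = restrict b \<Lambda>'" by (simp add: restrict_eq_iff color_proj_def)
      moreover have "restrict (\<lambda>z. snd (?F (b, f) z)) \<Lambda> = restrict f \<Lambda>"
        using sub by (auto simp: restrict_eq_iff)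
      moreover have "restrict f \<Lambda> = f" using p(3) by (simp add: PiE_restrict)
      ultimately show "?G (?F p) = p" using p by (simp only: restrict_patch)
    qed
    show "\<forall>c\<in>fillings Y \<Lambda> \<Lambda>' y. ?F (?G c) = c"
    proof
      fix c assume c: "c \<in> fillings Y \<Lambda> \<Lambda>' y"
      have "?F (?G c) = restrict c \<Lambda>'" unfolding prod.case
      proof (rule restrict_ext)
        fix z assume z: "z \<in> \<Lambda>'"
        have "z \<notin> \<Lambda> \<Longrightarrow> y z = c z" using c z by (simp add: fillings_def restrict_eq_iff)
        then show "(restrict (color_proj c) \<Lambda>' z, if z \<in> \<Lambda> then restrict (\<lambda>z. snd (c z)) \<Lambda> z else snd (y z)) = c z"
          using z by (simp add: color_proj_def)
      qed
      moreover have "c \<in> patches Y \<Lambda>'" using c by (simp add: fillings_def)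
      ultimately show "?F (?G c) = c" by (simp only: restrict_patch)
    qed
    show "?F ` ?P \<subseteq> fillings Y \<Lambda> \<Lambda>' y"
    proof (rule image_subsetI)
      fix p assume "p \<in> ?P"
      then obtain b f where p: "p = (b, f)" "b \<in> fillings X \<Lambda> \<Lambda>' (color_proj y)" "f \<in> (\<Pi>\<^sub>E z\<in>\<Lambda>. {..<\<kappa> (b z)})"
        by auto
      obtain x where x: "x \<in> X" "b = restrict x \<Lambda>'" using p(2) by (auto simp: fillings_def patches_def)
      have eq: "x z = fst (y z)" if "z \<in> \<Lambda>'" "z \<notin> \<Lambda>" for z
      proof -
        have "b z = color_proj y z" using p(2) that by (simp add: fillings_def restrict_eq_iff)
        then show ?thesis using that x(2) by (simp add: color_proj_def)
      qed
      define u where "u = (\<lambda>z. if z \<in> \<Lambda> then f z else if z \<in> \<Lambda>' then snd (y z) else 0)"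
      have "u z < \<kappa> (x z)" for z
      proof (cases "z \<in> \<Lambda>")
        case True
        then have "f z \<in> {..<\<kappa> (b z)}" by (rule PiE_mem[OF p(3)])
        then show ?thesis using True sub x(2) by (auto simp: u_def)
      next
        case False
        then show ?thesis using eq[of z] y \<kappa>_pos X_letter[OF x(1)] by (simp add: u_def Y_iff)
      qed
      then have "(\<lambda>z. (x z, u z)) \<in> Y" by (rule Y_I[OF x(1)])
      moreover have "?F p = restrict (\<lambda>z. (x z, u z)) \<Lambda>'"
        by (simp add: p(1) restrict_eq_iff u_def x(2))
      moreover have "restrict (\<lambda>z. (x z, u z)) (\<Lambda>' - \<Lambda>) = restrict y (\<Lambda>' - \<Lambda>)"
        using eq by (simp add: restrict_eq_iff u_def prod_eq_iff)
      ultimately show "?F p \<in> fillings Y \<Lambda> \<Lambda>' y"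
        by (auto simp: fillings_def patches_def Int_absorb1)
    qed
    show "?G ` fillings Y \<Lambda> \<Lambda>' y \<subseteq> ?P"
    proof (rule image_subsetI)
      fix c assume c: "c \<in> fillings Y \<Lambda> \<Lambda>' y"
      then obtain y' where y': "y' \<in> Y" "c = restrict y' \<Lambda>'" by (auto simp: fillings_def patches_def)
      have "restrict (color_proj c) \<Lambda>' \<in> patches X \<Lambda>'"
        using color_Y[OF y'(1)] by (simp add: y'(2) color_restrict patches_def)
      moreover have "color_proj c z = color_proj y z" if "z \<in> \<Lambda>' - \<Lambda>" for z
        using c that by (simp add: fillings_def restrict_eq_iff color_proj_def)
      ultimately have "restrict (color_proj c) \<Lambda>' \<in> fillings X \<Lambda> \<Lambda>' (color_proj y)"
        by (simp add: fillings_def restrict_eq_iff del: restrict_restrict)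
      moreover have "snd (c z) < \<kappa> (restrict (color_proj c) \<Lambda>' z)" if "z \<in> \<Lambda>" for z
        using that sub y' by (auto simp: Y_iff color_proj_def)
      ultimately show "?G c \<in> ?P" by auto
    qed
  qed
  then have "card (fillings Y \<Lambda> \<Lambda>' y) = card ?P" by (rule bij_betw_same_card[symmetric])
  also have "\<dots> = (\<Sum>b\<in>fillings X \<Lambda> \<Lambda>' (color_proj y). \<Prod>z\<in>\<Lambda>. \<kappa> (b z))"
    using fin finite_subset[OF sub fin] by (subst card_SigmaI) (auto simp: card_PiE intro: finite_PiE)
  finally show ?thesis by simp
qed

section \<open>Uniform lifts\<close>
text \<open>
  The mass of a color cylinder is spread evenly over the \<open>\<Prod>z\<in>\<Lambda>. \<kappa> (x z)\<close> cylinders above it.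
\<close>
definition uniform_lift :: "('a \<times> nat) config measure \<Rightarrow> 'a config measure \<Rightarrow> bool" where
  "uniform_lift \<mu> \<nu> \<longleftrightarrow> (\<forall>\<Lambda>. finite \<Lambda> \<longrightarrow> (\<forall>y\<in>Y.
     Y.pr \<mu> \<Lambda> y * (\<Prod>z\<in>\<Lambda>. real (\<kappa> (fst (y z)))) = pr \<nu> \<Lambda> (color_proj y)))"

lemma uniform_lift_pushforward:
  assumes \<mu>: "Y.config_prob \<mu>" and \<nu>: "config_prob \<nu>" and lift: "uniform_lift \<mu> \<nu>"
  shows "push \<mu> = \<nu>"
proof (rule config_prob_eqI[OF color_pushforward_prob[OF \<mu>] \<nu>])
  fix n a assume "a \<in> patches X (box n)"
  then obtain x where x: "x \<in> X" "a = restrict x (box n)" by (auto simp: patches_def)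
  let ?I = "{b \<in> patches Y (box n). restrict (color_proj b) (box n) = restrict x (box n)}"
  let ?k = "\<Prod>z\<in>box n. real (\<kappa> (x z))"
  have "Y.pr \<mu> (box n) b = pr \<nu> (box n) x / ?k" if "b \<in> ?I" for b
  proof -
    obtain y where y: "y \<in> Y" "b = restrict y (box n)" using \<open>b \<in> ?I\<close> by (auto simp: patches_def)
    have eq: "fst (y z) = x z" if "z \<in> box n" for z
      using \<open>b \<in> ?I\<close> that y(2) by (auto simp: restrict_eq_iff color_proj_def)
    then have "pr \<nu> (box n) (color_proj y) = pr \<nu> (box n) x"
      by (intro block_prob_cong) (simp add: color_proj_def)
    moreover have "(\<Prod>z\<in>box n. real (\<kappa> (fst (y z)))) = ?k" using eq by simp
    ultimately have "Y.pr \<mu> (box n) y * ?k = pr \<nu> (box n) x"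
      using lift y(1) unfolding uniform_lift_def by (metis finite_box)
    then show ?thesis using \<kappa>_prod_pos[OF x(1), of "box n"]
      by (simp add: y(2) block_prob_restrict eq_divide_eq del: prod_zero_iff)
  qed
  then have "pr (push \<mu>) (box n) x = real (card ?I) * (pr \<nu> (box n) x / ?k)"
    by (simp add: color_pushforward_block_prob[OF \<mu>])
  also have "real (card ?I) = ?k" by (simp add: card_color_class[OF x(1)])
  finally show "pr (push \<mu>) (box n) a = pr \<nu> (box n) a"
    using \<kappa>_prod_pos[OF x(1), of "box n"] by (simp add: x(2) block_prob_restrict del: prod_zero_iff)
qed

lemma uniform_lift_unique:
  assumes "Y.config_prob \<mu>" "Y.config_prob \<mu>'" and lift: "uniform_lift \<mu> \<nu>" "uniform_lift \<mu>' \<nu>"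
  shows "\<mu> = \<mu>'"
proof (rule Y.config_prob_eqI[OF assms(1,2)])
  fix n a assume "a \<in> patches Y (box n)"
  then obtain y where y: "y \<in> Y" "a = restrict y (box n)" by (auto simp: patches_def)
  let ?k = "\<Prod>z\<in>box n. real (\<kappa> (fst (y z)))"
  have "Y.pr \<mu> (box n) y * ?k = Y.pr \<mu>' (box n) y * ?k"
    using lift y(1) unfolding uniform_lift_def by simp
  moreover have "0 < ?k" using \<kappa>_prod_pos[OF color_Y[OF y(1)], of "box n"] by (simp add: color_proj_def)
  ultimately show "Y.pr \<mu> (box n) a = Y.pr \<mu>' (box n) a"
    by (simp add: y(2) block_prob_restrict del: prod_zero_iff)
qed

lemma uniform_lift_invariant:
  assumes \<mu>: "Y.config_prob \<mu>" and \<nu>: "\<nu> \<in> invariant_measures A X" and lift: "uniform_lift \<mu> \<nu>"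
  shows "\<mu> \<in> invariant_measures A' Y"
proof (rule Y.invariant_measuresI[OF \<mu>])
  fix t n y assume y: "y \<in> Y"
  let ?k = "\<Prod>z\<in>box n. real (\<kappa> (fst (shift t y z)))"
  have "(\<Prod>z\<in>(+) t ` box n. real (\<kappa> (fst (y z)))) = ?k"
    by (subst prod.reindex) (simp_all add: shift_def)
  then have "Y.pr \<mu> ((+) t ` box n) y * ?k = pr \<nu> ((+) t ` box n) (color_proj y)"
    using lift y unfolding uniform_lift_def by (metis finite_box finite_imageI)
  also have "\<dots> = pr \<nu> (box n) (color_proj (shift t y))"
    by (simp add: block_prob_shift[OF \<nu>] color_shift)
  also have "\<dots> = Y.pr \<mu> (box n) (shift t y) * ?k"
    using lift Y.shift_X[OF y] unfolding uniform_lift_def by (metis finite_box)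
  finally show "Y.pr \<mu> ((+) t ` box n) y = Y.pr \<mu> (box n) (shift t y)"
    using \<kappa>_prod_pos[OF color_Y[OF Y.shift_X[OF y, of t]], of "box n"]
    by (simp add: color_proj_def del: prod_zero_iff)
qed

text \<open>
  The equation upstairs, multiplied by the number of lifts of the colors on \<open>\<Lambda>'\<close>, is the equation downstairs:
  the probabilities become those of the colors, a factor for the lifts on \<open>\<Lambda>\<close> remains on the right, and
  \<open>card_fillings_split\<close> turns the number of fillings into the partition sum.
\<close>
lemma uniform_lift_gibbs_iff:
  assumes lift: "uniform_lift \<mu> \<nu>"
  shows "Y.gibbs (\<lambda>_. 1) \<mu> \<longleftrightarrow> gibbs (\<lambda>a. real (\<kappa> a)) \<nu>"
proof -
  have key: "(Y.pr \<mu> \<Lambda>' y * real (card (fillings Y \<Lambda> \<Lambda>' y)) = Y.pr \<mu> (\<Lambda>' - \<Lambda>) y)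
      \<longleftrightarrow> (pr \<nu> \<Lambda>' (color_proj y) * (\<Sum>b\<in>fillings X \<Lambda> \<Lambda>' (color_proj y). \<Prod>z\<in>\<Lambda>. real (\<kappa> (b z)))
        = pr \<nu> (\<Lambda>' - \<Lambda>) (color_proj y) * (\<Prod>z\<in>\<Lambda>. real (\<kappa> (color_proj y z))))"
    if y: "y \<in> Y" and fin: "finite \<Lambda>'" and sub: "\<Lambda> \<subseteq> \<Lambda>'" for \<Lambda> \<Lambda>' y
  proof -
    let ?k = "\<lambda>\<Lambda>. \<Prod>z\<in>\<Lambda>. real (\<kappa> (fst (y z)))"
    have k: "?k \<Lambda>' = ?k (\<Lambda>' - \<Lambda>) * ?k \<Lambda>" using prod.subset_diff[OF sub fin] .
    have pos: "0 < ?k \<Delta>" for \<Delta> using \<kappa>_prod_pos[OF color_Y[OF y], of \<Delta>] by (simp add: color_proj_def)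
    have l: "Y.pr \<mu> \<Lambda>' y * ?k \<Lambda>' = pr \<nu> \<Lambda>' (color_proj y)"
      "Y.pr \<mu> (\<Lambda>' - \<Lambda>) y * ?k (\<Lambda>' - \<Lambda>) = pr \<nu> (\<Lambda>' - \<Lambda>) (color_proj y)"
      using lift y fin unfolding uniform_lift_def by auto
    have "(Y.pr \<mu> \<Lambda>' y * real (card (fillings Y \<Lambda> \<Lambda>' y)) = Y.pr \<mu> (\<Lambda>' - \<Lambda>) y)
      \<longleftrightarrow> (Y.pr \<mu> \<Lambda>' y * ?k \<Lambda>' * real (card (fillings Y \<Lambda> \<Lambda>' y))
        = Y.pr \<mu> (\<Lambda>' - \<Lambda>) y * ?k (\<Lambda>' - \<Lambda>) * ?k \<Lambda>)"
      using pos[of "\<Lambda>' - \<Lambda>"] pos[of \<Lambda>] by (simp add: k del: prod_zero_iff)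
    then show ?thesis unfolding l card_fillings_split[OF y fin sub] by (simp add: color_proj_def)
  qed
  have rY: "Y.pr \<mu> \<Lambda>' (restrict y \<Lambda>') = Y.pr \<mu> \<Lambda>' y"
    "Y.pr \<mu> (\<Lambda>' - \<Lambda>) (restrict y \<Lambda>') = Y.pr \<mu> (\<Lambda>' - \<Lambda>) y"
    "fillings Y \<Lambda> \<Lambda>' (restrict y \<Lambda>') = fillings Y \<Lambda> \<Lambda>' y" for y \<Lambda> \<Lambda>'
    by (simp_all add: block_prob_restrict, rule Y.fillings_cong) (simp add: restrict_eq_iff del: restrict_restrict)
  have rX: "pr \<nu> \<Lambda>' (restrict x \<Lambda>') = pr \<nu> \<Lambda>' x"
    "pr \<nu> (\<Lambda>' - \<Lambda>) (restrict x \<Lambda>') = pr \<nu> (\<Lambda>' - \<Lambda>) x"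
    "fillings X \<Lambda> \<Lambda>' (restrict x \<Lambda>') = fillings X \<Lambda> \<Lambda>' x" for x \<Lambda> \<Lambda>'
    by (simp_all add: block_prob_restrict, rule fillings_cong) (simp add: restrict_eq_iff del: restrict_restrict)
  have rp: "(\<Prod>z\<in>\<Lambda>. real (\<kappa> (restrict x \<Lambda>' z))) = (\<Prod>z\<in>\<Lambda>. real (\<kappa> (x z)))" if "\<Lambda> \<subseteq> \<Lambda>'" for x and \<Lambda> \<Lambda>' :: "site set"
    using that by (intro prod.cong) auto
  show ?thesis
  proof
    assume g: "Y.gibbs (\<lambda>_. 1) \<mu>"
    show "gibbs (\<lambda>a. real (\<kappa> a)) \<nu>" unfolding gibbs_def
    proof (intro allI impI ballI)
      fix \<Lambda> \<Lambda>' a assume fin: "finite \<Lambda>'" and sub: "\<Lambda> \<union> outer_boundary 2 \<Lambda> \<subseteq> \<Lambda>'" and "a \<in> patches X \<Lambda>'"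
      then obtain x where "x \<in> X" and a: "a = restrict x \<Lambda>'" by (auto simp: patches_def)
      then obtain y where y: "y \<in> Y" "color_proj y = x" using X_lift by blast
      have subL: "\<Lambda> \<subseteq> \<Lambda>'" using sub by simp
      have "restrict y \<Lambda>' \<in> patches Y \<Lambda>'" using y by (simp add: patches_def)
      then have "Y.pr \<mu> \<Lambda>' y * real (card (fillings Y \<Lambda> \<Lambda>' y)) = Y.pr \<mu> (\<Lambda>' - \<Lambda>) y"
        using g fin sub unfolding Y.gibbs_uniform_iff by (metis rY)
      then show "pr \<nu> \<Lambda>' a * (\<Sum>b\<in>fillings X \<Lambda> \<Lambda>' a. \<Prod>z\<in>\<Lambda>. real (\<kappa> (b z)))
          = pr \<nu> (\<Lambda>' - \<Lambda>) a * (\<Prod>z\<in>\<Lambda>. real (\<kappa> (a z)))"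
        using key[OF y(1) fin subL] unfolding a rX rp[OF subL] y(2) by simp
    qed
  next
    assume g: "gibbs (\<lambda>a. real (\<kappa> a)) \<nu>"
    show "Y.gibbs (\<lambda>_. 1) \<mu>" unfolding Y.gibbs_uniform_iff
    proof (intro allI impI ballI)
      fix \<Lambda> \<Lambda>' a assume fin: "finite \<Lambda>'" and sub: "\<Lambda> \<union> outer_boundary 2 \<Lambda> \<subseteq> \<Lambda>'" and "a \<in> patches Y \<Lambda>'"
      then obtain y where y: "y \<in> Y" and a: "a = restrict y \<Lambda>'" by (auto simp: patches_def)
      have subL: "\<Lambda> \<subseteq> \<Lambda>'" using sub by simp
      have "restrict (color_proj y) \<Lambda>' \<in> patches X \<Lambda>'" using color_Y[OF y] by (simp add: patches_def)
      from g[unfolded gibbs_def, rule_format, OF fin sub this]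
      have "pr \<nu> \<Lambda>' (color_proj y) * (\<Sum>b\<in>fillings X \<Lambda> \<Lambda>' (color_proj y). \<Prod>z\<in>\<Lambda>. real (\<kappa> (b z)))
        = pr \<nu> (\<Lambda>' - \<Lambda>) (color_proj y) * (\<Prod>z\<in>\<Lambda>. real (\<kappa> (color_proj y z)))"
        unfolding rX rp[OF subL] .
      then show "Y.pr \<mu> \<Lambda>' a * real (card (fillings Y \<Lambda> \<Lambda>' a)) = Y.pr \<mu> (\<Lambda>' - \<Lambda>) a"
        using key[OF y fin subL] unfolding a rY by simp
    qed
  qed
qed

text \<open>
  Relabelling inside \<open>\<Lambda>\<close> without touching the colors keeps patches on \<open>\<Lambda>\<close> and its boundary admissible and
  preserves their boundary condition. The Gibbs property assigns the same probability to both patches, and it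
  remains to sum over the boundary conditions.
\<close>
lemma gibbs_block_prob_color:
  assumes \<mu>: "Y.config_prob \<mu>" and gibbs: "Y.gibbs (\<lambda>_. 1) \<mu>" and fin: "finite \<Lambda>"
    and y: "y \<in> Y" and y': "y' \<in> Y" and col: "\<And>z. z \<in> \<Lambda> \<Longrightarrow> fst (y z) = fst (y' z)"
  shows "Y.pr \<mu> \<Lambda> y = Y.pr \<mu> \<Lambda> y'"
proof -
  let ?L = "\<Lambda> \<union> outer_boundary 2 \<Lambda>"
  have finL: "finite ?L" using fin by (simp add: finite_outer_boundary)
  \<comment> \<open>Replaces \<open>b\<close> on \<open>\<Lambda>\<close> by \<open>v\<close>, which will have the same colors there.\<close>
  define swap where "swap = (\<lambda>v b. restrict (\<lambda>z. if z \<in> \<Lambda> then v z else b z) ?L :: ('a \<times> nat) config)"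
  let ?I = "\<lambda>v. {b \<in> patches Y ?L. restrict b \<Lambda> = restrict v \<Lambda>}"
  have swap: "swap v b \<in> ?I v" "Y.pr \<mu> ?L (swap v b) = Y.pr \<mu> ?L b"
    if v: "v \<in> Y" and w: "w \<in> Y" "\<And>z. z \<in> \<Lambda> \<Longrightarrow> fst (v z) = fst (w z)" and b: "b \<in> ?I w" for v w b
  proof -
    obtain x where x: "x \<in> Y" "b = restrict x ?L" using b by (auto simp: patches_def)
    have xw: "x z = w z" if "z \<in> \<Lambda>" for z
      using b that by (auto simp: x(2) restrict_eq_iff simp del: restrict_restrict)
    let ?s = "\<lambda>z. if z \<in> \<Lambda> then v z else x z"
    have "color_proj ?s = color_proj x" using xw w(2) by (auto simp: color_proj_def fun_eq_iff)
    then have "?s \<in> Y" using x(1) v by (auto simp: Y_iff)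
    moreover have s: "swap v b = restrict ?s ?L" by (auto simp: swap_def x(2) restrict_eq_iff)
    ultimately have p: "swap v b \<in> patches Y ?L" by (simp add: patches_def)
    then show "swap v b \<in> ?I v" by (simp add: s restrict_eq_iff del: restrict_restrict)
    have bp: "b \<in> patches Y ?L" using b by simp
    have off: "restrict (swap v b) (?L - \<Lambda>) = restrict b (?L - \<Lambda>)"
      by (auto simp: swap_def restrict_eq_iff simp del: restrict_restrict)
    have "Y.pr \<mu> ?L (swap v b) * real (card (fillings Y \<Lambda> ?L (swap v b))) = Y.pr \<mu> (?L - \<Lambda>) (swap v b)"
      "Y.pr \<mu> ?L b * real (card (fillings Y \<Lambda> ?L b)) = Y.pr \<mu> (?L - \<Lambda>) b"
      using gibbs finL p bp unfolding Y.gibbs_uniform_iff by blast+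
    moreover have "Y.pr \<mu> (?L - \<Lambda>) (swap v b) = Y.pr \<mu> (?L - \<Lambda>) b"
      using off by (simp only: block_prob_def)
    ultimately have "Y.pr \<mu> ?L (swap v b) * real (card (fillings Y \<Lambda> ?L b))
        = Y.pr \<mu> ?L b * real (card (fillings Y \<Lambda> ?L b))"
      using Y.fillings_cong[OF off] by simp
    moreover have "real (card (fillings Y \<Lambda> ?L b)) \<noteq> 0" using Y.card_fillings_pos[OF finL bp, of \<Lambda>] by simp
    ultimately show "Y.pr \<mu> ?L (swap v b) = Y.pr \<mu> ?L b"
      by (metis mult_right_cancel)
  qed
  have inv: "swap w (swap v b) = b" if "b \<in> ?I w" for v w b
  proof -
    have bp: "b \<in> patches Y ?L" and bw: "\<And>z. z \<in> \<Lambda> \<Longrightarrow> b z = w z"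
      using that by (auto simp: restrict_eq_iff)
    have "swap w (swap v b) = restrict b ?L" using bw by (auto simp: swap_def restrict_eq_iff)
    then show ?thesis using restrict_patch[OF bp] by simp
  qed
  have "Y.pr \<mu> \<Lambda> y = (\<Sum>b\<in>?I y. Y.pr \<mu> ?L b)"
    by (rule Y.block_prob_split[OF \<mu> finL]) simp
  also have "\<dots> = (\<Sum>b\<in>?I y'. Y.pr \<mu> ?L b)"
  proof (rule sum.reindex_bij_witness[of _ "swap y" "swap y'"])
    fix b assume b: "b \<in> ?I y"
    show "swap y (swap y' b) = b" by (rule inv[OF b])
    show "swap y' b \<in> ?I y'" "Y.pr \<mu> ?L (swap y' b) = Y.pr \<mu> ?L b"
      by (rule swap[OF y' y _ b]; simp add: col)+
  next
    fix b assume b: "b \<in> ?I y'"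
    show "swap y' (swap y b) = b" by (rule inv[OF b])
    show "swap y b \<in> ?I y" by (rule swap(1)[OF y y' col b])
  qed
  also have "\<dots> = Y.pr \<mu> \<Lambda> y'"
    by (rule Y.block_prob_split[OF \<mu> finL, symmetric]) simp
  finally show ?thesis .
qed

lemma gibbs_uniform_lift:
  assumes \<mu>: "Y.config_prob \<mu>" and gibbs: "Y.gibbs (\<lambda>_. 1) \<mu>"
  shows "uniform_lift \<mu> (push \<mu>)"
  unfolding uniform_lift_def
proof (intro allI impI ballI)
  fix \<Lambda> y assume fin: "finite (\<Lambda> :: site set)" and y: "y \<in> Y"
  let ?I = "{b \<in> patches Y \<Lambda>. restrict (color_proj b) \<Lambda> = restrict (color_proj y) \<Lambda>}"
  have "Y.pr \<mu> \<Lambda> b = Y.pr \<mu> \<Lambda> y" if "b \<in> ?I" for b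
  proof -
    obtain y' where y': "y' \<in> Y" "b = restrict y' \<Lambda>" using \<open>b \<in> ?I\<close> by (auto simp: patches_def)
    have "fst (y' z) = fst (y z)" if "z \<in> \<Lambda>" for z
      using \<open>b \<in> ?I\<close> that y'(2) by (auto simp: restrict_eq_iff color_proj_def)
    then have "Y.pr \<mu> \<Lambda> y' = Y.pr \<mu> \<Lambda> y"
      by (intro gibbs_block_prob_color[OF \<mu> gibbs fin y'(1) y])
    then show ?thesis by (simp add: y'(2) block_prob_restrict)
  qed
  then have "pr (push \<mu>) \<Lambda> (color_proj y) = real (card ?I) * Y.pr \<mu> \<Lambda> y"
    by (simp add: color_pushforward_block_prob[OF \<mu> fin])
  also have "real (card ?I) = (\<Prod>z\<in>\<Lambda>. real (\<kappa> (fst (y z))))"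
    by (simp add: card_color_class[OF color_Y[OF y] fin]) (simp add: color_proj_def)
  finally show "Y.pr \<mu> \<Lambda> y * (\<Prod>z\<in>\<Lambda>. real (\<kappa> (fst (y z))))
      = pr (push \<mu>) \<Lambda> (color_proj y)" by simp
qed

end

context sft
begin

section \<open>Continuous functions on a subshift\<close>
text \<open>
  Each configuration has a cylinder on which \<open>f\<close> stays within \<open>e / 2\<close> of its value. By compactness finitely many
  of these cylinders cover the subshift, and a box that contains all of their windows will do.
\<close>
lemma continuous_map_uniformly_local:
  assumes f: "continuous_map (config_topology A X) euclideanreal f" and e: "0 < e"
  obtains n where "\<And>x y. x \<in> X \<Longrightarrow> y \<in> X \<Longrightarrow> restrict x (box n) = restrict y (box n) \<Longrightarrow> \<bar>f x - f y\<bar> < e"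
proof -
  have "\<exists>n. cylinder X (box n) (restrict x (box n)) \<subseteq> {y \<in> X. f y \<in> ball (f x) (e / 2)}" if "x \<in> X" for x
  proof -
    have "openin (config_topology A X) {y \<in> topspace (config_topology A X). f y \<in> ball (f x) (e / 2)}"
      by (rule openin_continuous_map_preimage[OF f]) simp
    then have "openin (config_topology A X) {y \<in> X. f y \<in> ball (f x) (e / 2)}" by simp
    moreover have "x \<in> {y \<in> X. f y \<in> ball (f x) (e / 2)}" using that e by simp
    ultimately obtain n where "cylinder X (box n) (restrict x (box n)) \<subseteq> {y \<in> X. f y \<in> ball (f x) (e / 2)}"
      by (rule open_contains_cylinder)
    then show ?thesis ..
  qed
  then have "\<forall>x\<in>X. \<exists>n. cylinder X (box n) (restrict x (box n)) \<subseteq> {y \<in> X. f y \<in> ball (f x) (e / 2)}" by (rule ballI)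
  from bchoice[OF this] obtain k where k: "\<forall>x\<in>X.
      cylinder X (box (k x)) (restrict x (box (k x))) \<subseteq> {y \<in> X. f y \<in> ball (f x) (e / 2)}" ..
  let ?C = "\<lambda>x. cylinder X (box (k x)) (restrict x (box (k x)))"
  have "compactin (config_topology A X) X" using compact_config by (simp add: compact_space_def)
  moreover have "openin (config_topology A X) U" if "U \<in> ?C ` X" for U
    using that openin_cylinder[OF finite_box] by blast
  moreover have "X \<subseteq> \<Union> (?C ` X)" by (auto simp: cylinder_def)
  ultimately have "\<exists>\<F>. finite \<F> \<and> \<F> \<subseteq> ?C ` X \<and> X \<subseteq> \<Union> \<F>" by (rule compactinD)
  then obtain \<F> where \<F>: "finite \<F>" "\<F> \<subseteq> ?C ` X" "X \<subseteq> \<Union> \<F>" by (elim exE conjE)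
  from finite_subset_image[OF \<F>(1,2)] obtain F where F: "F \<subseteq> X" "finite F" "\<F> = ?C ` F"
    by (elim exE conjE)
  define n where "n = Max (insert 0 (k ` F))"
  show thesis
  proof (rule that[of n])
    fix x y assume x: "x \<in> X" and y: "y \<in> X" and eq: "restrict x (box n) = restrict y (box n)"
    obtain c where c: "c \<in> F" "x \<in> ?C c" using \<F>(3) F(3) x by auto
    have "k c \<le> n" unfolding n_def using F(2) c(1) by (intro Max_ge) auto
    then have "restrict x (box (k c)) = restrict y (box (k c))" using restrict_eq_subset[OF eq] box_mono by blast
    then have "y \<in> ?C c" using c(2) y by (simp add: cylinder_def)
    moreover have "?C c \<subseteq> {y \<in> X. f y \<in> ball (f c) (e / 2)}" using c(1) F(1) by (intro bspec[OF k]) auto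
    ultimately have "f x \<in> ball (f c) (e / 2) \<and> f y \<in> ball (f c) (e / 2)"
      using subsetD[of "?C c" "{y \<in> X. f y \<in> ball (f c) (e / 2)}"] c(2) by simp
    then have "\<bar>f c - f x\<bar> < e / 2" "\<bar>f c - f y\<bar> < e / 2" by (simp_all add: dist_real_def)
    then show "\<bar>f x - f y\<bar> < e" by linarith
  qed
qed

lemma continuous_map_if_uniformly_local:
  assumes f: "\<And>e. 0 < e \<Longrightarrow> \<exists>n. \<forall>x\<in>X. \<forall>y\<in>X. restrict x (box n) = restrict y (box n) \<longrightarrow> \<bar>f x - f y\<bar> < e"
  shows "continuous_map (config_topology A X) euclideanreal f"
  unfolding continuous_map_def
proof (intro conjI allI impI)
  show "f \<in> topspace (config_topology A X) \<rightarrow> topspace euclideanreal" by simp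
  fix U :: "real set" assume "openin euclideanreal U"
  then have U: "open U" by simp
  show "openin (config_topology A X) {x \<in> topspace (config_topology A X). f x \<in> U}"
  proof (subst openin_subopen, intro ballI)
    fix x assume "x \<in> {x \<in> topspace (config_topology A X). f x \<in> U}"
    then have x: "x \<in> X" "f x \<in> U" by auto
    then obtain e where e: "0 < e" "ball (f x) e \<subseteq> U" using U openE by blast
    obtain n where n: "\<And>x y. x \<in> X \<Longrightarrow> y \<in> X \<Longrightarrow> restrict x (box n) = restrict y (box n) \<Longrightarrow> \<bar>f x - f y\<bar> < e"
      using f[OF e(1)] by metis
    have "cylinder X (box n) (restrict x (box n)) \<subseteq> {x \<in> topspace (config_topology A X). f x \<in> U}"
    proof
      fix y assume "y \<in> cylinder X (box n) (restrict x (box n))"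
      then have y: "y \<in> X" "restrict x (box n) = restrict y (box n)" by (auto simp: cylinder_def)
      then have "f y \<in> ball (f x) e" using n[OF x(1) y] by (simp add: dist_real_def)
      then show "y \<in> {x \<in> topspace (config_topology A X). f x \<in> U}" using e(2) y(1) by auto
    qed
    then show "\<exists>T. openin (config_topology A X) T \<and> x \<in> T \<and> T \<subseteq> {x \<in> topspace (config_topology A X). f x \<in> U}"
      using openin_cylinder[OF finite_box, of n x] x(1)
      by (intro exI[of _ "cylinder X (box n) (restrict x (box n))"]) (simp add: cylinder_def)
  qed
qed

lemma continuous_map_measurable:
  assumes f: "continuous_map (config_topology A X) euclideanreal f"
  shows "f \<in> borel_measurable (config_borel A X)"
proof (rule borel_measurableI)
  fix U :: "real set" assume "open U"
  then have "openin (config_topology A X) {x \<in> topspace (config_topology A X). f x \<in> U}"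
    by (intro openin_continuous_map_preimage[OF f]) simp
  then have "{x \<in> X. f x \<in> U} \<in> sets (config_borel A X)" by (intro sets_openin) simp
  moreover have "f -` U \<inter> space (config_borel A X) = {x \<in> X. f x \<in> U}" by auto
  ultimately show "f -` U \<inter> space (config_borel A X) \<in> sets (config_borel A X)" by simp
qed

lemma continuous_map_bounded:
  assumes f: "continuous_map (config_topology A X) euclideanreal f"
  obtains C where "\<And>x. x \<in> X \<Longrightarrow> \<bar>f x\<bar> \<le> C"
proof -
  have "compactin (config_topology A X) X" using compact_config by (simp add: compact_space_def)
  from image_compactin[OF this f] have "bounded (f ` X)" by (simp add: compact_imp_bounded)
  then show thesis using that by (auto simp: bounded_iff)
qed

section \<open>Equilibrium states are Gibbs measures\<close>
text \<open>
  The boundary condition of radius 2 together with the filling \<open>b\<close>, as in the partition sum that defines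
  equilibrium states.
\<close>
definition glue_patch :: "site set \<Rightarrow> 'a config \<Rightarrow> 'a config \<Rightarrow> 'a config" where
  "glue_patch \<Lambda> a b = merge \<Lambda> (outer_boundary 2 \<Lambda>) (b, restrict a (outer_boundary 2 \<Lambda>))"

text \<open>
  The partition sum only involves the boundary of radius 2, whereas fillings refer to all of \<open>\<Lambda>'\<close>; the two
  agree by \<open>bij_betw_fillings\<close>.
\<close>
lemma sum_glue_patches:
  assumes fin: "finite \<Lambda>'" and sub: "\<Lambda> \<union> outer_boundary 2 \<Lambda> \<subseteq> \<Lambda>'" and a: "a \<in> patches X \<Lambda>'"
  shows "(\<Sum>b\<in>{b \<in> \<Lambda> \<rightarrow>\<^sub>E A. cylinder X (\<Lambda> \<union> outer_boundary 2 \<Lambda>) (glue_patch \<Lambda> a b) \<noteq> {}}.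
      exp (- \<beta> * energy \<Phi> \<Lambda> (glue_patch \<Lambda> a b)))
    = (\<Sum>b\<in>fillings X \<Lambda> \<Lambda>' a. \<Prod>z\<in>\<Lambda>. exp (- \<beta> * \<Phi> (b z)))"
proof -
  let ?D = "outer_boundary 2 \<Lambda>"
  have disj: "z \<notin> \<Lambda>" if "z \<in> ?D" for z using that by (simp add: outer_boundary_def)
  have finL: "finite \<Lambda>" using fin sub finite_subset by auto
  have w: "exp (- \<beta> * energy \<Phi> \<Lambda> b) = (\<Prod>z\<in>\<Lambda>. exp (- \<beta> * \<Phi> (b z)))" for b
    using finL by (simp add: energy_def sum_distrib_left exp_sum flip: sum_negf)
  have gl: "glue_patch \<Lambda> a b z = (if z \<in> \<Lambda> then b z else if z \<in> ?D then a z else undefined)" for b z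
    by (auto simp: glue_patch_def merge_def)
  have "(\<Sum>b\<in>{b \<in> \<Lambda> \<rightarrow>\<^sub>E A. cylinder X (\<Lambda> \<union> ?D) (glue_patch \<Lambda> a b) \<noteq> {}}.
        exp (- \<beta> * energy \<Phi> \<Lambda> (glue_patch \<Lambda> a b)))
      = (\<Sum>c\<in>fillings X \<Lambda> (\<Lambda> \<union> ?D) a. \<Prod>z\<in>\<Lambda>. exp (- \<beta> * \<Phi> (c z)))"
    unfolding cylinder_nonempty_iff w
  proof (rule sum.reindex_bij_witness[of _ "\<lambda>c. restrict c \<Lambda>" "glue_patch \<Lambda> a"])
    fix b assume b: "b \<in> {b \<in> \<Lambda> \<rightarrow>\<^sub>E A. glue_patch \<Lambda> a b \<in> patches X (\<Lambda> \<union> ?D)}"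
    have "restrict (glue_patch \<Lambda> a b) \<Lambda> = restrict b \<Lambda>" by (simp add: restrict_eq_iff gl)
    moreover have "b \<in> \<Lambda> \<rightarrow>\<^sub>E A" using b by simp
    ultimately show "restrict (glue_patch \<Lambda> a b) \<Lambda> = b" by (simp only: PiE_restrict)
    show "glue_patch \<Lambda> a b \<in> fillings X \<Lambda> (\<Lambda> \<union> ?D) a"
      using b by (auto simp: fillings_def restrict_eq_iff gl)
  next
    fix c assume c: "c \<in> fillings X \<Lambda> (\<Lambda> \<union> ?D) a"
    then have cp: "c \<in> patches X (\<Lambda> \<union> ?D)" and off: "\<And>z. z \<in> ?D \<Longrightarrow> c z = a z"
      using disj by (auto simp: fillings_def restrict_eq_iff)
    have "glue_patch \<Lambda> a (restrict c \<Lambda>) = restrict c (\<Lambda> \<union> ?D)"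
      using off by (auto simp: fun_eq_iff gl)
    then show g: "glue_patch \<Lambda> a (restrict c \<Lambda>) = c" using restrict_patch[OF cp] by simp
    have "restrict c \<Lambda> \<in> patches X \<Lambda>" using cp by (rule restrict_patches) simp
    then show "restrict c \<Lambda> \<in> {b \<in> \<Lambda> \<rightarrow>\<^sub>E A. glue_patch \<Lambda> a b \<in> patches X (\<Lambda> \<union> ?D)}"
      using patches_subset cp g by auto
  qed (simp_all add: gl)
  also have "\<dots> = (\<Sum>b\<in>fillings X \<Lambda> \<Lambda>' a. \<Prod>z\<in>\<Lambda>. exp (- \<beta> * \<Phi> (restrict b (\<Lambda> \<union> ?D) z)))"
    by (rule sum.reindex_bij_betw[OF bij_betw_fillings[OF _ sub a], symmetric]) simp
  also have "\<dots> = (\<Sum>b\<in>fillings X \<Lambda> \<Lambda>' a. \<Prod>z\<in>\<Lambda>. exp (- \<beta> * \<Phi> (b z)))"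
    by (intro sum.cong prod.cong refl) simp
  finally show ?thesis .
qed

text \<open>
  The partition sum is positive, so the quotients can be cleared. If the boundary condition has probability 0, then so has
  the patch, and the cleared equation reads \<open>0 = 0\<close>.
\<close>
lemma equilibrium_iff_gibbs:
  "equilibrium_states A X \<Phi> \<beta> = {\<mu> \<in> invariant_measures A X. gibbs (\<lambda>a. exp (- \<beta> * \<Phi> a)) \<mu>}"
proof -
  let ?w = "\<lambda>\<Lambda> b. \<Prod>z\<in>\<Lambda>. exp (- \<beta> * \<Phi> (b z))"
  let ?eq = "\<lambda>\<mu> \<Lambda> \<Lambda>' a. measure \<mu> (cylinder X (\<Lambda>' - \<Lambda>) (restrict a (\<Lambda>' - \<Lambda>))) > 0 \<longrightarrow>
      measure \<mu> (cylinder X \<Lambda>' a) / measure \<mu> (cylinder X (\<Lambda>' - \<Lambda>) (restrict a (\<Lambda>' - \<Lambda>)))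
        = exp (- \<beta> * energy \<Phi> \<Lambda> a)
          / (\<Sum>b\<in>{b \<in> \<Lambda> \<rightarrow>\<^sub>E A. cylinder X (\<Lambda> \<union> outer_boundary 2 \<Lambda>) (glue_patch \<Lambda> a b) \<noteq> {}}.
               exp (- \<beta> * energy \<Phi> \<Lambda> (glue_patch \<Lambda> a b)))"
  have local: "(\<forall>a \<in> \<Lambda>' \<rightarrow>\<^sub>E A. admissible X \<Lambda>' a \<longrightarrow> ?eq \<mu> \<Lambda> \<Lambda>' a)
      \<longleftrightarrow> (\<forall>a\<in>patches X \<Lambda>'. pr \<mu> \<Lambda>' a * (\<Sum>b\<in>fillings X \<Lambda> \<Lambda>' a. ?w \<Lambda> b)
            = pr \<mu> (\<Lambda>' - \<Lambda>) a * ?w \<Lambda> a)"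
    if inv: "\<mu> \<in> invariant_measures A X" and fin: "finite \<Lambda>'" and sub: "\<Lambda> \<union> outer_boundary 2 \<Lambda> \<subseteq> \<Lambda>'"
    for \<mu> \<Lambda> \<Lambda>'
  proof -
    have \<mu>: "config_prob \<mu>" by (rule invariant_config_prob[OF inv])
    have finL: "finite \<Lambda>" using fin sub finite_subset by auto
    have w: "exp (- \<beta> * energy \<Phi> \<Lambda> b) = ?w \<Lambda> b" for b
      using finL by (simp add: energy_def sum_distrib_left exp_sum flip: sum_negf)
    have key: "(0 < pr \<mu> (\<Lambda>' - \<Lambda>) a \<longrightarrow> pr \<mu> \<Lambda>' a / pr \<mu> (\<Lambda>' - \<Lambda>) a
          = ?w \<Lambda> a / (\<Sum>b\<in>fillings X \<Lambda> \<Lambda>' a. ?w \<Lambda> b))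
        \<longleftrightarrow> pr \<mu> \<Lambda>' a * (\<Sum>b\<in>fillings X \<Lambda> \<Lambda>' a. ?w \<Lambda> b) = pr \<mu> (\<Lambda>' - \<Lambda>) a * ?w \<Lambda> a"
      if a: "a \<in> patches X \<Lambda>'" for a
    proof -
      have S: "0 < (\<Sum>b\<in>fillings X \<Lambda> \<Lambda>' a. ?w \<Lambda> b)"
        using fin patch_in_fillings[OF a] by (intro sum_pos) (auto intro!: prod_pos)
      have "pr \<mu> \<Lambda>' a \<le> pr \<mu> (\<Lambda>' - \<Lambda>) a" using fin by (intro block_prob_mono[OF \<mu>]) auto
      then have "pr \<mu> (\<Lambda>' - \<Lambda>) a = 0 \<Longrightarrow> pr \<mu> \<Lambda>' a = 0"
        using block_prob_nonneg[of X \<mu> \<Lambda>' a] by simp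
      moreover have "0 < pr \<mu> (\<Lambda>' - \<Lambda>) a \<or> pr \<mu> (\<Lambda>' - \<Lambda>) a = 0"
        using block_prob_nonneg[of X \<mu> "\<Lambda>' - \<Lambda>" a] by linarith
      ultimately show ?thesis using S by (auto simp: frac_eq_eq mult.commute simp del: prod_zero_iff)
    qed
    have adm: "a \<in> \<Lambda>' \<rightarrow>\<^sub>E A \<and> admissible X \<Lambda>' a \<longleftrightarrow> a \<in> patches X \<Lambda>'" for a
      using patches_subset by (auto simp: admissible_def cylinder_nonempty_iff)
    have "(\<forall>a \<in> \<Lambda>' \<rightarrow>\<^sub>E A. admissible X \<Lambda>' a \<longrightarrow> ?eq \<mu> \<Lambda> \<Lambda>' a) \<longleftrightarrow> (\<forall>a\<in>patches X \<Lambda>'. ?eq \<mu> \<Lambda> \<Lambda>' a)"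
      using adm by blast
    also have "\<dots> \<longleftrightarrow> (\<forall>a\<in>patches X \<Lambda>'. 0 < pr \<mu> (\<Lambda>' - \<Lambda>) a \<longrightarrow>
          pr \<mu> \<Lambda>' a / pr \<mu> (\<Lambda>' - \<Lambda>) a
            = ?w \<Lambda> a / (\<Sum>b\<in>fillings X \<Lambda> \<Lambda>' a. ?w \<Lambda> b))"
      by (intro ball_cong refl)
        (simp only: sum_glue_patches[OF fin sub], simp only: w block_prob_def restrict_patch)
    also have "\<dots> \<longleftrightarrow> (\<forall>a\<in>patches X \<Lambda>'. pr \<mu> \<Lambda>' a * (\<Sum>b\<in>fillings X \<Lambda> \<Lambda>' a. ?w \<Lambda> b)
            = pr \<mu> (\<Lambda>' - \<Lambda>) a * ?w \<Lambda> a)"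
      by (intro ball_cong refl) (rule key)
    finally show ?thesis .
  qed
  have finL: "finite \<Lambda>" if "finite \<Lambda>'" "\<Lambda> \<union> outer_boundary 2 \<Lambda> \<subseteq> \<Lambda>'" for \<Lambda> \<Lambda>'
    using that finite_subset by auto
  have guard: "(G \<longrightarrow> F \<longrightarrow> C \<longrightarrow> P) \<longleftrightarrow> (F \<longrightarrow> C \<longrightarrow> Q)"
    if "F \<Longrightarrow> C \<Longrightarrow> P \<longleftrightarrow> Q" "F \<Longrightarrow> C \<Longrightarrow> G" for F C G P Q
    using that by blast
  show ?thesis
    unfolding equilibrium_states_def gibbs_def Let_def glue_patch_def[symmetric]
    by (intro Collect_cong conj_cong refl iff_allI, rule guard, rule local, assumption+, rule finL)
qed

text \<open>
  The equation for a window \<open>\<Lambda>\<close> acquires the factor \<open>c ^ card \<Lambda>\<close> on both sides.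
\<close>
lemma gibbs_scale:
  assumes c: "0 < c" and w: "\<And>a. a \<in> A \<Longrightarrow> w a = c * w' a"
  shows "gibbs w \<mu> \<longleftrightarrow> gibbs w' \<mu>"
proof -
  have p: "(\<Prod>z\<in>\<Lambda>. w (b z)) = c ^ card \<Lambda> * (\<Prod>z\<in>\<Lambda>. w' (b z))"
    if "b \<in> patches X \<Lambda>'" "\<Lambda> \<subseteq> \<Lambda>'" for b \<Lambda> \<Lambda>'
  proof -
    have "b z \<in> A" if "z \<in> \<Lambda>" for z
      using \<open>b \<in> patches X \<Lambda>'\<close> \<open>\<Lambda> \<subseteq> \<Lambda>'\<close> that patches_subset[of \<Lambda>'] by (auto simp: PiE_def Pi_def)
    then have "(\<Prod>z\<in>\<Lambda>. w (b z)) = (\<Prod>z\<in>\<Lambda>. c * w' (b z))" using w by (intro prod.cong) auto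
    then show ?thesis by (simp add: prod.distrib)
  qed
  have "(pr \<mu> \<Lambda>' a * (\<Sum>b\<in>fillings X \<Lambda> \<Lambda>' a. \<Prod>z\<in>\<Lambda>. w (b z))
        = pr \<mu> (\<Lambda>' - \<Lambda>) a * (\<Prod>z\<in>\<Lambda>. w (a z)))
      \<longleftrightarrow> (pr \<mu> \<Lambda>' a * (\<Sum>b\<in>fillings X \<Lambda> \<Lambda>' a. \<Prod>z\<in>\<Lambda>. w' (b z))
        = pr \<mu> (\<Lambda>' - \<Lambda>) a * (\<Prod>z\<in>\<Lambda>. w' (a z)))"
    if a: "a \<in> patches X \<Lambda>'" and sub: "\<Lambda> \<union> outer_boundary 2 \<Lambda> \<subseteq> \<Lambda>'" for a \<Lambda> \<Lambda>'
  proof -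
    have "(\<Sum>b\<in>fillings X \<Lambda> \<Lambda>' a. \<Prod>z\<in>\<Lambda>. w (b z)) = c ^ card \<Lambda> * (\<Sum>b\<in>fillings X \<Lambda> \<Lambda>' a. \<Prod>z\<in>\<Lambda>. w' (b z))"
      unfolding sum_distrib_left using sub by (intro sum.cong refl p[of _ \<Lambda>']) (auto simp: fillings_def)
    moreover have "(\<Prod>z\<in>\<Lambda>. w (a z)) = c ^ card \<Lambda> * (\<Prod>z\<in>\<Lambda>. w' (a z))" using sub by (intro p[OF a]) auto
    moreover note c
    ultimately show ?thesis by (simp add: mult.left_commute[of _ "c ^ card \<Lambda>"] del: prod_zero_iff)
  qed
  then show ?thesis unfolding gibbs_def by (meson)
qed

end

section \<open>Continuity in the weak topologies\<close>
lemma topspace_weak_topology: "topspace (weak_topology A X) = invariant_measures A X"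
proof -
  let ?S = "{{\<mu> \<in> invariant_measures A X. integral\<^sup>L \<mu> f \<in> U} | f U.
      continuous_map (config_topology A X) euclideanreal f \<and> open U}"
  have "{\<mu> \<in> invariant_measures A X. integral\<^sup>L \<mu> (\<lambda>_. 0) \<in> (UNIV :: real set)} \<in> ?S"
    by (intro CollectI exI[of _ "\<lambda>_. 0"] exI[of _ UNIV]) simp
  then have "\<Union> ?S = invariant_measures A X" by auto
  then show ?thesis unfolding weak_topology_def topology_generated_by_topspace .
qed

text \<open>
  A map between sets of measures that is dual to a map between continuous test functions pulls subbasic open
  sets back to subbasic open sets.
\<close>
lemma continuous_map_weak_topology:
  assumes E: "E \<subseteq> invariant_measures A X" and T: "\<And>\<mu>. \<mu> \<in> E \<Longrightarrow> T \<mu> \<in> invariant_measures A' X'"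
    and dual: "\<And>f. continuous_map (config_topology A' X') euclideanreal f \<Longrightarrow>
      \<exists>g. continuous_map (config_topology A X) euclideanreal g \<and> (\<forall>\<mu>\<in>E. integral\<^sup>L (T \<mu>) f = integral\<^sup>L \<mu> g)"
  shows "continuous_map (subtopology (weak_topology A X) E) (weak_topology A' X') T"
proof -
  have top: "topspace (subtopology (weak_topology A X) E) = E"
    using E by (auto simp: topspace_weak_topology)
  show ?thesis unfolding weak_topology_def[of A' X']
  proof (rule continuous_on_generated_topo)
    fix V assume "V \<in> {{\<mu> \<in> invariant_measures A' X'. integral\<^sup>L \<mu> f \<in> U} | f U.
      continuous_map (config_topology A' X') euclideanreal f \<and> open U}"
    then obtain f U where V: "V = {\<mu> \<in> invariant_measures A' X'. integral\<^sup>L \<mu> f \<in> U}"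
      and f: "continuous_map (config_topology A' X') euclideanreal f" and U: "open U" by auto
    obtain g where g: "continuous_map (config_topology A X) euclideanreal g"
      "\<And>\<mu>. \<mu> \<in> E \<Longrightarrow> integral\<^sup>L (T \<mu>) f = integral\<^sup>L \<mu> g" using dual[OF f] by blast
    have "openin (weak_topology A X) {\<mu> \<in> invariant_measures A X. integral\<^sup>L \<mu> g \<in> U}"
      unfolding weak_topology_def using g(1) U by (intro topology_generated_by_Basis) blast
    moreover have "T -` V \<inter> E = {\<mu> \<in> invariant_measures A X. integral\<^sup>L \<mu> g \<in> U} \<inter> E"
      using E T g(2) by (auto simp: V)
    ultimately show "openin (subtopology (weak_topology A X) E) (T -` V \<inter> topspace (subtopology (weak_topology A X) E))"
      unfolding top openin_subtopology by blast
  next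
    show "T ` topspace (subtopology (weak_topology A X) E)
        \<subseteq> \<Union> {{\<mu> \<in> invariant_measures A' X'. integral\<^sup>L \<mu> f \<in> U} | f U.
          continuous_map (config_topology A' X') euclideanreal f \<and> open U}"
      using T topspace_weak_topology[of A' X'] top
      unfolding weak_topology_def[of A' X'] topology_generated_by_topspace by auto
  qed
qed

section \<open>Construction of the uniform lift\<close>
lemma card_residue_class:
  assumes "k dvd m" "i < (k::nat)"
  shows "card {v \<in> {..<m}. v mod k = i} = m div k"
proof -
  obtain q where q: "m = k * q" using assms(1) by (rule dvdE)
  have "{v \<in> {..<m}. v mod k = i} = (\<lambda>j. i + k * j) ` {..<q}"
  proof (intro equalityI subsetI)
    fix v assume "v \<in> {v \<in> {..<m}. v mod k = i}"
    then have v: "v < k * q" "v mod k = i" by (auto simp: q)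
    then have "v div k < q" by (simp add: less_mult_imp_div_less mult.commute)
    moreover have "v = i + k * (v div k)" using v(2) mod_mult_div_eq[of v k] by simp
    ultimately show "v \<in> (\<lambda>j. i + k * j) ` {..<q}" by blast
  next
    fix v assume "v \<in> (\<lambda>j. i + k * j) ` {..<q}"
    then obtain j where j: "j < q" "v = i + k * j" by auto
    have "i + k * j < k * Suc j" using assms(2) by simp
    also have "\<dots> \<le> k * q" using j(1) by (intro mult_le_mono2) simp
    finally show "v \<in> {v \<in> {..<m}. v mod k = i}" using j(2) assms(2) by (simp add: q)
  qed
  moreover have "inj_on (\<lambda>j. i + k * j) {..<q}" using assms(2) by (auto simp: inj_on_def)
  ultimately show ?thesis using assms(2) by (simp add: card_image q)
qed

context split_sft
begin

definition noise :: "(site \<Rightarrow> nat) measure" where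
  "noise = Pi\<^sub>M UNIV (\<lambda>_. uniform_count_measure {..<M})"

text \<open>
  The residue of a uniform label modulo \<open>\<kappa> a\<close> is again uniform, because \<open>\<kappa> a\<close> divides \<open>M\<close>. In this way
  one label distribution serves all letters, and the labels are independent of the configuration.
\<close>
definition split_by :: "'a config \<times> (site \<Rightarrow> nat) \<Rightarrow> ('a \<times> nat) config" where
  "split_by p = (\<lambda>z. (fst p z, snd p z mod \<kappa> (fst p z)))"

definition lift_measure :: "'a config measure \<Rightarrow> ('a \<times> nat) config measure" where
  "lift_measure \<nu> = distr (\<nu> \<Otimes>\<^sub>M noise) (config_borel A' Y) split_by"

lemma product_prob_space_noise: "product_prob_space (\<lambda>_::site. uniform_count_measure {..<M})"
  by (rule product_prob_spaceI, rule prob_space_uniform_count_measure) (use M_pos in auto)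

lemma prob_space_noise: "prob_space noise"
  unfolding noise_def
  by (rule prob_space_PiM, rule prob_space_uniform_count_measure) (use M_pos in auto)

lemma
  assumes fin: "finite \<Lambda>" and x: "x \<in> X" and r: "\<And>z. z \<in> \<Lambda> \<Longrightarrow> r z < \<kappa> (x z)"
  shows sets_noise_residues: "{u \<in> space noise. \<forall>z\<in>\<Lambda>. u z mod \<kappa> (x z) = r z} \<in> sets noise"
    and measure_noise_residues:
      "measure noise {u \<in> space noise. \<forall>z\<in>\<Lambda>. u z mod \<kappa> (x z) = r z} = (\<Prod>z\<in>\<Lambda>. 1 / real (\<kappa> (x z)))"
proof -
  interpret product_prob_space "\<lambda>_::site. uniform_count_measure {..<M}" UNIV
    by (rule product_prob_space_noise)
  interpret noise: prob_space noise by (rule prob_space_noise)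
  let ?R = "\<lambda>z. {v \<in> {..<M}. v mod \<kappa> (x z) = r z}"
  have sp: "space noise = (\<Pi>\<^sub>E z\<in>UNIV. {..<M})"
    unfolding noise_def space_PiM by (simp add: space_uniform_count_measure)
  have eq: "{u \<in> space noise. \<forall>z\<in>\<Lambda>. u z mod \<kappa> (x z) = r z} = {u \<in> space noise. \<forall>z\<in>\<Lambda>. u z \<in> ?R z}"
    unfolding sp by auto
  have R: "?R z \<in> sets (uniform_count_measure {..<M})" for z by (auto simp: sets_uniform_count_measure)
  show "{u \<in> space noise. \<forall>z\<in>\<Lambda>. u z mod \<kappa> (x z) = r z} \<in> sets noise"
    unfolding eq noise_def using fin R by measurable
  have "emeasure noise {u \<in> space noise. \<forall>z\<in>\<Lambda>. u z \<in> ?R z}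
      = (\<Prod>z\<in>\<Lambda>. emeasure (uniform_count_measure {..<M}) (?R z))"
    unfolding noise_def using fin R by (intro emeasure_PiM_Collect) auto
  also have "\<dots> = (\<Prod>z\<in>\<Lambda>. ennreal (1 / real (\<kappa> (x z))))"
  proof (rule prod.cong[OF refl])
    fix z assume z: "z \<in> \<Lambda>"
    have k: "\<kappa> (x z) dvd M" "0 < \<kappa> (x z)" using x X_letter \<kappa>_dvd \<kappa>_pos by auto
    have "emeasure (uniform_count_measure {..<M}) (?R z) = ennreal (real (card (?R z)) / real M)"
      by (subst emeasure_uniform_count_measure) auto
    also have "real (card (?R z)) / real M = 1 / real (\<kappa> (x z))"
      unfolding card_residue_class[OF k(1) r[OF z]] using k M_pos by (simp add: real_of_nat_div)
    finally show "emeasure (uniform_count_measure {..<M}) (?R z) = ennreal (1 / real (\<kappa> (x z)))" .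
  qed
  also have "\<dots> = ennreal (\<Prod>z\<in>\<Lambda>. 1 / real (\<kappa> (x z)))" by (rule prod_ennreal) simp
  finally show "measure noise {u \<in> space noise. \<forall>z\<in>\<Lambda>. u z mod \<kappa> (x z) = r z} = (\<Prod>z\<in>\<Lambda>. 1 / real (\<kappa> (x z)))"
    unfolding eq noise.emeasure_eq_measure by (subst (asm) ennreal_inj) (auto intro!: prod_nonneg)
qed

lemma split_by_Y: "x \<in> X \<Longrightarrow> split_by (x, u) \<in> Y"
  unfolding split_by_def fst_conv snd_conv by (intro Y_I) (simp_all add: \<kappa>_pos X_letter)

text \<open>
  The preimage of a cylinder is a rectangle, so its measure is a product: the colors are constrained by \<open>\<nu>\<close>,
  the residues by the noise.
\<close>
lemma split_by_vimage_cylinder: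
  assumes "y \<in> Y"
  shows "split_by -` cylinder Y \<Lambda> (restrict y \<Lambda>) \<inter> X \<times> space noise
    = cylinder X \<Lambda> (restrict (color_proj y) \<Lambda>)
      \<times> {u \<in> space noise. \<forall>z\<in>\<Lambda>. u z mod \<kappa> (color_proj y z) = snd (y z)}"
  by (auto simp: cylinder_def restrict_eq_iff split_by_Y) (auto simp: split_by_def color_proj_def prod_eq_iff)

lemma split_by_measurable: "split_by \<in> measurable (config_borel A X \<Otimes>\<^sub>M noise) (config_borel A' Y)"
proof (rule Y.measurable_config_borel)
  show "split_by \<in> space (config_borel A X \<Otimes>\<^sub>M noise) \<rightarrow> Y"
    by (auto simp: space_pair_measure split_by_Y)
  fix n a assume "a \<in> patches Y (box n)"
  then obtain y where y: "y \<in> Y" "a = restrict y (box n)" by (auto simp: patches_def)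
  have "{u \<in> space noise. \<forall>z\<in>box n. u z mod \<kappa> (color_proj y z) = snd (y z)} \<in> sets noise"
    using y(1) by (intro sets_noise_residues color_Y) (auto simp: Y_iff color_proj_def)
  then show "split_by -` cylinder Y (box n) a \<inter> space (config_borel A X \<Otimes>\<^sub>M noise)
      \<in> sets (config_borel A X \<Otimes>\<^sub>M noise)"
    unfolding space_pair_measure space_config_borel y(2) split_by_vimage_cylinder[OF y(1)]
    by (intro pair_measureI sets_cylinder finite_box)
qed

lemma split_by_measurable_prob:
  assumes "config_prob \<nu>"
  shows "split_by \<in> measurable (\<nu> \<Otimes>\<^sub>M noise) (config_borel A' Y)"
proof -
  have "sets (\<nu> \<Otimes>\<^sub>M noise) = sets (config_borel A X \<Otimes>\<^sub>M noise)"
    using assms by (intro sets_pair_measure_cong) (simp_all add: config_prob_def)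
  then show ?thesis using split_by_measurable measurable_cong_sets by blast
qed

lemma lift_measure_prob:
  assumes \<nu>: "config_prob \<nu>"
  shows "Y.config_prob (lift_measure \<nu>)"
proof -
  interpret \<nu>: prob_space \<nu> using \<nu> by (simp add: config_prob_def)
  interpret noise: prob_space noise by (rule prob_space_noise)
  interpret pair_prob_space \<nu> noise ..
  show ?thesis using split_by_measurable_prob[OF \<nu>]
    by (simp add: Y.config_prob_def lift_measure_def prob_space_distr)
qed

lemma lift_measure_uniform_lift:
  assumes \<nu>: "config_prob \<nu>"
  shows "uniform_lift (lift_measure \<nu>) \<nu>"
  unfolding uniform_lift_def
proof (intro allI impI ballI)
  fix \<Lambda> y assume fin: "finite (\<Lambda> :: site set)" and y: "y \<in> Y"
  interpret \<nu>: prob_space \<nu> using \<nu> by (simp add: config_prob_def)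
  interpret noise: prob_space noise by (rule prob_space_noise)
  interpret pair_prob_space \<nu> noise ..
  let ?C = "cylinder X \<Lambda> (restrict (color_proj y) \<Lambda>)"
  let ?R = "{u \<in> space noise. \<forall>z\<in>\<Lambda>. u z mod \<kappa> (color_proj y z) = snd (y z)}"
  have pos: "0 < (\<Prod>z\<in>\<Lambda>. real (\<kappa> (fst (y z))))"
    using \<kappa>_prod_pos[OF color_Y[OF y], of \<Lambda>] by (simp add: color_proj_def)
  have r: "\<And>z. z \<in> \<Lambda> \<Longrightarrow> snd (y z) < \<kappa> (color_proj y z)" using y by (simp add: Y_iff color_proj_def)
  have "Y.pr (lift_measure \<nu>) \<Lambda> y = measure (\<nu> \<Otimes>\<^sub>M noise) (?C \<times> ?R)"
    unfolding block_prob_def lift_measure_def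
    by (subst measure_distr[OF split_by_measurable_prob[OF \<nu>] Y.sets_cylinder[OF fin]])
      (simp add: space_pair_measure config_prob_space[OF \<nu>] split_by_vimage_cylinder[OF y])
  also have "\<dots> = measure \<nu> ?C * measure noise ?R"
  proof -
    have "?C \<in> sets \<nu>" using \<nu> sets_cylinder[OF fin] by (simp add: config_prob_def)
    then have "emeasure (\<nu> \<Otimes>\<^sub>M noise) (?C \<times> ?R) = emeasure \<nu> ?C * emeasure noise ?R"
      using sets_noise_residues[OF fin color_Y[OF y] r] by (rule noise.emeasure_pair_measure_Times)
    then show ?thesis
      by (simp add: emeasure_eq_measure \<nu>.emeasure_eq_measure noise.emeasure_eq_measure flip: ennreal_mult)
  qed
  also have "measure noise ?R = 1 / (\<Prod>z\<in>\<Lambda>. real (\<kappa> (fst (y z))))"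
    using measure_noise_residues[OF fin color_Y[OF y] r] by (simp add: color_proj_def prod_dividef)
  finally have "Y.pr (lift_measure \<nu>) \<Lambda> y
      = pr \<nu> \<Lambda> (color_proj y) / (\<Prod>z\<in>\<Lambda>. real (\<kappa> (fst (y z))))"
    by (simp only: block_prob_def times_divide_eq_right mult_1_right)
  then show "Y.pr (lift_measure \<nu>) \<Lambda> y * (\<Prod>z\<in>\<Lambda>. real (\<kappa> (fst (y z)))) = pr \<nu> \<Lambda> (color_proj y)"
    using pos by (simp del: prod_zero_iff)
qed

lemma continuous_map_color_proj:
  assumes f: "continuous_map (config_topology A X) euclideanreal f"
  shows "continuous_map (config_topology A' Y) euclideanreal (\<lambda>y. f (color_proj y))"
proof (rule Y.continuous_map_if_uniformly_local)
  fix e :: real assume "0 < e"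
  then obtain n where n: "\<And>x y. x \<in> X \<Longrightarrow> y \<in> X \<Longrightarrow> restrict x (box n) = restrict y (box n) \<Longrightarrow> \<bar>f x - f y\<bar> < e"
    using continuous_map_uniformly_local[OF f] by metis
  have "\<bar>f (color_proj x) - f (color_proj y)\<bar> < e"
    if "x \<in> Y" "y \<in> Y" "restrict x (box n) = restrict y (box n)" for x y
    using that by (intro n color_Y) (simp_all add: restrict_eq_iff color_proj_def)
  then show "\<exists>n. \<forall>x\<in>Y. \<forall>y\<in>Y. restrict x (box n) = restrict y (box n) \<longrightarrow> \<bar>f (color_proj x) - f (color_proj y)\<bar> < e"
    by blast
qed

lemma integral_color_pushforward:
  assumes \<mu>: "Y.config_prob \<mu>" and f: "continuous_map (config_topology A X) euclideanreal f"
  shows "integral\<^sup>L (push \<mu>) f = integral\<^sup>L \<mu> (\<lambda>y. f (color_proj y))"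
  unfolding color_pushforward_def
proof (rule integral_distr)
  show "color_proj \<in> measurable \<mu> (config_borel A X)"
    using color_proj_measurable by (simp add: Y.measurable_config_prob[OF \<mu>])
qed (rule continuous_map_measurable[OF f])

text \<open>
  The operator on test functions whose dual is \<open>lift_measure\<close>.
\<close>
definition noise_average :: "(('a \<times> nat) config \<Rightarrow> real) \<Rightarrow> 'a config \<Rightarrow> real" where
  "noise_average g x = (\<integral>u. g (split_by (x, u)) \<partial>noise)"

lemma integrable_split_by:
  assumes g: "continuous_map (config_topology A' Y) euclideanreal g" and x: "x \<in> X"
  shows "integrable noise (\<lambda>u. g (split_by (x, u)))"
proof -
  interpret noise: prob_space noise by (rule prob_space_noise)
  obtain C where C: "\<And>y. y \<in> Y \<Longrightarrow> \<bar>g y\<bar> \<le> C" using Y.continuous_map_bounded[OF g] by metis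
  have "(\<lambda>u. (x, u)) \<in> measurable noise (config_borel A X \<Otimes>\<^sub>M noise)"
    by (rule measurable_Pair1') (simp add: x)
  then have "(\<lambda>u. g (split_by (x, u))) \<in> borel_measurable noise"
    by (rule measurable_compose[OF measurable_compose[OF _ split_by_measurable] Y.continuous_map_measurable[OF g]])
  then show ?thesis
    using C split_by_Y[OF x] by (intro noise.integrable_const_bound[of _ C]) auto
qed

text \<open>
  Configurations that agree on a box still agree there after both are split by the same labels, so averaging
  over the labels does not spoil the uniform locality of \<open>g\<close>.
\<close>
lemma continuous_map_noise_average:
  assumes g: "continuous_map (config_topology A' Y) euclideanreal g"
  shows "continuous_map (config_topology A X) euclideanreal (noise_average g)"
proof (rule continuous_map_if_uniformly_local)
  interpret noise: prob_space noise by (rule prob_space_noise)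
  fix e :: real assume e: "0 < e"
  then obtain n where n: "\<And>x y. x \<in> Y \<Longrightarrow> y \<in> Y \<Longrightarrow> restrict x (box n) = restrict y (box n) \<Longrightarrow> \<bar>g x - g y\<bar> < e / 2"
    using Y.continuous_map_uniformly_local[OF g, of "e / 2"] by (metis half_gt_zero)
  have "\<bar>noise_average g x - noise_average g y\<bar> < e"
    if xy: "x \<in> X" "y \<in> X" "restrict x (box n) = restrict y (box n)" for x y
  proof -
    let ?d = "\<lambda>u. g (split_by (x, u)) - g (split_by (y, u))"
    have d: "\<bar>?d u\<bar> < e / 2" for u
      using xy by (intro n split_by_Y) (simp_all add: restrict_eq_iff split_by_def)
    have minus_le: "- (e / 2) \<le> ?d u" for u using d[of u] by linarith
    have int: "integrable noise ?d"
      using integrable_split_by[OF g xy(1)] integrable_split_by[OF g xy(2)] by (rule Bochner_Integration.integrable_diff)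
    have "noise_average g x - noise_average g y = integral\<^sup>L noise ?d"
      unfolding noise_average_def
      using integrable_split_by[OF g xy(1)] integrable_split_by[OF g xy(2)]
      by (rule Bochner_Integration.integral_diff[symmetric])
    moreover have "integral\<^sup>L noise ?d \<le> e / 2"
      by (rule noise.integral_le_const[OF int], rule AE_I2, rule order_trans[OF abs_ge_self less_imp_le[OF d]])
    moreover have "- (e / 2) \<le> integral\<^sup>L noise ?d"
      by (rule noise.integral_ge_const[OF int], rule AE_I2, rule minus_le)
    ultimately show ?thesis using e by linarith
  qed
  then show "\<exists>n. \<forall>x\<in>X. \<forall>y\<in>X. restrict x (box n) = restrict y (box n) \<longrightarrow> \<bar>noise_average g x - noise_average g y\<bar> < e"
    by blast
qed

lemma integral_lift_measure:
  assumes \<nu>: "config_prob \<nu>" and g: "continuous_map (config_topology A' Y) euclideanreal g"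
  shows "integral\<^sup>L (lift_measure \<nu>) g = integral\<^sup>L \<nu> (noise_average g)"
proof -
  interpret \<nu>: prob_space \<nu> using \<nu> by (simp add: config_prob_def)
  interpret noise: prob_space noise by (rule prob_space_noise)
  interpret pair_prob_space \<nu> noise ..
  obtain C where C: "\<And>y. y \<in> Y \<Longrightarrow> \<bar>g y\<bar> \<le> C" using Y.continuous_map_bounded[OF g] by metis
  have sp: "space (\<nu> \<Otimes>\<^sub>M noise) = X \<times> space noise" by (simp add: space_pair_measure config_prob_space[OF \<nu>])
  have int: "integrable (\<nu> \<Otimes>\<^sub>M noise) (\<lambda>p. g (split_by p))"
  proof (rule integrable_const_bound[of _ C])
    show "AE p in \<nu> \<Otimes>\<^sub>M noise. norm (g (split_by p)) \<le> C"
      using C split_by_Y by (intro AE_I2) (auto simp: sp)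
    show "(\<lambda>p. g (split_by p)) \<in> borel_measurable (\<nu> \<Otimes>\<^sub>M noise)"
      by (rule measurable_compose[OF split_by_measurable_prob[OF \<nu>] Y.continuous_map_measurable[OF g]])
  qed
  have "integral\<^sup>L (lift_measure \<nu>) g = integral\<^sup>L (\<nu> \<Otimes>\<^sub>M noise) (\<lambda>p. g (split_by p))"
    unfolding lift_measure_def
    by (rule integral_distr[OF split_by_measurable_prob[OF \<nu>] Y.continuous_map_measurable[OF g]])
  also have "\<dots> = integral\<^sup>L \<nu> (noise_average g)"
    unfolding noise_average_def by (rule integral_fst'[OF int, symmetric])
  finally show ?thesis .
qed

section \<open>The color projection on Gibbs measures\<close>
text \<open>
  The inverse is \<open>lift_measure\<close>: a uniform Gibbs measure is a uniform lift of its projection, and a uniform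
  lift is determined by its projection. Both maps are dual to operators on continuous functions, namely
  composition with the projection and averaging over the labels.
\<close>
theorem color_pushforward_homeomorphic:
  "homeomorphic_map
     (subtopology (weak_topology A' Y) {\<mu> \<in> invariant_measures A' Y. Y.gibbs (\<lambda>_. 1) \<mu>})
     (subtopology (weak_topology A X) {\<nu> \<in> invariant_measures A X. gibbs (\<lambda>a. real (\<kappa> a)) \<nu>})
     (push)"
proof -
  let ?E = "{\<mu> \<in> invariant_measures A' Y. Y.gibbs (\<lambda>_. 1) \<mu>}"
  let ?F = "{\<nu> \<in> invariant_measures A X. gibbs (\<lambda>a. real (\<kappa> a)) \<nu>}"
  have push: "push \<mu> \<in> ?F" "lift_measure (push \<mu>) = \<mu>" if "\<mu> \<in> ?E" for \<mu>
  proof -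
    have inv: "\<mu> \<in> invariant_measures A' Y" and g: "Y.gibbs (\<lambda>_. 1) \<mu>" using that by auto
    have \<mu>: "Y.config_prob \<mu>" by (rule Y.invariant_config_prob[OF inv])
    have lift: "uniform_lift \<mu> (push \<mu>)" by (rule gibbs_uniform_lift[OF \<mu> g])
    show "push \<mu> \<in> ?F"
      using color_pushforward_invariant[OF inv] uniform_lift_gibbs_iff[OF lift] g by simp
    have \<nu>: "config_prob (push \<mu>)" by (rule color_pushforward_prob[OF \<mu>])
    show "lift_measure (push \<mu>) = \<mu>"
      by (rule uniform_lift_unique[OF lift_measure_prob[OF \<nu>] \<mu> lift_measure_uniform_lift[OF \<nu>] lift])
  qed
  have lift: "lift_measure \<nu> \<in> ?E" "push (lift_measure \<nu>) = \<nu>" if "\<nu> \<in> ?F" for \<nu>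
  proof -
    have inv: "\<nu> \<in> invariant_measures A X" and g: "gibbs (\<lambda>a. real (\<kappa> a)) \<nu>" using that by auto
    have \<nu>: "config_prob \<nu>" by (rule invariant_config_prob[OF inv])
    note l = lift_measure_uniform_lift[OF \<nu>]
    show "lift_measure \<nu> \<in> ?E"
      using uniform_lift_invariant[OF lift_measure_prob[OF \<nu>] inv l] uniform_lift_gibbs_iff[OF l] g by simp
    show "push (lift_measure \<nu>) = \<nu>"
      by (rule uniform_lift_pushforward[OF lift_measure_prob[OF \<nu>] \<nu> l])
  qed
  have "continuous_map (subtopology (weak_topology A' Y) ?E) (weak_topology A X) (push)"
  proof (rule continuous_map_weak_topology)
    fix f assume f: "continuous_map (config_topology A X) euclideanreal f"
    show "\<exists>g. continuous_map (config_topology A' Y) euclideanreal g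
        \<and> (\<forall>\<mu>\<in>?E. integral\<^sup>L (push \<mu>) f = integral\<^sup>L \<mu> g)"
      using continuous_map_color_proj[OF f] integral_color_pushforward[OF Y.invariant_config_prob f] by blast
  qed (use color_pushforward_invariant in auto)
  then have 1: "continuous_map (subtopology (weak_topology A' Y) ?E) (subtopology (weak_topology A X) ?F) (push)"
    using push(1) by (intro continuous_map_into_subtopology) (auto simp: topspace_weak_topology)
  have "continuous_map (subtopology (weak_topology A X) ?F) (weak_topology A' Y) lift_measure"
  proof (rule continuous_map_weak_topology)
    fix g assume g: "continuous_map (config_topology A' Y) euclideanreal g"
    show "\<exists>f. continuous_map (config_topology A X) euclideanreal f
        \<and> (\<forall>\<nu>\<in>?F. integral\<^sup>L (lift_measure \<nu>) g = integral\<^sup>L \<nu> f)"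
      using continuous_map_noise_average[OF g] integral_lift_measure[OF invariant_config_prob g] by blast
  qed (use lift(1) in auto)
  then have 2: "continuous_map (subtopology (weak_topology A X) ?F) (subtopology (weak_topology A' Y) ?E) lift_measure"
    using lift(1) by (intro continuous_map_into_subtopology) (auto simp: topspace_weak_topology)
  have "homeomorphic_maps (subtopology (weak_topology A' Y) ?E) (subtopology (weak_topology A X) ?F)
      (push) lift_measure"
    unfolding homeomorphic_maps_def using 1 2 push(2) lift(2) by simp
  then show ?thesis unfolding homeomorphic_map_maps by blast
qed

end

section \<open>Convex combinations\<close>
lemma sets_convex_comb [simp]: "sets (convex_comb t \<mu> \<nu>) = sets \<mu>"
  and space_convex_comb [simp]: "space (convex_comb t \<mu> \<nu>) = space \<mu>"
  by (simp_all add: convex_comb_def)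

lemma emeasure_convex_comb:
  assumes sets: "sets \<nu> = sets \<mu>" and C: "C \<in> sets \<mu>"
  shows "emeasure (convex_comb t \<mu> \<nu>) C = ennreal t * emeasure \<mu> C + ennreal (1 - t) * emeasure \<nu> C"
  unfolding convex_comb_def
proof (rule emeasure_measure_of_sigma)
  show "sigma_algebra (space \<mu>) (sets \<mu>)" by (rule sets.sigma_algebra_axioms)
  show "positive (sets \<mu>) (\<lambda>C. ennreal t * emeasure \<mu> C + ennreal (1 - t) * emeasure \<nu> C)"
    by (simp add: positive_def)
  show "countably_additive (sets \<mu>) (\<lambda>C. ennreal t * emeasure \<mu> C + ennreal (1 - t) * emeasure \<nu> C)"
  proof (rule countably_additiveI)
    fix D :: "nat \<Rightarrow> _" assume "range D \<subseteq> sets \<mu>" "disjoint_family D" "\<Union> (range D) \<in> sets \<mu>"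
    then show "(\<Sum>i. ennreal t * emeasure \<mu> (D i) + ennreal (1 - t) * emeasure \<nu> (D i))
        = ennreal t * emeasure \<mu> (\<Union> (range D)) + ennreal (1 - t) * emeasure \<nu> (\<Union> (range D))"
      by (simp add: suminf_add[symmetric] suminf_emeasure sets)
  qed
qed (rule C)

lemma (in split_sft) color_pushforward_convex_comb:
  assumes \<mu>: "Y.config_prob \<mu>" and \<nu>: "Y.config_prob \<nu>"
  shows "push (convex_comb t \<mu> \<nu>)
    = convex_comb t (push \<mu>) (push \<nu>)"
proof (rule measure_eqI)
  show "sets (push (convex_comb t \<mu> \<nu>))
      = sets (convex_comb t (push \<mu>) (push \<nu>))"
    by (simp add: color_pushforward_def)
  fix C assume "C \<in> sets (push (convex_comb t \<mu> \<nu>))"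
  then have C: "C \<in> sets (config_borel A X)" by (simp add: color_pushforward_def)
  have m: "color_proj \<in> measurable \<rho> (config_borel A X)" if "sets \<rho> = sets (config_borel A' Y)" for \<rho>
    using color_proj_measurable measurable_cong_sets[OF that refl] by blast
  have s: "sets \<mu> = sets (config_borel A' Y)" "sets \<nu> = sets (config_borel A' Y)"
    using \<mu> \<nu> by (simp_all add: Y.config_prob_def)
  have sp: "space \<mu> = Y" "space \<nu> = Y" using Y.config_prob_space \<mu> \<nu> by auto
  have pre: "color_proj -` C \<inter> Y \<in> sets \<mu>" using measurable_sets[OF m[OF s(1)] C] by (simp add: sp)
  show "emeasure (push (convex_comb t \<mu> \<nu>)) C
      = emeasure (convex_comb t (push \<mu>) (push \<nu>)) C"
    using C pre
    by (simp add: emeasure_convex_comb color_pushforward_def emeasure_distr m s sp)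
qed

section \<open>Measures of maximal entropy and equilibrium states\<close>
theorem theorem1:
  fixes A :: "'a set" and L :: "'a config set"
    and \<Phi> :: "'a \<Rightarrow> real" and \<epsilon> :: real and S :: "nat set" and N :: nat
  defines "X \<equiv> subshift A L"
    and "A\<^sub>N \<equiv> split_alphabet A \<Phi> \<epsilon> S N"
    and "X\<^sub>N \<equiv> split_subshift A L \<Phi> \<epsilon> S N"
    and "\<beta> \<equiv> ln (real N) / \<epsilon>"
  assumes "finite A"
    and "L \<subseteq> cross \<rightarrow>\<^sub>E A"
    and "strongly_irreducible A X"
    and "\<epsilon> > 0"
    and "finite S"
    and "\<Phi> ` A \<subseteq> (\<lambda>s. \<epsilon> * real s) ` S"
    and "N \<ge> 1"
  shows "homeomorphic_map
           (subtopology (weak_topology A\<^sub>N X\<^sub>N) (max_entropy_measures A\<^sub>N X\<^sub>N))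
           (subtopology (weak_topology A X) (equilibrium_states A X \<Phi> \<beta>))
           (color_pushforward A X)
       \<and> (\<forall>\<mu> \<in> max_entropy_measures A\<^sub>N X\<^sub>N. \<forall>\<nu> \<in> max_entropy_measures A\<^sub>N X\<^sub>N. \<forall>t \<in> {0..1}.
           color_pushforward A X (convex_comb t \<mu> \<nu>)
             = convex_comb t (color_pushforward A X \<mu>) (color_pushforward A X \<nu>))"
proof -
  \<comment> \<open>The exponent \<open>s\<close> with \<open>\<Phi> a = \<epsilon> s\<close>.\<close>
  define level where "level = (\<lambda>a. nat \<lfloor>\<Phi> a / \<epsilon>\<rfloor>)"
  define \<kappa> where "\<kappa> = (\<lambda>a. N ^ (Max S - level a))"
  have level: "level a \<in> S" "\<Phi> a = \<epsilon> * real (level a)" if a: "a \<in> A" for a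
  proof -
    have "\<Phi> a \<in> (\<lambda>s. \<epsilon> * real s) ` S" using assms(10) a by blast
    then obtain s where s: "s \<in> S" "\<Phi> a = \<epsilon> * real s" by blast
    then have "level a = s" using \<open>\<epsilon> > 0\<close> by (simp add: level_def)
    then show "level a \<in> S" "\<Phi> a = \<epsilon> * real (level a)" using s by simp_all
  qed
  have level_unique: "level a = s" if "\<Phi> a = \<epsilon> * real s" for a s
    using that \<open>\<epsilon> > 0\<close> by (simp add: level_def)
  interpret split_sft A L \<kappa> "N ^ Max S"
  proof
    show "0 < \<kappa> a" "\<kappa> a dvd N ^ Max S" for a
      using \<open>N \<ge> 1\<close> by (simp_all add: \<kappa>_def le_imp_power_dvd)
  qed (use \<open>finite A\<close> \<open>N \<ge> 1\<close> in auto)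
  have AN: "A\<^sub>N = A'"
  proof (rule set_eqI)
    fix p :: "'a \<times> nat"
    have "p \<in> A\<^sub>N \<longleftrightarrow> (\<exists>s\<in>S. fst p \<in> A \<and> \<Phi> (fst p) = \<epsilon> * real s \<and> snd p < N ^ (Max S - s))"
      by (cases p) (simp add: A\<^sub>N_def split_alphabet_def level_set_def)
    also have "\<dots> \<longleftrightarrow> fst p \<in> A \<and> snd p < \<kappa> (fst p)"
      unfolding \<kappa>_def using level[of "fst p"] level_unique[of "fst p"] by metis
    finally show "p \<in> A\<^sub>N \<longleftrightarrow> p \<in> A'" by (simp add: A'_iff)
  qed
  have XN: "X\<^sub>N = Y"
    unfolding X\<^sub>N_def split_subshift_def split_patches_def L'_def AN[unfolded A\<^sub>N_def] ..
  \<comment> \<open>With \<open>\<beta> = ln N / \<epsilon>\<close> the Boltzmann factor of a letter of level \<open>s\<close> is \<open>N\<close> to the power \<open>- s\<close>, so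
     multiplicities and Boltzmann factors differ by a constant factor.\<close>
  have weight: "real (\<kappa> a) = real N ^ Max S * exp (- \<beta> * \<Phi> a)" if a: "a \<in> A" for a
  proof -
    have "level a \<le> Max S" using \<open>finite S\<close> level(1)[OF a] by simp
    then have "real N ^ (Max S - level a) = real N ^ Max S / real N ^ level a"
      using \<open>N \<ge> 1\<close> by (intro power_diff) auto
    then have "real (\<kappa> a) = real N ^ Max S / real N ^ level a" by (simp add: \<kappa>_def)
    moreover have "exp (- \<beta> * \<Phi> a) = 1 / real N ^ level a"
    proof -
      have "- \<beta> * \<Phi> a = - (real (level a) * ln (real N))"
        using \<open>\<epsilon> > 0\<close> by (simp add: \<beta>_def level(2)[OF a])
      also have "exp \<dots> = inverse (exp (ln (real N)) ^ level a)"
        by (simp only: exp_minus exp_of_nat_mult)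
      finally show ?thesis using \<open>N \<ge> 1\<close> by (simp add: inverse_eq_divide)
    qed
    ultimately show ?thesis by simp
  qed
  have max: "max_entropy_measures A\<^sub>N X\<^sub>N = {\<mu> \<in> invariant_measures A' Y. Y.gibbs (\<lambda>_. 1) \<mu>}"
    unfolding AN XN
    by (rule Y.max_entropy_iff_gibbs[OF strongly_irreducible_split[OF assms(7)[unfolded X_def]]])
  have "gibbs (\<lambda>a. real (\<kappa> a)) \<mu> \<longleftrightarrow> gibbs (\<lambda>a. exp (- \<beta> * \<Phi> a)) \<mu>" for \<mu>
    by (rule gibbs_scale[of "real N ^ Max S"]) (use \<open>N \<ge> 1\<close> weight in auto)
  then have eq: "equilibrium_states A X \<Phi> \<beta> = {\<nu> \<in> invariant_measures A X. gibbs (\<lambda>a. real (\<kappa> a)) \<nu>}"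
    unfolding X_def equilibrium_iff_gibbs by simp
  show ?thesis
  proof (intro conjI ballI)
    show "homeomorphic_map
           (subtopology (weak_topology A\<^sub>N X\<^sub>N) (max_entropy_measures A\<^sub>N X\<^sub>N))
           (subtopology (weak_topology A X) (equilibrium_states A X \<Phi> \<beta>))
           (color_pushforward A X)"
      unfolding max eq unfolding AN XN X_def by (rule color_pushforward_homeomorphic)
    fix \<mu> \<nu> t assume "\<mu> \<in> max_entropy_measures A\<^sub>N X\<^sub>N" "\<nu> \<in> max_entropy_measures A\<^sub>N X\<^sub>N"
    then have "Y.config_prob \<mu>" "Y.config_prob \<nu>" unfolding max by (auto intro: Y.invariant_config_prob)
    then show "color_pushforward A X (convex_comb t \<mu> \<nu>)
        = convex_comb t (color_pushforward A X \<mu>) (color_pushforward A X \<nu>)"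
      unfolding X_def by (rule color_pushforward_convex_comb)
  qed
qed

end
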